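(* Let $m\ge0$ and let $V=(V_{ij})_{i,j=1}^2$ be a $2\times 2$ matrix-valued function on $\mathbb{R}$ (not assumed Hermitian) with $V_{ij}\in L^1(\mathbb{R})+L^\infty_0(\mathbb{R})$ for $i,j=1,2$. Let $H$ be the Dirac operator with potential $V$ (described in the context), and set $$F_V(s):=\sup_{y\in\mathbb{R}}\int_{\mathbb{R}}\|V(x)\|\,e^{-s|x-y|}\,dx,\quad s>0.$$ For $z\in\rho(H_0)=\mathbb{C}\setminus\big((-\infty,-m]\cup[m,\infty)\big)$ let $$\eta(|\Phi(z)|):=\frac1{\sqrt2}\sqrt{1+\frac{|z|^2+m^2}{|z^2-m^2|}} .$$ If $z\in\rho(H_0)$ and $$\eta(|\Phi(z)|)\,F_V\!\left(\operatorname{Im}\sqrt{z^2-m^2}\right)<1,$$ then $z\notin\sigma(H)$. If moreover $m>0$ and the equation $F_V(\mu)=\mu/m$ has a solution $\mu_0\in(-m,m)$ (necessarily $\mu_0>0$, since $F_V$ is defined on $(0,\infty)$), then this solution is unique and $$\sigma(H)\cap\left(-\sqrt{m^2-\mu_0^2},\,\sqrt{m^2-\mu_0^2}\right)=\emptyset.$$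
   Context: Units are chosen so that $\hbar=c=1$. The Hilbert space is $\mathcal{H}=L^2(\mathbb{R})\otimes\mathbb{C}^2=L^2(\mathbb{R};\mathbb{C}^2)$. The free Dirac operator is the selfadjoint operator $H_0=-i\frac{d}{dx}\sigma_1+m\sigma_3$ with domain $H^1(\mathbb{R};\mathbb{C}^2)$, where $\sigma_1=\begin{pmatrix}0&1\\1&0\end{pmatrix}$, $\sigma_3=\begin{pmatrix}1&0\\0&-1\end{pmatrix}$; $R_0(z)=(H_0-z)^{-1}$. $L^\infty_0(\mathbb{R})$ is the space of bounded functions that vanish at infinity. $\|V(x)\|$ is the operator norm of the matrix $V(x)$ on $\mathbb{C}^2$ with Euclidean norm; $V$ is identified with the closed maximal multiplication operator in $\mathcal{H}$. Definition of $H$: let $V=U|V|$ be the polar decomposition and $A:=|V|^{1/2}$, $B:=U|V|^{1/2}$, so $V=BA$. For $z\in\rho(H_0)$, $AR_0(z)$ is bounded and $R_0(z)B$, $AR_0(z)B$ have bounded closures; put $Q(z):=\overline{AR_0(z)B}$. Then $H$ is the closed densely defined extension of $H_0+V$ with $\rho(H)\cap\rho(H_0)=\{z\in\rho(H_0): -1\in\rho(Q(z))\}\neq\emptyset$ and, for $z$ in this set, $(H-z)^{-1}=R_0(z)-\overline{R_0(z)B}\,(I+Q(z))^{-1}AR_0(z)$. If $V$ is bounded, $H=H_0+V$ on the domain of $H_0$. The branch of $\sqrt{z^2-m^2}$, $z\in\rho(H_0)$, is chosen such that $\operatorname{Im}\sqrt{z^2-m^2}>0$. The symbol $\eta(|\Phi(z)|)$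 equals $\eta(s)=\sqrt{\frac12+\frac14(s+s^{-1})}$ evaluated at $s=|\Phi(z)|$, $\Phi(z)=\frac{z+m}{z-m}$. *)

theory Defs
  imports "HOL-Analysis.Analysis"
begin

section \<open>The Hilbert space of square-integrable spinors\<close>

text \<open>Elements are classes modulo equality almost everywhere.  Borel representatives suffice:
  every Lebesgue measurable function agrees almost everywhere with a Borel measurable one.\<close>

definition sq_integrable :: "(real \<Rightarrow> complex^2) \<Rightarrow> bool" where
  "sq_integrable f \<longleftrightarrow> f \<in> borel_measurable lborel \<and> integrable lborel (\<lambda>x. (norm (f x))\<^sup>2)"

definition l2_rel :: "(real \<Rightarrow> complex^2) \<Rightarrow> (real \<Rightarrow> complex^2) \<Rightarrow> bool" where
  "l2_rel f g \<longleftrightarrow> sq_integrable f \<and> sq_integrable g \<and> (AE x in lborel. f x = g x)"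

lemma sq_integrable_zero: "sq_integrable (\<lambda>x. 0)"
  by (simp add: sq_integrable_def)

quotient_type l2 = "real \<Rightarrow> complex^2" / partial: l2_rel
proof (rule part_equivpI)
  show "\<exists>f. l2_rel f f"
    using sq_integrable_zero by (auto simp: l2_rel_def)
  show "symp l2_rel"
    by (auto simp: symp_def l2_rel_def elim: AE_mp)
  show "transp l2_rel"
    unfolding transp_def l2_rel_def by auto
qed

lemma sq_integrable_add:
  assumes "sq_integrable f" "sq_integrable g"
  shows "sq_integrable (\<lambda>x. f x + g x)"
proof -
  have [measurable]: "f \<in> borel_measurable lborel" "g \<in> borel_measurable lborel"
    using assms by (auto simp: sq_integrable_def)
  have "integrable lborel (\<lambda>x. (norm (f x + g x))\<^sup>2)"
  proof (rule Bochner_Integration.integrable_bound)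
    show "integrable lborel (\<lambda>x. 2 * (norm (f x))\<^sup>2 + 2 * (norm (g x))\<^sup>2)"
      using assms by (auto simp: sq_integrable_def)
    have "(norm (f x + g x))\<^sup>2 \<le> 2 * (norm (f x))\<^sup>2 + 2 * (norm (g x))\<^sup>2" for x
    proof -
      have "(norm (f x + g x))\<^sup>2 \<le> (norm (f x) + norm (g x))\<^sup>2"
        by (intro power_mono norm_triangle_ineq) simp
      also have "\<dots> \<le> 2 * (norm (f x))\<^sup>2 + 2 * (norm (g x))\<^sup>2"
        using sum_squares_bound[of "norm (f x)" "norm (g x)"] by (simp add: power2_sum)
      finally show ?thesis .
    qed
    then show "AE x in lborel. norm ((norm (f x + g x))\<^sup>2)
        \<le> norm (2 * (norm (f x))\<^sup>2 + 2 * (norm (g x))\<^sup>2)"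
      by simp
  qed measurable
  then show ?thesis
    by (simp add: sq_integrable_def)
qed

lemma sq_integrable_scaleR: "sq_integrable f \<Longrightarrow> sq_integrable (\<lambda>x. r *\<^sub>R f x)"
  by (auto simp: sq_integrable_def power_mult_distrib)

lemma sq_integrable_minus: "sq_integrable f \<Longrightarrow> sq_integrable (\<lambda>x. - f x)"
  using sq_integrable_scaleR[of f "-1"] by simp

lemma sq_integrable_diff:
  "sq_integrable f \<Longrightarrow> sq_integrable g \<Longrightarrow> sq_integrable (\<lambda>x. f x - g x)"
  using sq_integrable_add[of f "\<lambda>x. - g x"] sq_integrable_minus[of g] by simp

lemma norm_vector_scalar_mult: "norm (z *s v) = cmod z * norm (v :: complex^'n)"
  by (simp add: norm_vec_def L2_set_def norm_mult power_mult_distrib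
      flip: sum_distrib_left real_sqrt_mult)
    (simp add: real_sqrt_mult)

lemma borel_measurable_vector_scalar_mult:
  assumes "f \<in> borel_measurable M"
  shows "(\<lambda>x. z *s (f x :: complex^2)) \<in> borel_measurable M"
proof -
  have "bounded_linear (\<lambda>v :: complex^2. z *s v)"
    by (rule bounded_linear_intro[where K = "cmod z"])
      (auto simp: vec_eq_iff norm_vector_scalar_mult algebra_simps)
  then have "continuous_on UNIV (\<lambda>v :: complex^2. z *s v)"
    by (rule linear_continuous_on)
  then show ?thesis
    using assms by (rule borel_measurable_continuous_on)
qed

lemma sq_integrable_scaleC: "sq_integrable f \<Longrightarrow> sq_integrable (\<lambda>x. z *s f x)"
  by (auto simp: sq_integrable_def norm_vector_scalar_mult power_mult_distrib
      intro: borel_measurable_vector_scalar_mult)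

lemma integrable_inner_sq_integrable:
  assumes "sq_integrable f" "sq_integrable g"
  shows "integrable lborel (\<lambda>x. inner (f x) (g x))"
proof (rule Bochner_Integration.integrable_bound)
  have [measurable]: "f \<in> borel_measurable lborel" "g \<in> borel_measurable lborel"
    using assms by (auto simp: sq_integrable_def)
  show "integrable lborel (\<lambda>x. (norm (f x))\<^sup>2 + (norm (g x))\<^sup>2)"
    using assms by (auto simp: sq_integrable_def)
  show "(\<lambda>x. inner (f x) (g x)) \<in> borel_measurable lborel"
    by measurable
  have "norm (inner (f x) (g x)) \<le> norm ((norm (f x))\<^sup>2 + (norm (g x))\<^sup>2)" for x
  proof -
    have "\<bar>inner (f x) (g x)\<bar> \<le> norm (f x) * norm (g x)"
      by (rule Cauchy_Schwarz_ineq2)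
    also have "\<dots> \<le> (norm (f x))\<^sup>2 + (norm (g x))\<^sup>2"
      using sum_squares_bound[of "norm (f x)" "norm (g x)"]
        mult_nonneg_nonneg[OF norm_ge_zero[of "f x"] norm_ge_zero[of "g x"]]
      by linarith
    finally show ?thesis by simp
  qed
  then show "AE x in lborel. norm (inner (f x) (g x)) \<le> norm ((norm (f x))\<^sup>2 + (norm (g x))\<^sup>2)"
    by simp
qed

text \<open>The real inner product below is the real part of the sesquilinear one, so that
  \<open>norm\<close> is the usual Hilbert space norm; the complex structure is \<open>scaleC\<close>.\<close>

instantiation l2 :: real_inner
begin

lift_definition zero_l2 :: l2 is "\<lambda>x. 0"
  by (simp add: l2_rel_def sq_integrable_zero)

lift_definition plus_l2 :: "l2 \<Rightarrow> l2 \<Rightarrow> l2" is "\<lambda>f g x. f x + g x"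
  by (auto simp: l2_rel_def sq_integrable_add)

lift_definition uminus_l2 :: "l2 \<Rightarrow> l2" is "\<lambda>f x. - f x"
  by (auto simp: l2_rel_def sq_integrable_minus)

lift_definition minus_l2 :: "l2 \<Rightarrow> l2 \<Rightarrow> l2" is "\<lambda>f g x. f x - g x"
  by (auto simp: l2_rel_def sq_integrable_diff)

lift_definition scaleR_l2 :: "real \<Rightarrow> l2 \<Rightarrow> l2" is "\<lambda>r f x. r *\<^sub>R f x"
  by (auto simp: l2_rel_def sq_integrable_scaleR elim: AE_mp)

lift_definition inner_l2 :: "l2 \<Rightarrow> l2 \<Rightarrow> real" is "\<lambda>f g. LINT x|lborel. inner (f x) (g x)"
  by (rule integral_cong_AE) (auto simp: l2_rel_def sq_integrable_def)

definition norm_l2 :: "l2 \<Rightarrow> real" where "norm_l2 f = sqrt (inner f f)"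
definition dist_l2 :: "l2 \<Rightarrow> l2 \<Rightarrow> real" where "dist_l2 f g = norm (f - g)"
definition sgn_l2 :: "l2 \<Rightarrow> l2" where "sgn_l2 f = inverse (norm f) *\<^sub>R f"
definition uniformity_l2 :: "(l2 \<times> l2) filter" where
  "uniformity_l2 = (INF e\<in>{0<..}. principal {(f, g). dist f g < e})"
definition open_l2 :: "l2 set \<Rightarrow> bool" where
  "open_l2 S \<longleftrightarrow> (\<forall>f\<in>S. \<forall>\<^sub>F (f', g) in uniformity. f' = f \<longrightarrow> g \<in> S)"

instance
proof
  fix f g h :: l2 and r s :: real
  show "f + g + h = f + (g + h)"
    by transfer (auto simp: l2_rel_def sq_integrable_add add.assoc)
  show "f + g = g + f"
    by transfer (auto simp: l2_rel_def sq_integrable_add add.commute)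
  show "0 + f = f"
    by transfer (auto simp: l2_rel_def)
  show "- f + f = 0"
    by transfer (auto simp: l2_rel_def sq_integrable_zero)
  show "f - g = f + - g"
    by transfer (auto simp: l2_rel_def sq_integrable_diff)
  show "r *\<^sub>R (f + g) = r *\<^sub>R f + r *\<^sub>R g"
    by transfer (auto simp: l2_rel_def sq_integrable_add sq_integrable_scaleR scaleR_add_right)
  show "(r + s) *\<^sub>R f = r *\<^sub>R f + s *\<^sub>R f"
    by transfer (auto simp: l2_rel_def sq_integrable_add sq_integrable_scaleR scaleR_add_left
        intro: sq_integrable_scaleR[of _ "_ + _", simplified scaleR_add_left])
  show "r *\<^sub>R s *\<^sub>R f = (r * s) *\<^sub>R f"
    by transfer (auto simp: l2_rel_def sq_integrable_scaleR)
  show "1 *\<^sub>R f = f"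
    by transfer (auto simp: l2_rel_def)
  show "dist f g = norm (f - g)" by (rule dist_l2_def)
  show "sgn f = inverse (norm f) *\<^sub>R f" by (rule sgn_l2_def)
  show "uniformity = (INF e\<in>{0<..}. principal {(f, g::l2). dist f g < e})"
    by (rule uniformity_l2_def)
  show "open S \<longleftrightarrow> (\<forall>f\<in>S. \<forall>\<^sub>F (f', g) in uniformity. f' = f \<longrightarrow> g \<in> S)" for S :: "l2 set"
    by (rule open_l2_def)
  show "inner f g = inner g f"
    by transfer (simp add: inner_commute)
  show "inner (f + g) h = inner f h + inner g h"
    by transfer (simp add: l2_rel_def inner_add_left integrable_inner_sq_integrable)
  show "inner (r *\<^sub>R f) g = r * inner f g"
    by transfer simp
  show "0 \<le> inner f f"
    by transfer (auto intro: integral_nonneg_AE)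
  show "inner f f = 0 \<longleftrightarrow> f = 0"
  proof transfer
    fix f :: "real \<Rightarrow> complex^2"
    assume "l2_rel f f"
    then have f: "sq_integrable f" by (simp add: l2_rel_def)
    have "(LINT x|lborel. inner (f x) (f x)) = 0 \<longleftrightarrow> (AE x in lborel. inner (f x) (f x) = 0)"
      by (rule integral_nonneg_eq_0_iff_AE) (auto intro: integrable_inner_sq_integrable f)
    then show "(LINT x|lborel. inner (f x) (f x)) = 0 \<longleftrightarrow> l2_rel f (\<lambda>x. 0)"
      using f by (simp add: l2_rel_def sq_integrable_zero)
  qed
  show "norm f = sqrt (inner f f)" by (rule norm_l2_def)
qed

end

lift_definition scaleC :: "complex \<Rightarrow> l2 \<Rightarrow> l2" is "\<lambda>z f x. z *s f x"
  by (auto simp: l2_rel_def sq_integrable_scaleC elim: AE_mp)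


section \<open>Unbounded operators\<close>

text \<open>An operator is identified with its graph; \<open>converse\<close>, \<open>closure\<close> and set inclusion are
  then the inverse, the closure and the extension relation of operators.\<close>

type_synonym l2_op = "(l2 \<times> l2) set"

definition linear_op :: "l2_op \<Rightarrow> bool" where
  "linear_op T \<longleftrightarrow> single_valued T \<and> (0, 0) \<in> T
     \<and> (\<forall>(f, g) \<in> T. \<forall>(f', g') \<in> T. (f + f', g + g') \<in> T)
     \<and> (\<forall>c. \<forall>(f, g) \<in> T. (scaleC c f, scaleC c g) \<in> T)"

definition densely_defined :: "l2_op \<Rightarrow> bool" where
  "densely_defined T \<longleftrightarrow> closure (Domain T) = UNIV"

definition op_add :: "l2_op \<Rightarrow> l2_op \<Rightarrow> l2_op" (infixl "[+]" 65) where
  "S [+] T = {(f, g + h) | f g h. (f, g) \<in> S \<and> (f, h) \<in> T}"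

definition op_diff :: "l2_op \<Rightarrow> l2_op \<Rightarrow> l2_op" (infixl "[-]" 65) where
  "S [-] T = {(f, g - h) | f g h. (f, g) \<in> S \<and> (f, h) \<in> T}"

definition op_comp :: "l2_op \<Rightarrow> l2_op \<Rightarrow> l2_op" (infixr "[*]" 70) where
  "S [*] T = T O S"

definition op_scalar :: "complex \<Rightarrow> l2_op" where
  "op_scalar z = {(f, scaleC z f) | f. True}"

definition bounded_everywhere :: "l2_op \<Rightarrow> bool" where
  "bounded_everywhere T \<longleftrightarrow> (\<exists>R. bounded_linear R \<and> T = {(f, R f) | f. True})"

definition resolvent :: "l2_op \<Rightarrow> complex \<Rightarrow> l2_op" where
  "resolvent T z = (T [-] op_scalar z)\<inverse>"

definition resolvent_set :: "l2_op \<Rightarrow> complex set" where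
  "resolvent_set T = {z. bounded_everywhere (resolvent T z)}"

definition spectrum :: "l2_op \<Rightarrow> complex set" where
  "spectrum T = - resolvent_set T"

text \<open>The maximal operator of multiplication by a matrix-valued function.\<close>

definition mult_op :: "(real \<Rightarrow> complex^2^2) \<Rightarrow> l2_op" where
  "mult_op M = {(f, g). AE x in lborel. rep_l2 g x = M x *v rep_l2 f x}"


section \<open>The free Dirac operator\<close>

text \<open>As usual in one dimension, compactly supported \<open>C\<^sup>1\<close> functions serve as test functions.\<close>

definition test_function :: "(real \<Rightarrow> real) \<Rightarrow> bool" where
  "test_function \<phi> \<longleftrightarrow> \<phi> C1_differentiable_on UNIV \<and> bounded {x. \<phi> x \<noteq> 0}"

text \<open>The graph of \<open>d/dx\<close>, whose domain is \<open>H\<^sup>1\<close>.\<close>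

definition weak_deriv :: l2_op where
  "weak_deriv = {(f, g). \<forall>\<phi>. test_function \<phi> \<longrightarrow>
     (LINT x|lborel. deriv \<phi> x *\<^sub>R rep_l2 f x) = - (LINT x|lborel. \<phi> x *\<^sub>R rep_l2 g x)}"

definition sigma1 :: "complex^2^2" where
  "sigma1 = vector [vector [0, 1], vector [1, 0]]"

definition sigma3 :: "complex^2^2" where
  "sigma3 = vector [vector [1, 0], vector [0, -1]]"

definition H0 :: "real \<Rightarrow> l2_op" where
  "H0 m = (op_scalar (-\<i>) [*] mult_op (\<lambda>x. sigma1) [*] weak_deriv)
      [+] (op_scalar (of_real m) [*] mult_op (\<lambda>x. sigma3))"

abbreviation R0 :: "real \<Rightarrow> complex \<Rightarrow> l2_op" where
  "R0 m \<equiv> resolvent (H0 m)"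


section \<open>Polar decomposition of the potential\<close>

definition ctranspose :: "complex^2^2 \<Rightarrow> complex^2^2" where
  "ctranspose M = (\<chi> i j. cnj (M $ j $ i))"

definition psd :: "complex^2^2 \<Rightarrow> bool" where
  "psd P \<longleftrightarrow> ctranspose P = P \<and> (\<forall>v. 0 \<le> Re (\<Sum>i\<in>UNIV. cnj (v $ i) * (P *v v) $ i))"

definition psd_sqrt :: "complex^2^2 \<Rightarrow> complex^2^2" where
  "psd_sqrt P = (THE S. psd S \<and> S ** S = P)"

definition mat_abs :: "complex^2^2 \<Rightarrow> complex^2^2" where
  "mat_abs M = psd_sqrt (ctranspose M ** M)"

text \<open>The unique partial isometry \<open>U\<close> with the kernel of \<open>M\<close> and \<open>M = U |M|\<close>.\<close>

definition polar_U :: "complex^2^2 \<Rightarrow> complex^2^2" where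
  "polar_U M = (THE U. U ** ctranspose U ** U = U \<and> (\<forall>v. U *v v = 0 \<longleftrightarrow> M *v v = 0)
     \<and> M = U ** mat_abs M)"

text \<open>The operators \<open>A = |V|\<^bsup>1/2\<^esup>\<close> and \<open>B = U |V|\<^bsup>1/2\<^esup>\<close>; the polar decomposition of a
  multiplication operator is the pointwise one.\<close>

definition opA :: "(real \<Rightarrow> complex^2^2) \<Rightarrow> l2_op" where
  "opA V = mult_op (\<lambda>x. psd_sqrt (mat_abs (V x)))"

definition opB :: "(real \<Rightarrow> complex^2^2) \<Rightarrow> l2_op" where
  "opB V = mult_op (\<lambda>x. polar_U (V x) ** psd_sqrt (mat_abs (V x)))"


section \<open>The perturbed Dirac operator\<close>

definition Q :: "real \<Rightarrow> (real \<Rightarrow> complex^2^2) \<Rightarrow> complex \<Rightarrow> l2_op" where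
  "Q m V z = closure (opA V [*] R0 m z [*] opB V)"

definition good_points :: "real \<Rightarrow> (real \<Rightarrow> complex^2^2) \<Rightarrow> complex set" where
  "good_points m V = {z \<in> resolvent_set (H0 m). -1 \<in> resolvent_set (Q m V z)}"

text \<open>These properties determine \<open>H\<close>, since a single resolvent does.\<close>

definition dirac_operator :: "real \<Rightarrow> (real \<Rightarrow> complex^2^2) \<Rightarrow> l2_op \<Rightarrow> bool" where
  "dirac_operator m V H \<longleftrightarrow>
     linear_op H \<and> closed H \<and> densely_defined H \<and>
     H0 m [+] mult_op V \<subseteq> H \<and>
     resolvent_set H \<inter> resolvent_set (H0 m) = good_points m V \<and>
     good_points m V \<noteq> {} \<and>
     (\<forall>z \<in> good_points m V.
        resolvent H z = R0 m z
          [-] (closure (R0 m z [*] opB V) [*] (op_scalar 1 [+] Q m V z)\<inverse> [*] opA V [*] R0 m z))"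


section \<open>Potentials and the quantities in the eigenvalue bound\<close>

text \<open>Null sets are irrelevant for membership, as a function vanishing almost everywhere is
  integrable; hence the second summand may be bounded and decay everywhere.\<close>

definition L1_plus_L0inf :: "(real \<Rightarrow> complex) set" where
  "L1_plus_L0inf = {\<lambda>x. u x + w x | u w. integrable lebesgue u \<and>
     w \<in> borel_measurable lebesgue \<and> bounded (range w) \<and> (w \<longlongrightarrow> 0) at_infinity}"

text \<open>For entries in \<open>L1_plus_L0inf\<close> the integrals exist and are bounded in \<open>y\<close> when \<open>s > 0\<close>.\<close>

definition F :: "(real \<Rightarrow> complex^2^2) \<Rightarrow> real \<Rightarrow> real" where
  "F V s = (SUP y. LINT x|lebesgue. onorm ((*v) (V x)) * exp (- s * \<bar>x - y\<bar>))"

text \<open>The branch of the square root of \<open>z\<^sup>2 - m\<^sup>2\<close> in the upper half-plane.\<close>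

definition branch_sqrt :: "real \<Rightarrow> complex \<Rightarrow> complex" where
  "branch_sqrt m z = (THE w. w\<^sup>2 = z\<^sup>2 - (of_real m)\<^sup>2 \<and> Im w > 0)"

definition Phi :: "real \<Rightarrow> complex \<Rightarrow> complex" where
  "Phi m z = (z + of_real m) / (z - of_real m)"

definition eta :: "real \<Rightarrow> real" where
  "eta s = sqrt (1/2 + 1/4 * (s + inverse s))"

lemma eta_Phi:
  assumes "z \<noteq> of_real m" "z \<noteq> - of_real m"
  shows "eta (cmod (Phi m z)) =
    1 / sqrt 2 * sqrt (1 + ((cmod z)\<^sup>2 + m\<^sup>2) / cmod (z\<^sup>2 - (of_real m)\<^sup>2))"
proof -
  define p q where "p = cmod (z + of_real m)" and "q = cmod (z - of_real m)"
  have pos: "p \<noteq> 0" "q \<noteq> 0"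
    using assms by (auto simp: p_def q_def add_eq_0_iff2)
  have "(cmod z)\<^sup>2 + m\<^sup>2 = (p\<^sup>2 + q\<^sup>2) / 2"
    unfolding p_def q_def cmod_power2 by (simp add: power2_eq_square algebra_simps)
  moreover have "cmod (z\<^sup>2 - (of_real m)\<^sup>2) = p * q"
  proof -
    have "z\<^sup>2 - (of_real m)\<^sup>2 = (z + of_real m) * (z - of_real m)"
      by (simp add: power2_eq_square algebra_simps)
    then show ?thesis
      by (simp add: p_def q_def norm_mult)
  qed
  ultimately have "1 + ((cmod z)\<^sup>2 + m\<^sup>2) / cmod (z\<^sup>2 - (of_real m)\<^sup>2) = 1 + (p\<^sup>2 + q\<^sup>2) / 2 / (p * q)"
    by (simp only:)
  also have "\<dots> = 2 * (1/2 + 1/4 * (p / q + inverse (p / q)))"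
    using pos by (simp add: field_simps power2_eq_square)
  also have "p / q = cmod (Phi m z)"
    by (simp add: Phi_def p_def q_def norm_divide)
  finally have eq: "1 + ((cmod z)\<^sup>2 + m\<^sup>2) / cmod (z\<^sup>2 - (of_real m)\<^sup>2)
      = 2 * (1/2 + 1/4 * (cmod (Phi m z) + inverse (cmod (Phi m z))))" .
  show ?thesis
    unfolding eq eta_def real_sqrt_mult by simp
qed

end

theory Submission
  imports Defs
begin

text \<open>By the Birman--Schwinger principle it suffices to show \<open>\<parallel>Q(z)\<parallel> < 1\<close>.  With \<open>k = \<surd>(z\<^sup>2 - m\<^sup>2)\<close> and
  \<open>\<zeta> = (z + m) / k\<close> the free resolvent is convolution with the matrix
  \<open>(\<i> / 2) exp (\<i> k |t|) [[\<zeta>, sgn t], [sgn t, 1 / \<zeta>]]\<close>, whose two one-sided parts have rank one and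
  norm \<open>\<eta>(|\<Phi>(z)|) exp (- Im k |t|)\<close>.  As \<open>|A(x)|\<^sup>2\<close> and \<open>|B(x)|\<^sup>2\<close> are bounded by \<open>|V(x)|\<close>, the Schur
  test with the weight \<open>|V|\<^bsup>1/2\<^esup>\<close> gives \<open>\<parallel>Q(z)\<parallel> \<le> \<eta>(|\<Phi>(z)|) F\<^sub>V(Im k)\<close>.  The second part follows since
  \<open>F\<^sub>V\<close> is nonincreasing and \<open>\<eta>(|\<Phi>(x)|) = m / Im k\<close> for real \<open>x\<close> in the gap.

  The resolvent is identified by solving \<open>u' = \<plusminus>\<i>ku + g\<close> on \<open>L\<^sup>2\<close>, uniqueness coming from a shift
  argument for weak solutions; points of the real axis outside the gap are excluded by the
  approximate eigenfunctions \<open>exp (- \<epsilon> |t| + \<i> p t) v\<close>.\<close>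

section \<open>Polar decomposition of two by two matrices\<close>

text \<open>The Birman-Schwinger principle is part of what \<open>dirac_operator\<close> demands of
  \<open>H\<close>: on the resolvent set of \<open>H0\<close> a point is regular for
  \<open>H\<close> exactly when -1 is regular for \<open>Q\<close>. What remains is to recognise the
  closure of a product of unbounded graphs as an everywhere defined operator of norm below 1. Three
  obstacles shape the work. \<open>opA\<close> and \<open>opB\<close> rest on definite descriptions,
  so explicit formulas and uniqueness must come before any estimate or measurability claim.
  \<open>V\<close> is only Lebesgue measurable while spinors have Borel representatives, so a Borel
  version of \<open>V\<close> is carried along. And the constant must be exactly \<open>eta\<close>:
  each one-sided Green matrix is singular, hence its Frobenius norm is its operator norm, and the
  two sides live on disjoint half-lines, so their norms never add. The resolvent set of
  \<open>H0\<close> is needed in both directions because the theorem quantifies over that set,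
  whereas the branch of the square root exists only off the two real half-lines.\<close>

abbreviation mat22 :: "'a \<Rightarrow> 'a \<Rightarrow> 'a \<Rightarrow> 'a::zero \<Rightarrow> 'a^2^2" where
  "mat22 a b c d \<equiv> vector [vector [a, b], vector [c, d]]"

lemma mat22_nth [simp]:
  "mat22 a b c d $ 1 $ 1 = a" "mat22 a b c d $ 1 $ 2 = b"
  "mat22 a b c d $ 2 $ 1 = c" "mat22 a b c d $ 2 $ 2 = d"
  by simp_all

lemma mat22_eq_iff:
  "(M :: 'a^2^2) = N \<longleftrightarrow> M$1$1 = N$1$1 \<and> M$1$2 = N$1$2 \<and> M$2$1 = N$2$1 \<and> M$2$2 = N$2$2"
  by (auto simp: vec_eq_iff forall_2)

lemma mat22_cases:
  obtains a b c d where "M = mat22 a b c d"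
proof
  show "M = mat22 (M$1$1) (M$1$2) (M$2$1) (M$2$2)"
    unfolding mat22_eq_iff by simp
qed

lemma ctranspose_nth [simp]: "ctranspose M $ i $ j = cnj (M $ j $ i)"
  by (simp add: ctranspose_def)

lemma matrix_mult_nth2: "((M :: 'a::semiring_1^2^2) ** N) $ i $ j = M$i$1 * N$1$j + M$i$2 * N$2$j"
  by (simp add: matrix_matrix_mult_def sum_2)

lemma matrix_vector_mult_nth2: "((M :: 'a::semiring_1^2^2) *v v) $ i = M$i$1 * v$1 + M$i$2 * v$2"
  by (simp add: matrix_vector_mult_def sum_2)

lemma matrix_vector_mult_scaleC: "(M :: complex^2^2) *v (c *s v) = c *s (M *v v)"
  unfolding vec_eq_iff forall_2 matrix_vector_mult_nth2 vector_smult_component by (simp add: algebra_simps)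

lemma inner_complex2:
  "inner (v :: complex^2) w = Re (cnj (v$1) * w$1) + Re (cnj (v$2) * w$2)"
  by (simp add: inner_vec_def sum_2 inner_complex_def)

lemma inner_matrix_left: "inner (M *v v) w = inner v (ctranspose M *v w)"
  unfolding inner_complex2 matrix_vector_mult_nth2
  by (simp add: algebra_simps)

lemma norm_complex2: "(norm (v :: complex^2))\<^sup>2 = (cmod (v$1))\<^sup>2 + (cmod (v$2))\<^sup>2"
  by (simp add: norm_vec_def L2_set_def sum_2)

lemma ctranspose_ctranspose [simp]: "ctranspose (ctranspose M) = M"
  by (simp add: mat22_eq_iff)

lemma psd_iff_inner: "psd P \<longleftrightarrow> ctranspose P = P \<and> (\<forall>v. 0 \<le> inner v (P *v v))"
  unfolding psd_def inner_complex2 by (simp add: sum_2)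

text \<open>Completing the square turns \<open>p\<close> times the quadratic form into a square plus
  the determinant \<open>p * r - |q|^2\<close> times \<open>|b|^2\<close>; only \<open>p = 0\<close>
  needs a separate argument.\<close>

lemma psd_iff:
  "psd P \<longleftrightarrow> (\<exists>p q r. P = mat22 (of_real p) q (cnj q) (of_real r) \<and> 0 \<le> p \<and> 0 \<le> r \<and> (cmod q)\<^sup>2 \<le> p * r)"
proof
  assume P: "psd P"
  then have h: "ctranspose P = P" and pos: "\<And>v. 0 \<le> inner v (P *v v)"
    by (auto simp: psd_iff_inner)
  define p q r where "p = Re (P$1$1)" and "q = P$1$2" and "r = Re (P$2$2)"
  have "cnj (P$1$1) = P$1$1" "cnj (P$2$2) = P$2$2" "P$2$1 = cnj q"
    using h by (auto simp: mat22_eq_iff q_def)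
  then have P_eq: "P = mat22 (of_real p) q (cnj q) (of_real r)"
    by (simp add: mat22_eq_iff p_def q_def r_def complex_eq_iff)
  have form: "inner (vector [a, b]) (P *v vector [a, b])
      = p * (cmod a)\<^sup>2 + 2 * Re (cnj a * q * b) + r * (cmod b)\<^sup>2" for a b
    unfolding inner_complex2 matrix_vector_mult_nth2 P_eq
    by (simp add: algebra_simps cmod_power2) (simp add: power2_eq_square algebra_simps)
  have p: "0 \<le> p" using pos[of "vector [1, 0]"] by (simp add: form)
  have r: "0 \<le> r" using pos[of "vector [0, 1]"] by (simp add: form)
  have "(cmod q)\<^sup>2 \<le> p * r"
  proof (cases "p = 0")
    case True
    \<comment> \<open>The vector \<open>(t q, -1)\<close> makes the form equal to
      \<open>r - 2 t |q|^2\<close>; since \<open>t\<close> is arbitrary, \<open>q\<close> must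
      vanish.\<close>
    have *: "2 * t * (cmod q)\<^sup>2 \<le> r" for t
      using pos[of "vector [of_real t * q, -1]"] unfolding cmod_power2
      by (simp add: form True algebra_simps power2_eq_square)
    have "(cmod q)\<^sup>2 = 0"
    proof (rule ccontr)
      assume "(cmod q)\<^sup>2 \<noteq> 0"
      then have "2 * ((r + 1) / (cmod q)\<^sup>2) * (cmod q)\<^sup>2 = 2 * (r + 1)"
        by simp
      then show False
        using *[of "(r + 1) / (cmod q)\<^sup>2"] r by simp
    qed
    then show ?thesis using True by simp
  next
    case False
    \<comment> \<open>The vector \<open>(q, -p)\<close> is annihilated by the first row of
      \<open>P\<close>, so the completed square drops out and only the determinant term is
      left.\<close>
    have "0 \<le> p * (p * r - (cmod q)\<^sup>2)"
      using pos[of "vector [q, - of_real p]"] unfolding form cmod_power2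
      by (simp add: power2_eq_square algebra_simps)
    then show ?thesis
      using False p by (simp add: zero_le_mult_iff)
  qed
  then show "\<exists>p q r. P = mat22 (of_real p) q (cnj q) (of_real r) \<and> 0 \<le> p \<and> 0 \<le> r \<and> (cmod q)\<^sup>2 \<le> p * r"
    using P_eq p r by blast
next
  assume "\<exists>p q r. P = mat22 (of_real p) q (cnj q) (of_real r) \<and> 0 \<le> p \<and> 0 \<le> r \<and> (cmod q)\<^sup>2 \<le> p * r"
  then obtain p q r where P_eq: "P = mat22 (of_real p) q (cnj q) (of_real r)"
    and p: "0 \<le> p" and r: "0 \<le> r" and q: "(cmod q)\<^sup>2 \<le> p * r"
    by blast
  have "0 \<le> inner v (P *v v)" for v
  proof -
    define a b where "a = v$1" and "b = v$2"
    have form: "inner v (P *v v) = p * (cmod a)\<^sup>2 + 2 * Re (cnj a * q * b) + r * (cmod b)\<^sup>2"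
      unfolding inner_complex2 matrix_vector_mult_nth2 P_eq a_def b_def
      by (simp add: algebra_simps cmod_power2) (simp add: power2_eq_square algebra_simps)
    show ?thesis
    proof (cases "p = 0")
      case True
      then show ?thesis using q r by (simp add: form)
    next
      case False
      have "p * inner v (P *v v) = (cmod (of_real p * a + q * b))\<^sup>2 + (p * r - (cmod q)\<^sup>2) * (cmod b)\<^sup>2"
        unfolding form cmod_power2 by (simp add: power2_eq_square algebra_simps)
      also have "\<dots> \<ge> 0" using q by simp
      finally show ?thesis using False p by (simp add: zero_le_mult_iff)
    qed
  qed
  then show "psd P"
    by (simp add: psd_iff_inner P_eq mat22_eq_iff)
qed

text \<open>For positive semidefinite \<open>P\<close> this is the determinant of the square root of
  \<open>P\<close>.\<close>

definition sqrt_det :: "complex^2^2 \<Rightarrow> real" where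
  "sqrt_det P = sqrt (Re (P$1$1) * Re (P$2$2) - (cmod (P$1$2))\<^sup>2)"

text \<open>The trace of the square root \<open>S\<close> of \<open>P\<close>, from
  \<open>(tr S)^2 = tr (S^2) + 2 det S\<close>.\<close>

definition sqrt_tr :: "complex^2^2 \<Rightarrow> real" where
  "sqrt_tr P = sqrt (Re (P$1$1) + Re (P$2$2) + 2 * sqrt_det P)"

text \<open>By Cayley--Hamilton \<open>S\<^sup>2 + det S = (tr S) S\<close>, and for \<open>S\<^sup>2 = P\<close> both invariants of \<open>S\<close> are
  determined by \<open>P\<close>.  Division by zero gives the correct value in the only degenerate case \<open>P = 0\<close>.\<close>

definition explicit_sqrt :: "complex^2^2 \<Rightarrow> complex^2^2" where
  "explicit_sqrt P =
     mat22 ((P$1$1 + sqrt_det P) / sqrt_tr P) (P$1$2 / sqrt_tr P)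
           (P$2$1 / sqrt_tr P) ((P$2$2 + sqrt_det P) / sqrt_tr P)"

text \<open>With \<open>d\<close> and \<open>t\<close> the two invariants, the formula is
  \<open>(P + d) / t\<close>. Expanding the square and using Cayley-Hamilton for \<open>P\<close>,
  whose determinant is \<open>d^2\<close>, gives
  \<open>(P + d)^2 = (tr P + 2 d) P = t^2 P\<close>.\<close>

lemma psd_explicit_sqrt:
  assumes "psd P"
  shows "psd (explicit_sqrt P)" and "explicit_sqrt P ** explicit_sqrt P = P"
proof -
  obtain p q r where P_eq: "P = mat22 (of_real p) q (cnj q) (of_real r)"
    and p: "0 \<le> p" and r: "0 \<le> r" and q: "(cmod q)\<^sup>2 \<le> p * r"
    using assms psd_iff by blast
  define d t where "d = sqrt_det P" and "t = sqrt_tr P"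
  have d: "d \<ge> 0" "d\<^sup>2 = p * r - (cmod q)\<^sup>2"
    using q by (auto simp: d_def sqrt_det_def P_eq)
  have t: "t \<ge> 0" "t\<^sup>2 = p + r + 2 * d"
    using p r d by (auto simp: t_def sqrt_tr_def P_eq d_def)
  have S_eq: "explicit_sqrt P = mat22 (of_real ((p + d) / t)) (q / t) (cnj (q / t)) (of_real ((r + d) / t))"
    unfolding explicit_sqrt_def d_def[symmetric] t_def[symmetric] by (simp add: P_eq)
  have "(cmod q)\<^sup>2 \<le> (p + d) * (r + d)"
    using q mult_nonneg_nonneg[OF d(1) p] mult_nonneg_nonneg[OF d(1) r] zero_le_square[of d]
    unfolding distrib_left distrib_right mult.commute[of p d] by linarith
  then have "(cmod (q / t))\<^sup>2 \<le> ((p + d) / t) * ((r + d) / t)"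
    by (simp add: norm_divide power_divide power2_eq_square divide_right_mono)
  then show "psd (explicit_sqrt P)"
    unfolding psd_iff S_eq using p r d t
    by (intro exI[of _ "(p + d) / t"] exI[of _ "q / t"] exI[of _ "(r + d) / t"]) simp
  show "explicit_sqrt P ** explicit_sqrt P = P"
  proof (cases "t = 0")
    case True
    then have "p = 0" "r = 0" using t p r d by auto
    then have "P = mat22 0 0 0 0" using q by (simp add: P_eq)
    then show ?thesis
      by (simp add: S_eq True mat22_eq_iff matrix_mult_nth2)
  next
    case False
    have "(cmod q)\<^sup>2 = p * r - d * d"
      using d(2) unfolding power2_eq_square[of d] by linarith
    then have qq: "q * cnj q = of_real p * of_real r - of_real d * of_real d"
      unfolding complex_norm_square[symmetric] by simp
    have tt: "complex_of_real t * of_real t = of_real p + of_real r + 2 * of_real d"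
      using t(2) by (metis of_real_add of_real_mult of_real_numeral power2_eq_square)
    have nz: "complex_of_real t \<noteq> 0" using False by simp
    have "(of_real p + of_real d) * (of_real p + of_real d) + q * cnj q = of_real t * of_real t * of_real p"
      "(of_real p + of_real d) * q + q * (of_real r + of_real d) = of_real t * of_real t * q"
      "cnj q * (of_real p + of_real d) + (of_real r + of_real d) * cnj q = of_real t * of_real t * cnj q"
      "cnj q * q + (of_real r + of_real d) * (of_real r + of_real d) = of_real t * of_real t * of_real r"
      using qq tt by algebra+
    then show ?thesis
      unfolding mat22_eq_iff S_eq matrix_mult_nth2
      using nz by (simp add: P_eq add_divide_distrib[symmetric])
  qed
qed

text \<open>Semidefiniteness makes trace and determinant of \<open>S\<close> nonnegative, so the
  real square roots computed from \<open>S ** S\<close> return exactly these numbers, and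
  Cayley-Hamilton returns \<open>S\<close>. This settles the description in
  \<open>psd_sqrt\<close>.\<close>

lemma psd_sqrt_unique:
  assumes S: "psd S"
  shows "explicit_sqrt (S ** S) = S"
proof -
  obtain a b c where S_eq: "S = mat22 (of_real a) b (cnj b) (of_real c)"
    and a: "0 \<le> a" and c: "0 \<le> c" and b: "(cmod b)\<^sup>2 \<le> a * c"
    using assms psd_iff by blast
  have bb: "b * cnj b = of_real ((cmod b)\<^sup>2)" "cnj b * b = of_real ((cmod b)\<^sup>2)"
    by (simp_all only: complex_norm_square mult.commute)
  have P_eq: "S ** S = mat22 (of_real (a\<^sup>2 + (cmod b)\<^sup>2)) (b * of_real (a + c))
      (cnj b * of_real (a + c)) (of_real (c\<^sup>2 + (cmod b)\<^sup>2))"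
    unfolding mat22_eq_iff matrix_mult_nth2 S_eq
    using bb by (simp add: power2_eq_square algebra_simps)
  have "(a\<^sup>2 + (cmod b)\<^sup>2) * (c\<^sup>2 + (cmod b)\<^sup>2) - (cmod (b * of_real (a + c)))\<^sup>2 = (a * c - (cmod b)\<^sup>2)\<^sup>2"
    using a c by (simp add: norm_mult power_mult_distrib flip: of_real_add) (simp add: power2_eq_square algebra_simps)
  then have d: "sqrt_det (S ** S) = a * c - (cmod b)\<^sup>2"
    unfolding sqrt_det_def P_eq using b by simp
  have "a\<^sup>2 + (cmod b)\<^sup>2 + (c\<^sup>2 + (cmod b)\<^sup>2) + 2 * (a * c - (cmod b)\<^sup>2) = (a + c)\<^sup>2"
    by (simp add: power2_eq_square algebra_simps)
  then have t: "sqrt_tr (S ** S) = a + c"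
    unfolding sqrt_tr_def d unfolding P_eq using a c by simp
  show ?thesis
  proof (cases "a + c = 0")
    case True
    then have "a = 0" "c = 0" using a c by auto
    with b show ?thesis
      unfolding explicit_sqrt_def t True by (simp add: S_eq)
  next
    case False
    then have nz: "complex_of_real (a + c) \<noteq> 0" by (metis of_real_eq_0_iff)
    then have nz': "complex_of_real a + of_real c \<noteq> 0" by simp
    show ?thesis
      unfolding explicit_sqrt_def t d unfolding P_eq mat22_nth unfolding mat22_eq_iff S_eq
      using nz' by (simp add: divide_simps power2_eq_square algebra_simps)
  qed
qed

lemma psd_sqrt_eq: "psd P \<Longrightarrow> psd_sqrt P = explicit_sqrt P"
  unfolding psd_sqrt_def
  by (rule the_equality) (auto simp: psd_explicit_sqrt psd_sqrt_unique)

lemma psd_psd_sqrt: "psd P \<Longrightarrow> psd (psd_sqrt P)"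
  and psd_sqrt_square: "psd P \<Longrightarrow> psd_sqrt P ** psd_sqrt P = P"
  by (simp_all add: psd_sqrt_eq psd_explicit_sqrt)

lemma ctranspose_psd: "psd P \<Longrightarrow> ctranspose P = P"
  by (simp add: psd_def)

lemma psd_ctranspose_mult: "psd (ctranspose M ** M)"
  unfolding psd_iff_inner
proof (intro conjI allI)
  show "ctranspose (ctranspose M ** M) = ctranspose M ** M"
    by (simp add: mat22_eq_iff matrix_mult_nth2 mult.commute)
  show "0 \<le> inner v ((ctranspose M ** M) *v v)" for v
    using inner_matrix_left[of M v "M *v v"] by (metis inner_ge_zero matrix_vector_mul_assoc)
qed

lemma psd_mat_abs: "psd (mat_abs M)"
  and mat_abs_square: "mat_abs M ** mat_abs M = ctranspose M ** M"
  by (simp_all add: mat_abs_def psd_psd_sqrt psd_sqrt_square psd_ctranspose_mult)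


text \<open>For invertible \<open>M\<close> with singular values \<open>s\<^sub>1, s\<^sub>2\<close> the cofactor matrix times \<open>sgn (det M)\<close> has the
  same singular vectors as \<open>M\<close> and the singular values \<open>s\<^sub>2, s\<^sub>1\<close>, so that adding it to \<open>M\<close> and
  dividing by \<open>s\<^sub>1 + s\<^sub>2\<close> leaves the unitary factor.\<close>

definition explicit_polar :: "complex^2^2 \<Rightarrow> complex^2^2" where
  "explicit_polar M = (let \<sigma> = sgn (M$1$1 * M$2$2 - M$1$2 * M$2$1); t = complex_of_real (sqrt_tr (ctranspose M ** M)) in
     mat22 ((M$1$1 + \<sigma> * cnj (M$2$2)) / t) ((M$1$2 - \<sigma> * cnj (M$2$1)) / t)
           ((M$2$1 - \<sigma> * cnj (M$1$2)) / t) ((M$2$2 + \<sigma> * cnj (M$1$1)) / t))"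

lemma ctranspose_mult_mat22:
  assumes "M = mat22 a b c d"
  shows "ctranspose M ** M = mat22 (of_real ((cmod a)\<^sup>2 + (cmod c)\<^sup>2)) (cnj a * b + cnj c * d)
    (cnj b * a + cnj d * c) (of_real ((cmod b)\<^sup>2 + (cmod d)\<^sup>2))"
  unfolding mat22_eq_iff matrix_mult_nth2 assms of_real_add complex_norm_square
  by (simp add: mult.commute)

lemma sqrt_det_ctranspose_mult:
  "sqrt_det (ctranspose M ** M) = cmod (M$1$1 * M$2$2 - M$1$2 * M$2$1)"
proof -
  obtain a b c d where M: "M = mat22 a b c d" by (rule mat22_cases)
  have "((cmod a)\<^sup>2 + (cmod c)\<^sup>2) * ((cmod b)\<^sup>2 + (cmod d)\<^sup>2) - (cmod (cnj a * b + cnj c * d))\<^sup>2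
      = (cmod (a * d - b * c))\<^sup>2"
    unfolding cmod_power2 by (simp add: power2_eq_square algebra_simps)
  then show ?thesis
    unfolding sqrt_det_def ctranspose_mult_mat22[OF M] by (simp add: M)
qed

lemma sqrt_tr_ctranspose_mult:
  "(sqrt_tr (ctranspose M ** M))\<^sup>2 = (cmod (M$1$1))\<^sup>2 + (cmod (M$1$2))\<^sup>2 + (cmod (M$2$1))\<^sup>2 + (cmod (M$2$2))\<^sup>2
     + 2 * cmod (M$1$1 * M$2$2 - M$1$2 * M$2$1)"
proof -
  obtain a b c d where M: "M = mat22 a b c d" by (rule mat22_cases)
  show ?thesis
    unfolding sqrt_tr_def sqrt_det_ctranspose_mult unfolding ctranspose_mult_mat22[OF M]
    by (simp add: M)
qed


text \<open>Here \<open>\<sigma>\<close> is the phase of the determinant (0 if \<open>M\<close> is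
  singular), \<open>D\<close> its modulus, \<open>\<tau>\<close> the squared Frobenius norm and
  \<open>t\<close> the trace of \<open>mat_abs M\<close>, that is, the sum of the singular
  values.\<close>

context
  fixes M :: "complex^2^2" and a b c d \<sigma> t \<tau> :: complex and D :: real
  assumes M: "M = mat22 a b c d"
  defines "\<sigma> \<equiv> sgn (a * d - b * c)" and "D \<equiv> cmod (a * d - b * c)"
    and "t \<equiv> of_real (sqrt_tr (ctranspose M ** M))"
    and "\<tau> \<equiv> a * cnj a + b * cnj b + c * cnj c + d * cnj d"
begin

text \<open>For \<open>algebra\<close> an entry and its conjugate are independent unknowns; these
  relations are the only link between them, which is why conjugate forms are recorded as
  well.\<close>

lemma polar_relations:
  "\<sigma> * of_real D = a * d - b * c" "cnj \<sigma> * of_real D = cnj a * cnj d - cnj b * cnj c"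
  "\<sigma> * (cnj a * cnj d - cnj b * cnj c) = of_real D" "cnj \<sigma> * (a * d - b * c) = of_real D"
  "\<sigma> * cnj \<sigma> * \<sigma> = \<sigma>" "\<sigma> * cnj \<sigma> * of_real D = of_real D"
  "t * t = \<tau> + 2 * of_real D" "cnj t = t"
proof -
  show *: "\<sigma> * of_real D = a * d - b * c"
    by (simp add: \<sigma>_def D_def sgn_eq)
  show "cnj \<sigma> * of_real D = cnj a * cnj d - cnj b * cnj c"
    using arg_cong[OF *, of cnj] by simp
  have "\<sigma> * cnj (a * d - b * c) = of_real D"
    unfolding \<sigma>_def D_def sgn_eq times_divide_eq_left complex_norm_square[symmetric]
    by (simp add: power2_eq_square)
  then show **: "\<sigma> * (cnj a * cnj d - cnj b * cnj c) = of_real D"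
    by simp
  show "cnj \<sigma> * (a * d - b * c) = of_real D"
    using arg_cong[OF **, of cnj] by simp
  show "\<sigma> * cnj \<sigma> * \<sigma> = \<sigma>"
    unfolding complex_norm_square[symmetric] by (simp add: \<sigma>_def norm_sgn)
  show "\<sigma> * cnj \<sigma> * of_real D = of_real D"
    unfolding complex_norm_square[symmetric] by (simp add: \<sigma>_def norm_sgn D_def)
  have "t * t = of_real ((sqrt_tr (ctranspose M ** M))\<^sup>2)"
    by (simp add: t_def power2_eq_square)
  then show "t * t = \<tau> + 2 * of_real D"
    unfolding sqrt_tr_ctranspose_mult M mat22_nth of_real_add complex_norm_square
    by (simp add: \<tau>_def D_def)
  show "cnj t = t" by (simp add: t_def)
qed

lemma explicit_polar_mat22:
  "explicit_polar M = mat22 ((a + \<sigma> * cnj d) / t) ((b - \<sigma> * cnj c) / t) ((c - \<sigma> * cnj b) / t) ((d + \<sigma> * cnj a) / t)"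
  by (simp add: explicit_polar_def Let_def \<sigma>_def t_def M)

lemma mat_abs_mat22:
  "mat_abs M = mat22 ((a * cnj a + c * cnj c + D) / t) ((cnj a * b + cnj c * d) / t)
    ((cnj b * a + cnj d * c) / t) ((b * cnj b + d * cnj d + D) / t)"
  unfolding mat_abs_def psd_sqrt_eq[OF psd_ctranspose_mult] explicit_sqrt_def sqrt_det_ctranspose_mult
    t_def[symmetric] 
  unfolding ctranspose_mult_mat22[OF M] mat22_nth of_real_add complex_norm_square
  by (simp add: M D_def)

lemma t_eq_0_imp: "t = 0 \<Longrightarrow> M = 0"
proof -
  assume "t = 0"
  then have "sqrt_tr (ctranspose M ** M) = 0" by (simp add: t_def)
  then have "a = 0 \<and> b = 0 \<and> c = 0 \<and> d = 0"
    using sqrt_tr_ctranspose_mult[of M] zero_le_power2[of "cmod a"] zero_le_power2[of "cmod b"]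
      zero_le_power2[of "cmod c"] zero_le_power2[of "cmod d"] norm_ge_zero[of "a * d - b * c"]
    by (simp add: M add_nonneg_eq_0_iff)
  then show "M = 0" by (simp add: M mat22_eq_iff)
qed

text \<open>Let \<open>C\<close> be the conjugate transpose of the adjugate of \<open>M\<close>, so
  that the factor is \<open>(M + \<sigma> C) / t\<close>. Then \<open>C\<close> times the adjoint of
  \<open>M\<close> is the conjugate determinant, and Cayley-Hamilton reduces the remaining terms, so
  that the product of the numerators is \<open>(\<tau> + 2 D) M = t^2 M\<close>.\<close>

lemma explicit_polar_mult_abs: "explicit_polar M ** mat_abs M = M"
proof (cases "t = 0")
  case True
  then have "a = 0" "b = 0" "c = 0" "d = 0" using t_eq_0_imp by (auto simp: M mat22_eq_iff)
  then show ?thesis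
    unfolding explicit_polar_mat22 mat_abs_mat22 mat22_eq_iff matrix_mult_nth2 by (simp add: True M)
next
  case False
  have "(a + \<sigma> * cnj d) * (a * cnj a + c * cnj c + D) + (b - \<sigma> * cnj c) * (cnj b * a + cnj d * c) = t * t * a"
    "(a + \<sigma> * cnj d) * (cnj a * b + cnj c * d) + (b - \<sigma> * cnj c) * (b * cnj b + d * cnj d + D) = t * t * b"
    "(c - \<sigma> * cnj b) * (a * cnj a + c * cnj c + D) + (d + \<sigma> * cnj a) * (cnj b * a + cnj d * c) = t * t * c"
    "(c - \<sigma> * cnj b) * (cnj a * b + cnj c * d) + (d + \<sigma> * cnj a) * (b * cnj b + d * cnj d + D) = t * t * d"
    using polar_relations(1-4,7) unfolding \<tau>_def by algebra+
  then show ?thesis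
    unfolding explicit_polar_mat22 mat_abs_mat22 mat22_eq_iff matrix_mult_nth2 unfolding M mat22_nth
    using False by (simp add: add_divide_distrib[symmetric])
qed

text \<open>If \<open>M\<close> is singular the factor is \<open>M / t\<close> with
  \<open>t^2 = \<tau>\<close>, and a matrix of rank at most one satisfies the cubic identity with
  factor \<open>\<tau>\<close>. Otherwise \<open>\<sigma>\<close> has modulus 1 and the factor is
  unitary.\<close>

lemma explicit_polar_isometry:
  "explicit_polar M ** ctranspose (explicit_polar M) ** explicit_polar M = explicit_polar M"
proof -
  define p q r s where "p = a + \<sigma> * cnj d" and "q = b - \<sigma> * cnj c"
    and "r = c - \<sigma> * cnj b" and "s = d + \<sigma> * cnj a"
  note rel = polar_relations[unfolded \<tau>_def]
  have "\<sigma> = 0 \<or> \<sigma> * cnj \<sigma> = 1"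
    using rel(5) by auto
  then have "(p * cnj p + q * cnj q) * p + (p * cnj r + q * cnj s) * r = t * t * p \<and>
     (p * cnj p + q * cnj q) * q + (p * cnj r + q * cnj s) * s = t * t * q \<and>
     (r * cnj p + s * cnj q) * p + (r * cnj r + s * cnj s) * r = t * t * r \<and>
     (r * cnj p + s * cnj q) * q + (r * cnj r + s * cnj s) * s = t * t * s"
  proof
    assume "\<sigma> = 0"
    moreover have "complex_of_real D = 0" "a * d - b * c = 0" "cnj \<sigma> = 0"
      using rel(1,3) \<open>\<sigma> = 0\<close> by auto
    moreover have "cnj a * cnj d - cnj b * cnj c = 0"
      using rel(2) \<open>\<sigma> = 0\<close> by auto
    ultimately show ?thesis
      unfolding rel p_def q_def r_def s_def complex_cnj_add complex_cnj_diff complex_cnj_mult complex_cnj_cnj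
      apply (intro conjI)
      apply algebra+
      done
  next
    assume "\<sigma> * cnj \<sigma> = 1"
    with rel(1-4,7) show ?thesis
      unfolding p_def q_def r_def s_def complex_cnj_add complex_cnj_diff complex_cnj_mult complex_cnj_cnj
      apply (intro conjI)
      apply algebra+
      done
  qed
  then show ?thesis
    unfolding explicit_polar_mat22 mat22_eq_iff matrix_mult_nth2 ctranspose_nth mat22_nth
      p_def[symmetric] q_def[symmetric] r_def[symmetric] s_def[symmetric]
    by (cases "t = 0") (auto simp: divide_simps rel(8))
qed

lemma explicit_polar_kernel: "explicit_polar M *v v = 0 \<longleftrightarrow> M *v v = 0"
proof (cases "D = 0")
  case True
  then have "\<sigma> = 0" by (simp add: \<sigma>_def D_def)
  then have *: "explicit_polar M *v v = inverse t *s (M *v v)"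
    unfolding vec_eq_iff forall_2 explicit_polar_mat22 matrix_vector_mult_nth2 vector_smult_component
    by (simp add: M divide_inverse algebra_simps)
  show ?thesis
  proof (cases "t = 0")
    case True
    then show ?thesis using t_eq_0_imp unfolding * by simp
  next
    case False
    then show ?thesis unfolding * by (simp add: vector_mul_eq_0)
  qed
next
  case False
  then have nz: "a * d - b * c \<noteq> 0" "complex_of_real D \<noteq> 0" by (auto simp: D_def)
  then have t: "t \<noteq> 0" using t_eq_0_imp by (auto simp: M mat22_eq_iff)
  have "v = 0" if "explicit_polar M *v v = 0"
  proof -
    have "(a + \<sigma> * cnj d) * v$1 + (b - \<sigma> * cnj c) * v$2 = 0" "(c - \<sigma> * cnj b) * v$1 + (d + \<sigma> * cnj a) * v$2 = 0"
      using that t unfolding vec_eq_iff forall_2 explicit_polar_mat22 matrix_vector_mult_nth2 mat22_nth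
      by (simp_all add: divide_simps)
    \<comment> \<open>Cramer's rule: the numerator matrix has determinant
      \<open>\<sigma> (\<tau> + 2 D)\<close>.\<close>
    then have "(\<tau> + 2 * of_real D) * \<sigma> * v$1 = 0" "(\<tau> + 2 * of_real D) * \<sigma> * v$2 = 0"
      using polar_relations unfolding \<tau>_def by algebra+
    moreover have "\<tau> + 2 * of_real D \<noteq> 0" "\<sigma> \<noteq> 0"
      using t nz polar_relations(7) by (auto simp: \<sigma>_def sgn_zero_iff)
    ultimately show "v = 0" by (simp add: vec_eq_iff forall_2)
  qed
  moreover have "v = 0" if "M *v v = 0"
  proof -
    have "a * v$1 + b * v$2 = 0" "c * v$1 + d * v$2 = 0"
      using that unfolding vec_eq_iff forall_2 M matrix_vector_mult_nth2 by simp_all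
    then have "(a * d - b * c) * v$1 = 0" "(a * d - b * c) * v$2 = 0"
      by algebra+
    then show "v = 0" using nz by (simp add: vec_eq_iff forall_2)
  qed
  ultimately show ?thesis by auto
qed

text \<open>Cayley-Hamilton for \<open>mat_abs M\<close>, whose trace is \<open>t\<close> and whose
  determinant is \<open>D\<close>. It serves to split every vector into parts from the range and the
  kernel of \<open>mat_abs M\<close>.\<close>

lemma mat_abs_quadratic: "t *s (mat_abs M *v v) = mat_abs M *v (mat_abs M *v v) + of_real D *s v"
proof (cases "t = 0")
  case True
  then have "a = 0" "b = 0" "c = 0" "d = 0" using t_eq_0_imp by (auto simp: M mat22_eq_iff)
  then show ?thesis
    unfolding vec_eq_iff forall_2 matrix_vector_mult_nth2 mat_abs_mat22
    by (simp add: True D_def matrix_vector_mult_nth2)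
next
  case False
  define p q r s where "p = a * cnj a + c * cnj c + of_real D" and "q = cnj a * b + cnj c * d"
    and "r = cnj b * a + cnj d * c" and "s = b * cnj b + d * cnj d + of_real D"
  have "p * p + q * r + t * t * of_real D = t * t * p" "p * q + q * s = t * t * q"
    "r * p + s * r = t * t * r" "r * q + s * s + t * t * of_real D = t * t * s"
    using polar_relations(1-4,7) unfolding \<tau>_def p_def q_def r_def s_def by algebra+
  then have "t * t * (p * v$1 + q * v$2) = p * (p * v$1 + q * v$2) + q * (r * v$1 + s * v$2) + t * t * (D * v$1)"
    "t * t * (r * v$1 + s * v$2) = r * (p * v$1 + q * v$2) + s * (r * v$1 + s * v$2) + t * t * (D * v$2)"
    by algebra+
  then show ?thesis
    unfolding mat_abs_mat22 vec_eq_iff forall_2 matrix_vector_mult_nth2 mat22_nth vector_add_component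
      vector_smult_component p_def[symmetric] q_def[symmetric] r_def[symmetric] s_def[symmetric]
    using False by (simp add: field_simps)
qed

end

text \<open>For uniqueness, two candidates agree on the range of \<open>mat_abs M\<close>, where
  both produce \<open>M\<close>, and on its kernel, where both vanish. The quadratic identity shows
  that range and kernel together span the space.\<close>

lemma polar_U_eq: "polar_U M = explicit_polar M"
  unfolding polar_U_def
proof (rule the_equality)
  show "explicit_polar M ** ctranspose (explicit_polar M) ** explicit_polar M = explicit_polar M \<and>
      (\<forall>v. explicit_polar M *v v = 0 \<longleftrightarrow> M *v v = 0) \<and> M = explicit_polar M ** mat_abs M"
    using mat22_cases[of M] explicit_polar_isometry explicit_polar_kernel explicit_polar_mult_abs by metis
next
  fix U :: "complex^2^2"
  assume U: "U ** ctranspose U ** U = U \<and> (\<forall>v. U *v v = 0 \<longleftrightarrow> M *v v = 0) \<and> M = U ** mat_abs M"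
  obtain a b c d where M: "M = mat22 a b c d" by (rule mat22_cases)
  define t D where "t = complex_of_real (sqrt_tr (ctranspose M ** M))" and "D = cmod (a * d - b * c)"
  let ?W = "explicit_polar M" and ?N = "mat_abs M"
  have range: "U *v (?N *v w) = ?W *v (?N *v w)" for w
    using U explicit_polar_mult_abs[OF M] by (metis matrix_vector_mul_assoc)
  have ker: "U *v w = ?W *v w" if "?N *v w = 0" for w
  proof -
    have "M *v w = 0" using U that by (metis matrix_vector_mul_assoc matrix_vector_mult_0_right)
    then show ?thesis using U explicit_polar_kernel[OF M] by metis
  qed
  have quad: "t *s (?N *v v) = ?N *v (?N *v v) + of_real D *s v" for v
    unfolding t_def D_def by (rule mat_abs_quadratic[OF M])
  have "U *v v = ?W *v v" for v
  proof (cases "D = 0")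
    case False
    have "of_real D *s v = ?N *v (t *s v - ?N *v v)"
      using quad[of v] by (simp add: matrix_vector_mult_diff_distrib matrix_vector_mult_scaleC algebra_simps)
    then have "v = ?N *v (inverse (of_real D) *s (t *s v - ?N *v v))"
      using False by (metis matrix_vector_mult_scaleC of_real_eq_0_iff vector_smult_assoc left_inverse vector_smult_lid)
    then show ?thesis using range by metis
  next
    case D: True
    show ?thesis
    proof (cases "t = 0")
      case True
      then have "M = 0" using t_eq_0_imp[OF M] by (simp add: t_def)
      then show ?thesis using U explicit_polar_kernel[OF M] by auto
    next
      case False
      \<comment> \<open>With \<open>D = 0\<close> the matrix \<open>?N\<close> annihilates
        \<open>v - ?N *v w\<close>, so \<open>v\<close> is this kernel vector plus
        \<open>?N *v w\<close>.\<close>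
      define w where "w = inverse t *s v"
      have v: "v = t *s w" using False by (simp add: w_def vector_smult_assoc)
      have "?N *v (v - ?N *v w) = 0"
        using quad[of w] by (simp add: D matrix_vector_mult_diff_distrib v matrix_vector_mult_scaleC)
      then show ?thesis
        using ker[of "v - ?N *v w"] range[of w] by (simp add: matrix_vector_mult_diff_distrib)
    qed
  qed
  then show "U = ?W" by (simp add: matrix_eq)
qed


text \<open>The adjoint of \<open>U\<close> times \<open>U\<close> is an orthogonal projection; its
  value \<open>w\<close> at \<open>v\<close> has the norm of \<open>U *v v\<close>, and
  Cauchy-Schwarz finishes.\<close>

lemma norm_polar_U_le: "norm (polar_U M *v v) \<le> norm v"
proof -
  define U where "U = polar_U M"
  have U: "U ** ctranspose U ** U = U"
    using mat22_cases[of M] explicit_polar_isometry unfolding U_def polar_U_eq by metis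
  define w where "w = ctranspose U *v (U *v v)"
  have sq: "(norm (U *v v))\<^sup>2 = inner v w"
    by (simp add: power2_norm_eq_inner inner_matrix_left w_def)
  have "(norm w)\<^sup>2 = inner (U *v v) (U *v w)"
    unfolding power2_norm_eq_inner by (subst (1) w_def) (simp add: inner_matrix_left)
  also have "U *v w = U *v v"
    unfolding w_def using U by (metis matrix_vector_mul_assoc)
  finally have "norm w = norm (U *v v)"
    by (simp add: power2_norm_eq_inner[symmetric])
  then have "(norm (U *v v))\<^sup>2 \<le> norm v * norm (U *v v)"
    using sq norm_cauchy_schwarz[of v w] by simp
  then show ?thesis
    unfolding U_def[symmetric] power2_eq_square by (cases "U *v v = 0") auto
qed

text \<open>The left side is the form of \<open>mat_abs M\<close> at \<open>v\<close>, and
  \<open>mat_abs M *v v\<close> has the same norm as \<open>M *v v\<close>.\<close>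

lemma norm_sqrt_abs_le:
  "(norm (psd_sqrt (mat_abs M) *v v))\<^sup>2 \<le> onorm ((*v) M) * (norm v)\<^sup>2"
proof -
  define N S where "N = mat_abs M" and "S = psd_sqrt N"
  have N: "ctranspose N = N" "N ** N = ctranspose M ** M" and S: "ctranspose S = S" "S ** S = N"
    by (simp_all add: N_def S_def ctranspose_psd psd_mat_abs psd_psd_sqrt psd_sqrt_square mat_abs_square)
  have "(norm (N *v v))\<^sup>2 = inner v ((N ** N) *v v)"
    unfolding power2_norm_eq_inner inner_matrix_left N(1) by (simp only: matrix_vector_mul_assoc)
  also have "\<dots> = (norm (M *v v))\<^sup>2"
    unfolding N(2) power2_norm_eq_inner inner_matrix_left[of M] by (simp only: matrix_vector_mul_assoc)
  finally have eq: "norm (N *v v) = norm (M *v v)"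
    by simp
  have "(norm (S *v v))\<^sup>2 = inner v ((S ** S) *v v)"
    unfolding power2_norm_eq_inner inner_matrix_left S(1) by (simp only: matrix_vector_mul_assoc)
  also have "\<dots> \<le> norm v * norm (M *v v)"
    unfolding S(2) eq[symmetric] by (rule norm_cauchy_schwarz)
  also have "\<dots> \<le> norm v * (onorm ((*v) M) * norm v)"
    by (intro mult_left_mono onorm) auto
  finally show ?thesis
    by (simp add: S_def N_def power2_eq_square mult_ac)
qed

lemma norm_polar_sqrt_abs_le:
  "(norm ((polar_U M ** psd_sqrt (mat_abs M)) *v v))\<^sup>2 \<le> onorm ((*v) M) * (norm v)\<^sup>2"
  using order_trans[OF power_mono[OF norm_polar_U_le norm_ge_zero] norm_sqrt_abs_le]
  by (simp flip: matrix_vector_mul_assoc)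

section \<open>Borel measurability of the polar factors and of the operator norm\<close>

lemma borel_measurable_vec_nth [measurable (raw)]:
  fixes f :: "'a \<Rightarrow> 'b::euclidean_space^'n"
  assumes "f \<in> borel_measurable M"
  shows "(\<lambda>x. f x $ i) \<in> borel_measurable M"
  using _ assms by (rule borel_measurable_continuous_on) (intro continuous_intros)

lemma borel_measurable_vec2I:
  fixes f :: "'a \<Rightarrow> 'b::euclidean_space^2"
  assumes "(\<lambda>x. f x $ 1) \<in> borel_measurable M" "(\<lambda>x. f x $ 2) \<in> borel_measurable M"
  shows "f \<in> borel_measurable M"
proof (subst borel_measurable_euclidean_space, intro ballI)
  fix b :: "'b^2" assume "b \<in> Basis"
  then obtain i c where b: "b = axis i c" unfolding Basis_vec_def by auto
  have "(\<lambda>x. f x $ i) \<in> borel_measurable M"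
    using assms exhaust_2[of i] by auto
  then show "(\<lambda>x. inner (f x) b) \<in> borel_measurable M"
    unfolding b inner_axis by simp
qed

lemma borel_measurable_mat22 [measurable (raw)]:
  fixes a b c d :: "'a \<Rightarrow> complex"
  assumes [measurable]: "a \<in> borel_measurable M" "b \<in> borel_measurable M"
    "c \<in> borel_measurable M" "d \<in> borel_measurable M"
  shows "(\<lambda>x. mat22 (a x) (b x) (c x) (d x)) \<in> borel_measurable M"
  by (intro borel_measurable_vec2I) simp_all

lemma borel_measurable_matrix_vector_mult [measurable (raw)]:
  fixes f :: "'a \<Rightarrow> complex^2^2"
  assumes [measurable]: "f \<in> borel_measurable M" "g \<in> borel_measurable M"
  shows "(\<lambda>x. f x *v g x) \<in> borel_measurable M"
  by (intro borel_measurable_vec2I) (simp_all add: matrix_vector_mult_nth2)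

lemma borel_measurable_matrix_mult [measurable (raw)]:
  fixes f g :: "'a \<Rightarrow> complex^2^2"
  assumes [measurable]: "f \<in> borel_measurable M" "g \<in> borel_measurable M"
  shows "(\<lambda>x. f x ** g x) \<in> borel_measurable M"
  by (rule borel_measurable_vec2I; rule borel_measurable_vec2I) (simp_all add: matrix_mult_nth2)

lemma borel_measurable_cnj [measurable (raw)]:
  "f \<in> borel_measurable M \<Longrightarrow> (\<lambda>x. cnj (f x)) \<in> borel_measurable M"
  by (rule borel_measurable_continuous_on[OF continuous_on_cnj[OF continuous_on_id]])

lemma borel_measurable_ctranspose [measurable (raw)]:
  fixes f :: "'a \<Rightarrow> complex^2^2"
  assumes [measurable]: "f \<in> borel_measurable M"
  shows "(\<lambda>x. ctranspose (f x)) \<in> borel_measurable M"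
  by (intro borel_measurable_vec2I) simp_all

lemma borel_measurable_explicit_sqrt [measurable (raw)]:
  assumes [measurable]: "f \<in> borel_measurable M"
  shows "(\<lambda>x. explicit_sqrt (f x)) \<in> borel_measurable M"
  unfolding explicit_sqrt_def sqrt_tr_def sqrt_det_def by measurable

lemma borel_measurable_explicit_polar [measurable (raw)]:
  assumes [measurable]: "f \<in> borel_measurable M"
  shows "(\<lambda>x. explicit_polar (f x)) \<in> borel_measurable M"
  unfolding explicit_polar_def sqrt_tr_def sqrt_det_def sgn_eq Let_def by measurable

text \<open>A definite description says nothing about measurability; the explicit formulas are built
  from arithmetic, conjugation, moduli and real roots.\<close>

lemma borel_measurable_sqrt_abs [measurable (raw)]:
  assumes [measurable]: "f \<in> borel_measurable M"
  shows "(\<lambda>x. psd_sqrt (mat_abs (f x))) \<in> borel_measurable M"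
  unfolding psd_sqrt_eq[OF psd_mat_abs] unfolding mat_abs_def psd_sqrt_eq[OF psd_ctranspose_mult]
  by measurable

lemma borel_measurable_polar_U [measurable (raw)]:
  assumes [measurable]: "f \<in> borel_measurable M"
  shows "(\<lambda>x. polar_U (f x)) \<in> borel_measurable M"
  unfolding polar_U_eq by measurable

lemma norm_matrix_vector_le:
  "norm ((M :: complex^2^2) *v v) \<le> norm M * norm v"
proof -
  have "(norm (M *v v))\<^sup>2 \<le> (norm M * norm v)\<^sup>2"
  proof -
    have *: "(cmod (p * x + q * y))\<^sup>2 \<le> ((cmod p)\<^sup>2 + (cmod q)\<^sup>2) * ((cmod x)\<^sup>2 + (cmod y)\<^sup>2)" for p q x y
    proof -
      \<comment> \<open>Lagrange's identity, from which Cauchy-Schwarz for one row is read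
        off.\<close>
      have "((cmod p)\<^sup>2 + (cmod q)\<^sup>2) * ((cmod x)\<^sup>2 + (cmod y)\<^sup>2) - (cmod (p * x + q * y))\<^sup>2
          = (cmod (p * cnj y - q * cnj x))\<^sup>2"
        unfolding cmod_power2 by (simp add: power2_eq_square algebra_simps)
      then show ?thesis using zero_le_power2 by (metis diff_ge_0_iff_ge)
    qed
    have "(norm M)\<^sup>2 = (norm (M$1))\<^sup>2 + (norm (M$2))\<^sup>2"
      by (simp add: norm_vec_def L2_set_def sum_2)
    then show ?thesis
      using add_mono[OF *[of "M$1$1" "v$1" "M$1$2" "v$2"] *[of "M$2$1" "v$1" "M$2$2" "v$2"]]
      by (simp add: norm_complex2 matrix_vector_mult_nth2 power_mult_distrib distrib_right)
  qed
  then show ?thesis by (rule power2_le_imp_le) simp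
qed

lemma onorm_matrix_le: "onorm ((*v) (M :: complex^2^2)) \<le> norm M"
  by (rule onorm_bound) (auto simp: norm_matrix_vector_le)

text \<open>The operator norm is 1-Lipschitz for the Frobenius norm, hence continuous in the
  matrix.\<close>

lemma borel_measurable_onorm [measurable (raw)]:
  fixes f :: "'a \<Rightarrow> complex^2^2"
  assumes "f \<in> borel_measurable M"
  shows "(\<lambda>x. onorm ((*v) (f x))) \<in> borel_measurable M"
proof -
  have tri: "onorm ((*v) A) \<le> onorm ((*v) B) + norm (A - B)" for A B :: "complex^2^2"
  proof -
    have "(*v) A = (\<lambda>v. B *v v + (A - B) *v v)"
      by (simp add: fun_eq_iff matrix_vector_mult_diff_rdistrib)
    then show ?thesis
      using onorm_triangle[of "(*v) B" "(*v) (A - B)"] onorm_matrix_le[of "A - B"] by simp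
  qed
  have "1-lipschitz_on UNIV (\<lambda>M :: complex^2^2. onorm ((*v) M))"
  proof (rule lipschitz_onI)
    fix A B :: "complex^2^2"
    show "dist (onorm ((*v) A)) (onorm ((*v) B)) \<le> 1 * dist A B"
      using tri[of A B] tri[of B A] by (simp add: dist_norm abs_le_iff norm_minus_commute)
  qed simp
  then have "continuous_on UNIV (\<lambda>M :: complex^2^2. onorm ((*v) M))"
    by (rule lipschitz_on_continuous_on)
  then show ?thesis using assms by (rule borel_measurable_continuous_on)
qed

section \<open>Completeness of the space of spinors\<close>

lemma sq_integrable_rep [simp, intro]: "sq_integrable (rep_l2 f)"
  using Quotient_rep_reflp[OF Quotient_l2, of f] by (simp add: l2_rel_def)

lemma measurable_rep_l2 [measurable]: "rep_l2 f \<in> borel_measurable borel"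
  using sq_integrable_rep[of f] unfolding sq_integrable_def by simp

lemma rep_abs_l2:
  assumes "sq_integrable f"
  shows "AE x in lborel. rep_l2 (abs_l2 f) x = f x"
  using Quotient_rep_abs[OF Quotient_l2, of f] assms by (simp add: l2_rel_def)

lemma l2_eqI:
  assumes "AE x in lborel. rep_l2 f x = rep_l2 g x"
  shows "f = g"
  using Quotient_rel_rep[OF Quotient_l2, of f g] assms by (simp add: l2_rel_def)

lemma rep_l2_add: "AE x in lborel. rep_l2 (f + g) x = rep_l2 f x + rep_l2 g x"
  unfolding plus_l2_def map_fun_def o_def id_def by (intro rep_abs_l2 sq_integrable_add) auto

lemma rep_l2_diff: "AE x in lborel. rep_l2 (f - g) x = rep_l2 f x - rep_l2 g x"
  unfolding minus_l2_def map_fun_def o_def id_def by (intro rep_abs_l2 sq_integrable_diff) auto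

lemma rep_l2_scaleR: "AE x in lborel. rep_l2 (r *\<^sub>R f) x = r *\<^sub>R rep_l2 f x"
  unfolding scaleR_l2_def map_fun_def o_def id_def by (intro rep_abs_l2 sq_integrable_scaleR) auto

lemma rep_l2_scaleC: "AE x in lborel. rep_l2 (scaleC z f) x = z *s rep_l2 f x"
  unfolding scaleC_def map_fun_def o_def id_def by (intro rep_abs_l2 sq_integrable_scaleC) auto

lemma rep_l2_zero: "AE x in lborel. rep_l2 0 x = 0"
  unfolding zero_l2_def by (intro rep_abs_l2 sq_integrable_zero)

lemma norm_l2_square: "(norm f)\<^sup>2 = (LINT x|lborel. (norm (rep_l2 f x))\<^sup>2)"
  unfolding norm_l2_def by (simp add: inner_l2_def map_fun_def power2_norm_eq_inner)

lemma norm_abs_l2_square: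
  assumes "sq_integrable f"
  shows "(norm (abs_l2 f))\<^sup>2 = (LINT x|lborel. (norm (f x))\<^sup>2)"
  unfolding norm_l2_square
  using assms rep_abs_l2[OF assms] by (intro integral_cong_AE) (auto simp: sq_integrable_def)

lemma sq_integrable_iff_nn_integral:
  "sq_integrable f \<longleftrightarrow> f \<in> borel_measurable borel \<and> (\<integral>\<^sup>+x. ennreal ((norm (f x))\<^sup>2) \<partial>lborel) < \<infinity>"
  unfolding sq_integrable_def by (auto simp: integrable_iff_bounded)

lemma nn_integral_sq_integrable:
  "sq_integrable f \<Longrightarrow> (\<integral>\<^sup>+x. ennreal ((norm (f x))\<^sup>2) \<partial>lborel) = ennreal (LINT x|lborel. (norm (f x))\<^sup>2)"
  unfolding sq_integrable_def by (intro nn_integral_eq_integral) auto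

lemma norm_l2_nn_integral: "ennreal ((norm f)\<^sup>2) = (\<integral>\<^sup>+x. ennreal ((norm (rep_l2 f x))\<^sup>2) \<partial>lborel)"
  by (simp add: nn_integral_sq_integrable norm_l2_square)

lemma norm_diff_l2_nn_integral:
  "ennreal ((norm (f - g))\<^sup>2) = (\<integral>\<^sup>+x. ennreal ((norm (rep_l2 f x - rep_l2 g x))\<^sup>2) \<partial>lborel)"
  unfolding norm_l2_nn_integral using rep_l2_diff[of f g]
  by (intro nn_integral_cong_AE) auto

lemma norm_abs_diff_l2_nn_integral:
  assumes "sq_integrable f"
  shows "ennreal ((norm (abs_l2 f - g))\<^sup>2) = (\<integral>\<^sup>+x. ennreal ((norm (f x - rep_l2 g x))\<^sup>2) \<partial>lborel)"
  unfolding norm_diff_l2_nn_integral using rep_abs_l2[OF assms]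
  by (intro nn_integral_cong_AE) auto

lemma ennreal_le_suminf: "u n \<le> (\<Sum>n. u n)" for u :: "nat \<Rightarrow> ennreal"
  using sum_le_suminf[of u "{n}"] by simp

text \<open>Riesz--Fischer: consecutive differences of a fast subsequence satisfy \<open>\<Sum> 4\<^sup>n |d\<^sub>n|\<^sup>2 < \<infinity>\<close> almost
  everywhere, so it converges pointwise almost everywhere, and Fatou's lemma identifies the limit.\<close>

lemma l2_fast_Cauchy_limit:
  fixes Y :: "nat \<Rightarrow> l2"
  assumes fast: "\<And>m n. n \<le> m \<Longrightarrow> norm (Y m - Y n) \<le> (1/8)^n"
  shows "\<exists>g. \<forall>n. norm (g - Y n) \<le> (1/8)^n"
proof -
  define f where "f n = rep_l2 (Y n)" for n
  have [measurable]: "f n \<in> borel_measurable borel" for n by (simp add: f_def)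
  have dist_f: "(\<integral>\<^sup>+x. ennreal ((norm (f m x - f n x))\<^sup>2) \<partial>lborel) \<le> ennreal (((1/8)^n)\<^sup>2)" if "n \<le> m" for m n
    unfolding f_def norm_diff_l2_nn_integral[symmetric]
    by (intro ennreal_leI power_mono fast that) simp
  let ?S = "\<lambda>x. \<Sum>n. ennreal (4^n * (norm (f (Suc n) x - f n x))\<^sup>2)"
  have "(\<integral>\<^sup>+x. ?S x \<partial>lborel) = (\<Sum>n. \<integral>\<^sup>+x. ennreal (4^n * (norm (f (Suc n) x - f n x))\<^sup>2) \<partial>lborel)"
    by (rule nn_integral_suminf) measurable
  also have "\<dots> \<le> (\<Sum>n. ennreal ((1/2)^n))"
  proof (rule suminf_le)
    fix n
    have "(\<integral>\<^sup>+x. ennreal (4^n * (norm (f (Suc n) x - f n x))\<^sup>2) \<partial>lborel)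
        = ennreal (4^n) * (\<integral>\<^sup>+x. ennreal ((norm (f (Suc n) x - f n x))\<^sup>2) \<partial>lborel)"
      by (subst nn_integral_cmult[symmetric]) (auto simp: ennreal_mult)
    also have "\<dots> \<le> ennreal (4^n) * ennreal (((1/8)^n)\<^sup>2)"
      by (intro mult_left_mono dist_f) auto
    also have "\<dots> = ennreal (4^n * ((1/8)^n)\<^sup>2)"
      by (rule ennreal_mult[symmetric]) auto
    also have "(4::real)^n * ((1/8)^n)\<^sup>2 = (1/16)^n"
      by (simp add: power2_eq_square flip: power_mult_distrib)
    also have "\<dots> \<le> ennreal ((1/2)^n)"
      by (intro ennreal_leI power_mono) auto
    finally show "(\<integral>\<^sup>+x. ennreal (4^n * (norm (f (Suc n) x - f n x))\<^sup>2) \<partial>lborel) \<le> ennreal ((1/2)^n)" .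
  qed auto
  also have "\<dots> < \<infinity>"
    by (subst suminf_ennreal2) (auto intro: summable_geometric)
  finally have "AE x in lborel. ?S x \<noteq> \<infinity>"
    by (intro nn_integral_PInf_AE) auto
  then have conv: "AE x in lborel. convergent (\<lambda>n. f n x)"
  proof eventually_elim
    case (elim x)
    define s where "s = enn2real (?S x)"
    have s: "0 \<le> s" "?S x = ennreal s"
      unfolding s_def using elim ennreal_enn2real[of "?S x"] by (simp_all only: less_top infinity_ennreal_def enn2real_nonneg)
    have bound: "norm (f (Suc n) x - f n x) \<le> sqrt s * (1/2)^n" for n
    proof -
      have "ennreal (4^n * (norm (f (Suc n) x - f n x))\<^sup>2) \<le> ?S x"
        by (rule ennreal_le_suminf)
      then have "4^n * (norm (f (Suc n) x - f n x))\<^sup>2 \<le> s"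
        unfolding s(2) by (simp only: ennreal_le_iff[OF s(1)])
      moreover have "(2^n)\<^sup>2 = (4::real)^n"
        by (simp add: power2_eq_square flip: power_mult_distrib)
      ultimately have "(2^n * norm (f (Suc n) x - f n x))\<^sup>2 \<le> s"
        by (simp add: power_mult_distrib)
      then have "2^n * norm (f (Suc n) x - f n x) \<le> sqrt s"
        by (rule real_le_rsqrt)
      then show ?thesis by (simp add: field_simps)
    qed
    have "summable (\<lambda>n. f (Suc n) x - f n x)"
      by (rule summable_comparison_test'[of "\<lambda>n. sqrt s * (1/2)^n" 0])
        (auto intro!: summable_mult summable_geometric bound)
    then show ?case
      by (simp add: summable_iff_convergent sum_lessThan_telescope[of "\<lambda>n. f n x"] convergent_diff_const_right_iff)
  qed
  define g where "g x = lim (\<lambda>n. f n x)" for x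
  have [measurable]: "g \<in> borel_measurable borel"
    unfolding g_def by measurable
  have lim: "AE x in lborel. (\<lambda>n. f n x) \<longlonglongrightarrow> g x"
    using conv by eventually_elim (simp add: g_def convergent_LIMSEQ_iff)
  have fatou: "(\<integral>\<^sup>+x. ennreal ((norm (g x - f n x))\<^sup>2) \<partial>lborel) \<le> ennreal (((1/8)^n)\<^sup>2)" for n
  proof -
    have "(\<integral>\<^sup>+x. ennreal ((norm (g x - f n x))\<^sup>2) \<partial>lborel)
        = (\<integral>\<^sup>+x. liminf (\<lambda>m. ennreal ((norm (f m x - f n x))\<^sup>2)) \<partial>lborel)"
    proof (rule nn_integral_cong_AE, use lim in eventually_elim)
      case (elim x)
      have "(\<lambda>m. ennreal ((norm (f m x - f n x))\<^sup>2)) \<longlonglongrightarrow> ennreal ((norm (g x - f n x))\<^sup>2)"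
        by (intro tendsto_intros elim)
      then show ?case
        using lim_imp_Liminf[OF sequentially_bot] by metis
    qed
    also have "\<dots> \<le> liminf (\<lambda>m. \<integral>\<^sup>+x. ennreal ((norm (f m x - f n x))\<^sup>2) \<partial>lborel)"
      by (rule nn_integral_liminf) measurable
    also have "\<dots> \<le> liminf (\<lambda>m. ennreal (((1/8)^n)\<^sup>2))"
      by (intro Liminf_mono eventually_sequentiallyI[of n] dist_f)
    finally show ?thesis by (simp add: Liminf_const)
  qed
  have "sq_integrable (\<lambda>x. g x - f n x)" for n
    unfolding sq_integrable_iff_nn_integral
    by (auto intro: le_less_trans[OF fatou])
  from sq_integrable_add[OF this[of 0], of "f 0"] have g: "sq_integrable g"
    by (simp add: f_def)
  have "norm (abs_l2 g - Y n) \<le> (1/8)^n" for n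
  proof -
    have "ennreal ((norm (abs_l2 g - Y n))\<^sup>2) \<le> ennreal (((1/8)^n)\<^sup>2)"
      using fatou[of n] unfolding norm_abs_diff_l2_nn_integral[OF g] f_def .
    then have "(norm (abs_l2 g - Y n))\<^sup>2 \<le> ((1/8)^n)\<^sup>2"
      by (simp add: ennreal_le_iff)
    then show ?thesis by (rule power2_le_imp_le) simp
  qed
  then show ?thesis by blast
qed

instance l2 :: complete_space
proof
  fix X :: "nat \<Rightarrow> l2"
  assume "Cauchy X"
  then have "\<exists>N. \<forall>m\<ge>N. \<forall>k\<ge>N. dist (X m) (X k) < (1/8)^n" for n :: nat
    unfolding Cauchy_def by simp
  then obtain N where N: "\<And>n m k. m \<ge> N n \<Longrightarrow> k \<ge> N n \<Longrightarrow> norm (X m - X k) < (1/8)^n"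
    unfolding dist_norm by metis
  \<comment> \<open>Summing the thresholds makes \<open>r m\<close> at least \<open>N n\<close> for
    every \<open>n \<le> m\<close>, so one subsequence meets all Cauchy bounds at once.\<close>
  define r where "r n = (\<Sum>i\<le>n. N i)" for n
  have r: "N n \<le> r m" if "n \<le> m" for n m
    unfolding r_def using that by (intro member_le_sum) auto
  obtain g where g: "\<And>n. norm (g - X (r n)) \<le> (1/8)^n"
    using l2_fast_Cauchy_limit[of "\<lambda>n. X (r n)"] N r by (meson less_imp_le order_refl)
  have close: "dist (X m) g \<le> 2 * (1/8)^n" if "m \<ge> N n" for m n
  proof -
    have "dist (X m) g \<le> norm (X m - X (r n)) + norm (X (r n) - g)"
      unfolding dist_norm by norm
    then show ?thesis
      using N[OF that r[OF order_refl]] g[of n] by (simp add: norm_minus_commute)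
  qed
  have "X \<longlonglongrightarrow> g"
  proof (rule LIMSEQ_I)
    fix e :: real assume "0 < e"
    then obtain n where "(1/8 :: real)^n < e / 2"
      using real_arch_pow_inv[of "e/2" "1/8"] by auto
    then have "\<forall>m\<ge>N n. norm (X m - g) < e"
      using close[of n] by (force simp: dist_norm)
    then show "\<exists>no. \<forall>m\<ge>no. norm (X m - g) < e" by blast
  qed
  then show "convergent X" by (rule convergentI)
qed

section \<open>Integral operators bounded by the Schur test\<close>

lemma matrix_vector_mult_scaleR: "(M :: complex^2^2) *v (r *\<^sub>R v) = r *\<^sub>R (M *v v)"
  unfolding vec_eq_iff forall_2 matrix_vector_mult_nth2 vector_scaleR_component
  by (simp add: scaleR_add_right)

text \<open>The majorant is symmetric in \<open>x\<close> and \<open>y\<close>, so the single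
  condition \<open>weight\<close> controls both the row and the column integrals. With
  \<open>a = 1\<close> it covers the convolutions and the free resolvent, with \<open>a\<close> the
  root of the norm of the potential the Birman-Schwinger kernel.\<close>

locale schur_kernel =
  fixes K :: "real \<Rightarrow> real \<Rightarrow> complex^2^2" and a :: "real \<Rightarrow> real" and c s C :: real
  assumes K_measurable: "(\<lambda>p. K (fst p) (snd p)) \<in> borel_measurable (lborel \<Otimes>\<^sub>M lborel)"
    and a_measurable [measurable]: "a \<in> borel_measurable borel"
    and a_nonneg: "\<And>x. 0 \<le> a x" and c_nonneg: "0 \<le> c" and C_nonneg: "0 \<le> C" and s_nonneg: "0 \<le> s"
    and K_le: "\<And>x y v. norm (K x y *v v) \<le> c * a x * a y * exp (- s * \<bar>x - y\<bar>) * norm v"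
    and weight: "\<And>x. (\<integral>\<^sup>+y. ennreal ((a y)\<^sup>2 * exp (- s * \<bar>y - x\<bar>)) \<partial>lborel) \<le> ennreal C"
begin

definition kernel_apply :: "(real \<Rightarrow> complex^2) \<Rightarrow> real \<Rightarrow> complex^2" where
  "kernel_apply f x = (LINT y|lborel. K x y *v f y)"

lemma measurable_kernel:
  assumes [measurable]: "f \<in> borel_measurable borel"
  shows "(\<lambda>(x, y). K x y *v f y) \<in> borel_measurable (lborel \<Otimes>\<^sub>M lborel)"
proof -
  note K_measurable [measurable]
  have "(\<lambda>p. K (fst p) (snd p) *v f (snd p)) \<in> borel_measurable (lborel \<Otimes>\<^sub>M lborel)"
    by measurable
  then show ?thesis by (simp add: case_prod_unfold)
qed

lemma measurable_kernel_section:
  assumes [measurable]: "f \<in> borel_measurable borel"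
  shows "(\<lambda>y. K x y *v f y) \<in> borel_measurable borel"
  using measurable_compose[OF measurable_Pair1' measurable_kernel[OF assms], of x] by simp

text \<open>Cauchy-Schwarz after halving the exponential into \<open>h y * h y\<close>. The factor
  \<open>a y\<close> stays with one half and is integrated out by \<open>weight\<close>;
  \<open>a x\<close> goes with \<open>f\<close>, ready for the later integration over
  \<open>x\<close>.\<close>

lemma nn_integral_kernel_square_le:
  assumes "f \<in> borel_measurable borel"
  shows "(\<integral>\<^sup>+y. ennreal (norm (K x y *v f y)) \<partial>lborel)\<^sup>2
    \<le> ennreal (c\<^sup>2 * C) * (\<integral>\<^sup>+y. ennreal ((a x)\<^sup>2 * exp (- s * \<bar>x - y\<bar>)) * ennreal ((norm (f y))\<^sup>2) \<partial>lborel)"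
proof -
  note [measurable] = assms
  define h where "h y = exp (- s * \<bar>x - y\<bar> / 2)" for y
  have [measurable]: "h \<in> borel_measurable borel" unfolding h_def by measurable
  have h: "h y * h y = exp (- s * \<bar>x - y\<bar>)" "0 \<le> h y" for y
    by (simp_all add: h_def flip: exp_add)
  have "(\<integral>\<^sup>+y. ennreal (norm (K x y *v f y)) \<partial>lborel)
      \<le> (\<integral>\<^sup>+y. ennreal c * (ennreal (a y * h y) * ennreal (a x * h y * norm (f y))) \<partial>lborel)"
  proof (rule nn_integral_mono)
    fix y
    have "c * (a y * h y * (a x * h y * norm (f y))) = c * a x * a y * exp (- s * \<bar>x - y\<bar>) * norm (f y)"
      unfolding h(1)[symmetric] by (simp add: mult_ac)
    then have "norm (K x y *v f y) \<le> c * (a y * h y * (a x * h y * norm (f y)))"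
      using K_le[of x y "f y"] by (simp only:)
    then have "ennreal (norm (K x y *v f y)) \<le> ennreal (c * (a y * h y * (a x * h y * norm (f y))))"
      by (rule ennreal_leI)
    also have "\<dots> = ennreal c * (ennreal (a y * h y) * ennreal (a x * h y * norm (f y)))"
      using c_nonneg a_nonneg h(2) by (simp add: ennreal_mult)
    finally show "ennreal (norm (K x y *v f y)) \<le> ennreal c * (ennreal (a y * h y) * ennreal (a x * h y * norm (f y)))" .
  qed
  also have "\<dots> = ennreal c * (\<integral>\<^sup>+y. ennreal (a y * h y) * ennreal (a x * h y * norm (f y)) \<partial>lborel)"
    by (rule nn_integral_cmult) measurable
  finally have "(\<integral>\<^sup>+y. ennreal (norm (K x y *v f y)) \<partial>lborel)\<^sup>2
      \<le> (ennreal c)\<^sup>2 * (\<integral>\<^sup>+y. ennreal (a y * h y) * ennreal (a x * h y * norm (f y)) \<partial>lborel)\<^sup>2"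
    unfolding power_mult_distrib[symmetric] by (intro power_mono) auto
  also have "\<dots> \<le> (ennreal c)\<^sup>2 * ((\<integral>\<^sup>+y. (ennreal (a y * h y))\<^sup>2 \<partial>lborel)
      * (\<integral>\<^sup>+y. (ennreal (a x * h y * norm (f y)))\<^sup>2 \<partial>lborel))"
    by (intro mult_left_mono Cauchy_Schwarz_nn_integral) auto
  also have "(\<integral>\<^sup>+y. (ennreal (a y * h y))\<^sup>2 \<partial>lborel) = (\<integral>\<^sup>+y. ennreal ((a y)\<^sup>2 * exp (- s * \<bar>y - x\<bar>)) \<partial>lborel)"
    using a_nonneg h(2) unfolding abs_minus_commute[of _ x] h(1)[symmetric]
    by (intro nn_integral_cong)
      (simp add: ennreal_power power_mult_distrib power2_eq_square[of "h _"])
  also have "(\<integral>\<^sup>+y. (ennreal (a x * h y * norm (f y)))\<^sup>2 \<partial>lborel)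
      = (\<integral>\<^sup>+y. ennreal ((a x)\<^sup>2 * exp (- s * \<bar>x - y\<bar>)) * ennreal ((norm (f y))\<^sup>2) \<partial>lborel)"
    using a_nonneg h(2) unfolding h(1)[symmetric]
    by (intro nn_integral_cong)
      (simp add: ennreal_power power_mult_distrib ennreal_mult[symmetric] power2_eq_square[of "h _"])
  finally have "(\<integral>\<^sup>+y. ennreal (norm (K x y *v f y)) \<partial>lborel)\<^sup>2 \<le> (ennreal c)\<^sup>2 *
      ((\<integral>\<^sup>+y. ennreal ((a y)\<^sup>2 * exp (- s * \<bar>y - x\<bar>)) \<partial>lborel)
      * (\<integral>\<^sup>+y. ennreal ((a x)\<^sup>2 * exp (- s * \<bar>x - y\<bar>)) * ennreal ((norm (f y))\<^sup>2) \<partial>lborel))" .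
  also have "\<dots> \<le> (ennreal c)\<^sup>2 * (ennreal C
      * (\<integral>\<^sup>+y. ennreal ((a x)\<^sup>2 * exp (- s * \<bar>x - y\<bar>)) * ennreal ((norm (f y))\<^sup>2) \<partial>lborel))"
    by (intro mult_left_mono mult_right_mono weight) auto
  also have "\<dots> = ennreal (c\<^sup>2 * C)
      * (\<integral>\<^sup>+y. ennreal ((a x)\<^sup>2 * exp (- s * \<bar>x - y\<bar>)) * ennreal ((norm (f y))\<^sup>2) \<partial>lborel)"
    using c_nonneg C_nonneg by (simp add: ennreal_power ennreal_mult mult.assoc)
  finally show ?thesis .
qed

lemma integrable_kernel:
  assumes f: "sq_integrable f"
  shows "integrable lborel (\<lambda>y. K x y *v f y)"
proof -
  have [measurable]: "f \<in> borel_measurable borel" using f by (simp add: sq_integrable_def)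
  have "(\<integral>\<^sup>+y. ennreal ((a x)\<^sup>2 * exp (- s * \<bar>x - y\<bar>)) * ennreal ((norm (f y))\<^sup>2) \<partial>lborel)
      \<le> (\<integral>\<^sup>+y. ennreal ((a x)\<^sup>2) * ennreal ((norm (f y))\<^sup>2) \<partial>lborel)"
    using s_nonneg by (intro nn_integral_mono mult_right_mono ennreal_leI) (auto intro: mult_left_le)
  also have "\<dots> = ennreal ((a x)\<^sup>2) * (\<integral>\<^sup>+y. ennreal ((norm (f y))\<^sup>2) \<partial>lborel)"
    by (rule nn_integral_cmult) measurable
  also have "\<dots> < \<infinity>"
    using f by (simp add: sq_integrable_iff_nn_integral ennreal_mult_less_top)
  finally have "(\<integral>\<^sup>+y. ennreal (norm (K x y *v f y)) \<partial>lborel)\<^sup>2 < \<infinity>"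
    by (intro le_less_trans[OF nn_integral_kernel_square_le]) (auto simp: ennreal_mult_less_top)
  then have "(\<integral>\<^sup>+y. ennreal (norm (K x y *v f y)) \<partial>lborel) < \<infinity>"
    by (auto simp: power2_eq_square ennreal_mult_less_top)
  then show ?thesis
    using measurable_kernel_section[of f x] by (simp add: integrable_iff_bounded)
qed

text \<open>After Tonelli the integral over \<open>x\<close> is again bounded by
  \<open>weight\<close>; the two uses of \<open>C\<close> and the factor \<open>c^2\<close> make up
  \<open>(c * C)^2\<close>.\<close>

lemma nn_integral_kernel_apply_le:
  assumes f: "sq_integrable f"
  shows "(\<integral>\<^sup>+x. ennreal ((norm (kernel_apply f x))\<^sup>2) \<partial>lborel)
    \<le> ennreal ((c * C)\<^sup>2) * (\<integral>\<^sup>+y. ennreal ((norm (f y))\<^sup>2) \<partial>lborel)"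
proof -
  have [measurable]: "f \<in> borel_measurable borel" using f by (simp add: sq_integrable_def)
  have "(\<integral>\<^sup>+x. ennreal ((norm (kernel_apply f x))\<^sup>2) \<partial>lborel)
      \<le> (\<integral>\<^sup>+x. ennreal (c\<^sup>2 * C) * (\<integral>\<^sup>+y. ennreal ((a x)\<^sup>2 * exp (- s * \<bar>x - y\<bar>)) * ennreal ((norm (f y))\<^sup>2) \<partial>lborel) \<partial>lborel)"
  proof (rule nn_integral_mono)
    fix x
    have "ennreal (norm (kernel_apply f x)) \<le> (\<integral>\<^sup>+y. ennreal (norm (K x y *v f y)) \<partial>lborel)"
      unfolding kernel_apply_def by (rule integral_norm_bound_ennreal[OF integrable_kernel[OF f]])
    then have "(ennreal (norm (kernel_apply f x)))\<^sup>2 \<le> (\<integral>\<^sup>+y. ennreal (norm (K x y *v f y)) \<partial>lborel)\<^sup>2"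
      by (intro power_mono) auto
    also note nn_integral_kernel_square_le
    finally show "ennreal ((norm (kernel_apply f x))\<^sup>2)
        \<le> ennreal (c\<^sup>2 * C) * (\<integral>\<^sup>+y. ennreal ((a x)\<^sup>2 * exp (- s * \<bar>x - y\<bar>)) * ennreal ((norm (f y))\<^sup>2) \<partial>lborel)"
      by (simp add: ennreal_power)
  qed
  also have "\<dots> = ennreal (c\<^sup>2 * C) *
      (\<integral>\<^sup>+x. (\<integral>\<^sup>+y. ennreal ((a x)\<^sup>2 * exp (- s * \<bar>x - y\<bar>)) * ennreal ((norm (f y))\<^sup>2) \<partial>lborel) \<partial>lborel)"
    by (rule nn_integral_cmult) measurable
  also have "(\<integral>\<^sup>+x. (\<integral>\<^sup>+y. ennreal ((a x)\<^sup>2 * exp (- s * \<bar>x - y\<bar>)) * ennreal ((norm (f y))\<^sup>2) \<partial>lborel) \<partial>lborel)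
      = (\<integral>\<^sup>+y. (\<integral>\<^sup>+x. ennreal ((a x)\<^sup>2 * exp (- s * \<bar>x - y\<bar>)) * ennreal ((norm (f y))\<^sup>2) \<partial>lborel) \<partial>lborel)"
    by (rule lborel_pair.Fubini') measurable
  also have "\<dots> = (\<integral>\<^sup>+y. (\<integral>\<^sup>+x. ennreal ((a x)\<^sup>2 * exp (- s * \<bar>x - y\<bar>)) \<partial>lborel) * ennreal ((norm (f y))\<^sup>2) \<partial>lborel)"
    by (intro nn_integral_cong nn_integral_multc) measurable
  also have "\<dots> \<le> (\<integral>\<^sup>+y. ennreal C * ennreal ((norm (f y))\<^sup>2) \<partial>lborel)"
    by (intro nn_integral_mono mult_right_mono weight) auto
  also have "\<dots> = ennreal C * (\<integral>\<^sup>+y. ennreal ((norm (f y))\<^sup>2) \<partial>lborel)"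
    by (rule nn_integral_cmult) measurable
  finally have "(\<integral>\<^sup>+x. ennreal ((norm (kernel_apply f x))\<^sup>2) \<partial>lborel)
      \<le> ennreal (c\<^sup>2 * C) * (ennreal C * (\<integral>\<^sup>+y. ennreal ((norm (f y))\<^sup>2) \<partial>lborel))"
    by (simp add: mult_left_mono)
  also have "\<dots> = ennreal ((c * C)\<^sup>2) * (\<integral>\<^sup>+y. ennreal ((norm (f y))\<^sup>2) \<partial>lborel)"
    using C_nonneg unfolding mult.assoc[symmetric, of "ennreal _" "ennreal _"]
    by (subst ennreal_mult[symmetric]) (auto simp: power2_eq_square mult_ac)
  finally show ?thesis .
qed

lemma measurable_kernel_apply:
  assumes "f \<in> borel_measurable borel"
  shows "kernel_apply f \<in> borel_measurable borel"
  unfolding kernel_apply_def using lborel.borel_measurable_lebesgue_integral[OF measurable_kernel[OF assms]]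
  by simp

lemma sq_integrable_kernel_apply:
  assumes f: "sq_integrable f"
  shows "sq_integrable (kernel_apply f)"
  unfolding sq_integrable_iff_nn_integral
proof
  show "kernel_apply f \<in> borel_measurable borel"
    using f by (intro measurable_kernel_apply) (simp add: sq_integrable_def)
  show "(\<integral>\<^sup>+x. ennreal ((norm (kernel_apply f x))\<^sup>2) \<partial>lborel) < \<infinity>"
    using f by (intro le_less_trans[OF nn_integral_kernel_apply_le])
      (auto simp: sq_integrable_iff_nn_integral ennreal_mult_less_top)
qed

lemma kernel_apply_cong_AE:
  assumes "sq_integrable f" "sq_integrable g" "AE y in lborel. f y = g y"
  shows "kernel_apply f x = kernel_apply g x"
  unfolding kernel_apply_def using assms measurable_kernel_section
  by (intro integral_cong_AE) (auto simp: sq_integrable_def)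

definition kernel_op :: "l2 \<Rightarrow> l2" where
  "kernel_op f = abs_l2 (kernel_apply (rep_l2 f))"

lemma rep_kernel_op: "AE x in lborel. rep_l2 (kernel_op f) x = kernel_apply (rep_l2 f) x"
  unfolding kernel_op_def by (intro rep_abs_l2 sq_integrable_kernel_apply) auto

lemma norm_kernel_op_le: "norm (kernel_op f) \<le> c * C * norm f"
proof -
  have "ennreal ((norm (kernel_op f))\<^sup>2) \<le> ennreal ((c * C)\<^sup>2) * ennreal ((norm f)\<^sup>2)"
    unfolding kernel_op_def norm_abs_l2_square[OF sq_integrable_kernel_apply[OF sq_integrable_rep]]
      nn_integral_sq_integrable[OF sq_integrable_kernel_apply[OF sq_integrable_rep], symmetric]
      norm_l2_nn_integral[of f]
    by (rule nn_integral_kernel_apply_le) auto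
  then have "(norm (kernel_op f))\<^sup>2 \<le> (c * C * norm f)\<^sup>2"
    by (simp add: power_mult_distrib flip: ennreal_mult)
  then show ?thesis
    by (rule power2_le_imp_le) (simp add: c_nonneg C_nonneg)
qed

lemma bounded_linear_kernel_op: "bounded_linear kernel_op"
proof (rule bounded_linear_intro)
  fix f g :: l2 and r :: real
  have "kernel_apply (rep_l2 (f + g)) x = kernel_apply (\<lambda>x. rep_l2 f x + rep_l2 g x) x" for x
    by (intro kernel_apply_cong_AE rep_l2_add sq_integrable_add) auto
  also have "\<dots> x = kernel_apply (rep_l2 f) x + kernel_apply (rep_l2 g) x" for x
    unfolding kernel_apply_def by (simp add: matrix_vector_right_distrib integrable_kernel)
  finally have add: "kernel_apply (rep_l2 (f + g)) x = kernel_apply (rep_l2 f) x + kernel_apply (rep_l2 g) x" for x .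
  show "kernel_op (f + g) = kernel_op f + kernel_op g"
    using rep_kernel_op[of "f + g"] rep_kernel_op[of f] rep_kernel_op[of g] rep_l2_add[of "kernel_op f" "kernel_op g"]
    by (intro l2_eqI, eventually_elim) (simp add: add)
  have "kernel_apply (rep_l2 (r *\<^sub>R f)) x = kernel_apply (\<lambda>x. r *\<^sub>R rep_l2 f x) x" for x
    by (intro kernel_apply_cong_AE rep_l2_scaleR sq_integrable_scaleR) auto
  also have "\<dots> x = r *\<^sub>R kernel_apply (rep_l2 f) x" for x
    unfolding kernel_apply_def by (simp add: matrix_vector_mult_scaleR)
  finally have scale: "kernel_apply (rep_l2 (r *\<^sub>R f)) x = r *\<^sub>R kernel_apply (rep_l2 f) x" for x .
  show "kernel_op (r *\<^sub>R f) = r *\<^sub>R kernel_op f"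
    using rep_kernel_op[of "r *\<^sub>R f"] rep_kernel_op[of f] rep_l2_scaleR[of r "kernel_op f"]
    by (intro l2_eqI, eventually_elim) (simp add: scale)
  show "norm (kernel_op f) \<le> norm f * (c * C)"
    using norm_kernel_op_le[of f] by (simp add: mult_ac)
qed

end

text \<open>Solving \<open>f + K f = g\<close> means finding a fixed point of the contraction
  \<open>f \<mapsto> g - K f\<close>, which exists by completeness; linearity of the solution map
  follows from uniqueness.\<close>

lemma bounded_everywhere_inverse_add:
  fixes K :: "l2 \<Rightarrow> l2"
  assumes K: "bounded_linear K" and q: "q < 1" "\<And>f. norm (K f) \<le> q * norm f"
  shows "bounded_everywhere ({(f, f + K f) | f. True}\<inverse>)"
proof -
  interpret K: bounded_linear K by fact
  \<comment> \<open>The fixed-point theorem asks for a nonnegative contraction constant, and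
    \<open>q\<close> has no lower bound.\<close>
  have q0: "0 \<le> max q 0" "max q 0 < 1" using q by auto
  have qK: "norm (K f) \<le> max q 0 * norm f" for f
    by (rule order_trans[OF q(2)]) (simp add: mult_right_mono)
  have "\<exists>!f. g - K f = f" for g
    by (rule banach_fix_type[OF q0])
      (simp add: dist_norm K.diff[symmetric], metis norm_minus_commute qK)
  then obtain R where R: "\<And>g. g - K (R g) = R g" and uniq: "\<And>f g. g - K f = f \<Longrightarrow> f = R g"
    by metis
  have R_add: "R g + K (R g) = g" for g
    using arg_cong[OF R[of g], of "\<lambda>f. f + K (R g)"] by (simp only: diff_add_cancel)
  have R_eq: "f = R g" if "f + K f = g" for f g
    unfolding that[symmetric] by (rule uniq) (rule add_diff_cancel_right')
  have "bounded_linear R"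
  proof (rule bounded_linear_intro)
    fix f g :: l2 and r :: real
    show "R (f + g) = R f + R g"
      using R_add[of f] R_add[of g] by (intro R_eq[symmetric]) (simp add: K.add algebra_simps)
    show "R (r *\<^sub>R f) = r *\<^sub>R R f"
      by (rule R_eq[symmetric]) (simp only: K.scaleR R_add scaleR_add_right[symmetric])
    have "norm (R f) \<le> norm f + norm (K (R f))"
      using norm_triangle_ineq4[of f "K (R f)"] by (simp add: R)
    also have "\<dots> \<le> norm f + max q 0 * norm (R f)"
      using qK by simp
    finally have "norm (R f) * (1 - max q 0) \<le> norm f"
      by (simp add: algebra_simps)
    then show "norm (R f) \<le> norm f * (1 / (1 - max q 0))"
      using q0 by (simp add: pos_le_divide_eq)
  qed
  moreover have "{(f, f + K f) | f. True}\<inverse> = {(f, R f) | f. True}"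
    using R_add R_eq by (auto simp: converse_def)
  ultimately show ?thesis
    unfolding bounded_everywhere_def by blast
qed

section \<open>Weak derivatives\<close>

lemma test_functionE:
  assumes "test_function \<phi>"
  obtains R where "0 < R" "\<And>x. (\<phi> has_real_derivative deriv \<phi> x) (at x)"
    "continuous_on UNIV \<phi>" "continuous_on UNIV (deriv \<phi>)"
    "\<And>x. R \<le> \<bar>x\<bar> \<Longrightarrow> \<phi> x = 0" "\<And>x. R \<le> \<bar>x\<bar> \<Longrightarrow> deriv \<phi> x = 0"
proof -
  from assms obtain D where D: "\<And>x. (\<phi> has_real_derivative D x) (at x)" "continuous_on UNIV D"
    unfolding test_function_def C1_differentiable_on_def has_real_derivative_iff_has_vector_derivative by auto
  have D_eq: "deriv \<phi> = D"
    using D(1) by (auto intro: DERIV_imp_deriv)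
  from assms obtain B where B: "\<And>x. \<phi> x \<noteq> 0 \<Longrightarrow> \<bar>x\<bar> \<le> B"
    unfolding test_function_def bounded_iff by auto
  \<comment> \<open>The extra 1 puts every \<open>x\<close> with
    \<open>R \<le> \<bar>x\<bar>\<close> into the open set where the function is zero, so that its
    derivative vanishes there too.\<close>
  define R where "R = \<bar>B\<bar> + 1"
  have zero: "\<phi> x = 0" if "\<bar>B\<bar> < \<bar>x\<bar>" for x
    using B[of x] that by force
  have "D x = 0" if "R \<le> \<bar>x\<bar>" for x
  proof -
    have "open {x :: real. \<bar>B\<bar> < \<bar>x\<bar>}"
      by (intro open_Collect_less continuous_intros)
    moreover have "x \<in> {x. \<bar>B\<bar> < \<bar>x\<bar>}" using that by (simp add: R_def)
    ultimately have "((\<lambda>x. 0) has_real_derivative D x) (at x)"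
      using zero has_field_derivative_transform_within_open[OF D(1)[of x], of _ "\<lambda>_. 0"] by auto
    then show ?thesis
      using DERIV_unique DERIV_const by blast
  qed
  with zero D show ?thesis
    by (intro that[of R]) (auto simp: R_def D_eq intro!: DERIV_continuous_on D(1)[THEN has_field_derivative_at_within])
qed

lemma test_functionI:
  assumes "\<And>x. (\<phi> has_real_derivative D x) (at x)" "continuous_on UNIV D" "\<And>x. R \<le> \<bar>x\<bar> \<Longrightarrow> \<phi> x = 0"
  shows "test_function \<phi>"
  unfolding test_function_def C1_differentiable_on_def
proof
  show "\<exists>D. (\<forall>x\<in>UNIV. (\<phi> has_vector_derivative D x) (at x)) \<and> continuous_on UNIV D"
    using assms(1,2) by (auto simp: has_real_derivative_iff_has_vector_derivative)
  show "bounded {x. \<phi> x \<noteq> 0}"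
    unfolding bounded_iff using assms(3) by (intro exI[of _ R]) force
qed

lemma continuous_compact_support_bounded:
  fixes \<psi> :: "real \<Rightarrow> 'a::real_normed_vector"
  assumes cont: "continuous_on UNIV \<psi>" and supp: "\<And>x. R \<le> \<bar>x\<bar> \<Longrightarrow> \<psi> x = 0"
  obtains B where "0 \<le> B" "\<And>x. norm (\<psi> x) \<le> B * indicator {-R..R} x"
proof -
  have "compact (\<psi> ` {-R..R})"
    by (intro compact_continuous_image continuous_on_subset[OF cont]) auto
  then obtain B where B: "\<And>x. x \<in> {-R..R} \<Longrightarrow> norm (\<psi> x) \<le> B"
    using compact_imp_bounded bounded_iff by (metis imageI)
  have "norm (\<psi> x) \<le> \<bar>B\<bar> * indicator {-R..R} x" for x
    using B[of x] supp[of x] by (cases "x \<in> {-R..R}") auto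
  then show ?thesis by (intro that[of "\<bar>B\<bar>"]) auto
qed

lemma integrable_compact_support:
  fixes \<psi> :: "real \<Rightarrow> 'a::{banach, second_countable_topology}"
  assumes cont: "continuous_on UNIV \<psi>" and supp: "\<And>x. R \<le> \<bar>x\<bar> \<Longrightarrow> \<psi> x = 0"
  shows "integrable lborel \<psi>"
proof -
  obtain B where B: "\<And>x. norm (\<psi> x) \<le> B * indicator {-R..R} x"
    using continuous_compact_support_bounded[OF assms] by metis
  have "integrable lborel (\<lambda>x. B * indicator {-R..R} x)"
    by (intro integrable_mult_right integrable_real_indicator) (auto simp: emeasure_lborel_Icc_eq)
  then show ?thesis
    by (rule Bochner_Integration.integrable_bound)
      (use B borel_measurable_continuous_onI[OF cont] in \<open>auto intro: order_trans[OF B abs_ge_self]\<close>)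
qed

lemma mult_le_sum_squares: "p * q \<le> p\<^sup>2 + q\<^sup>2" for p q :: real
proof -
  have "0 \<le> (p - q)\<^sup>2 + p\<^sup>2 + q\<^sup>2" by simp
  then show ?thesis by (simp add: power2_diff)
qed

lemma integrable_mult_sq_integrable:
  fixes f :: "real \<Rightarrow> 'a::{banach, second_countable_topology}"
  assumes \<psi>: "continuous_on UNIV \<psi>" "\<And>x. R \<le> \<bar>x\<bar> \<Longrightarrow> \<psi> x = (0::real)"
    and f: "f \<in> borel_measurable borel" "integrable lborel (\<lambda>x. (norm (f x))\<^sup>2)"
  shows "integrable lborel (\<lambda>x. \<psi> x *\<^sub>R f x)"
proof -
  have "integrable lborel (\<lambda>x. (\<psi> x)\<^sup>2)"
    using \<psi> by (intro integrable_compact_support[of _ R] continuous_intros) auto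
  then have "integrable lborel (\<lambda>x. (\<psi> x)\<^sup>2 + (norm (f x))\<^sup>2)"
    using f(2) by (rule Bochner_Integration.integrable_add)
  then show ?thesis
  proof (rule Bochner_Integration.integrable_bound)
    note [measurable] = f(1) borel_measurable_continuous_onI[OF \<psi>(1)]
    show "(\<lambda>x. \<psi> x *\<^sub>R f x) \<in> borel_measurable lborel" by measurable
    show "AE x in lborel. norm (\<psi> x *\<^sub>R f x) \<le> norm ((\<psi> x)\<^sup>2 + (norm (f x))\<^sup>2)"
      using mult_le_sum_squares[of "\<bar>\<psi> _\<bar>" "norm (f _)"] by simp
  qed
qed

text \<open>The relation is moved from classes to functions and to any Euclidean target, because the
  argument also differentiates scalar combinations of spinor components.\<close>

definition has_weak_deriv :: "(real \<Rightarrow> 'a::euclidean_space) \<Rightarrow> (real \<Rightarrow> 'a) \<Rightarrow> bool" where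
  "has_weak_deriv f g \<longleftrightarrow> (\<forall>\<phi>. test_function \<phi> \<longrightarrow>
     (LINT x|lborel. deriv \<phi> x *\<^sub>R f x) = - (LINT x|lborel. \<phi> x *\<^sub>R g x))"

lemma weak_deriv_iff: "(f, g) \<in> weak_deriv \<longleftrightarrow> has_weak_deriv (rep_l2 f) (rep_l2 g)"
  by (simp add: weak_deriv_def has_weak_deriv_def)

lemma integrable_test:
  fixes f :: "real \<Rightarrow> 'a::euclidean_space"
  assumes "test_function \<phi>" "f \<in> borel_measurable borel" "integrable lborel (\<lambda>x. (norm (f x))\<^sup>2)"
  shows "integrable lborel (\<lambda>x. \<phi> x *\<^sub>R f x)" "integrable lborel (\<lambda>x. deriv \<phi> x *\<^sub>R f x)"
proof -
  obtain R where "continuous_on UNIV \<phi>" "continuous_on UNIV (deriv \<phi>)"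
    "\<And>x. R \<le> \<bar>x\<bar> \<Longrightarrow> \<phi> x = 0" "\<And>x. R \<le> \<bar>x\<bar> \<Longrightarrow> deriv \<phi> x = 0"
    using test_functionE[OF assms(1)] by metis
  then show "integrable lborel (\<lambda>x. \<phi> x *\<^sub>R f x)" "integrable lborel (\<lambda>x. deriv \<phi> x *\<^sub>R f x)"
    using assms(2,3) by (auto intro!: integrable_mult_sq_integrable)
qed

lemma integrable_test_sq:
  assumes "test_function \<phi>" "sq_integrable f"
  shows "integrable lborel (\<lambda>x. \<phi> x *\<^sub>R f x)" "integrable lborel (\<lambda>x. deriv \<phi> x *\<^sub>R f x)"
  using assms(2) integrable_test[OF assms(1), of f] by (simp_all add: sq_integrable_def)

lemma borel_measurable_test:
  assumes "test_function \<phi>"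
  shows "\<phi> \<in> borel_measurable borel" "deriv \<phi> \<in> borel_measurable borel"
  using test_functionE[OF assms] borel_measurable_continuous_onI by metis+

lemma has_weak_deriv_cong_AE:
  fixes f f' g g' :: "real \<Rightarrow> 'a::euclidean_space"
  assumes "has_weak_deriv f g"
    and [measurable]: "f \<in> borel_measurable borel" "f' \<in> borel_measurable borel"
      "g \<in> borel_measurable borel" "g' \<in> borel_measurable borel"
    and AE: "AE x in lborel. f x = f' x" "AE x in lborel. g x = g' x"
  shows "has_weak_deriv f' g'"
  unfolding has_weak_deriv_def
proof (intro allI impI)
  fix \<phi> assume \<phi>: "test_function \<phi>"
  note [measurable] = borel_measurable_test[OF \<phi>]
  have "(LINT x|lborel. deriv \<phi> x *\<^sub>R f' x) = (LINT x|lborel. deriv \<phi> x *\<^sub>R f x)"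
    using AE(1) by (intro integral_cong_AE) auto
  moreover have "(LINT x|lborel. \<phi> x *\<^sub>R g' x) = (LINT x|lborel. \<phi> x *\<^sub>R g x)"
    using AE(2) by (intro integral_cong_AE) auto
  ultimately show "(LINT x|lborel. deriv \<phi> x *\<^sub>R f' x) = - (LINT x|lborel. \<phi> x *\<^sub>R g' x)"
    using assms(1) \<phi> by (simp add: has_weak_deriv_def)
qed

lemma has_weak_deriv_add:
  assumes "has_weak_deriv f f'" "has_weak_deriv g g'"
    and "sq_integrable f" "sq_integrable g" "sq_integrable f'" "sq_integrable g'"
  shows "has_weak_deriv (\<lambda>x. f x + g x) (\<lambda>x. f' x + g' x)"
  unfolding has_weak_deriv_def
proof (intro allI impI)
  fix \<phi> assume \<phi>: "test_function \<phi>"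
  show "(LINT x|lborel. deriv \<phi> x *\<^sub>R (f x + g x)) = - (LINT x|lborel. \<phi> x *\<^sub>R (f' x + g' x))"
    using assms \<phi> integrable_test_sq[OF \<phi>]
    by (simp add: has_weak_deriv_def scaleR_add_right)
qed

lemma has_weak_deriv_linear:
  fixes T :: "'b::euclidean_space \<Rightarrow> 'a::euclidean_space"
  assumes T: "bounded_linear T" and weak: "has_weak_deriv f f'"
    and f: "f \<in> borel_measurable borel" "integrable lborel (\<lambda>x. (norm (f x))\<^sup>2)"
    and f': "f' \<in> borel_measurable borel" "integrable lborel (\<lambda>x. (norm (f' x))\<^sup>2)"
  shows "has_weak_deriv (\<lambda>x. T (f x)) (\<lambda>x. T (f' x))"
  unfolding has_weak_deriv_def
proof (intro allI impI)
  fix \<phi> assume \<phi>: "test_function \<phi>"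
  interpret T: bounded_linear T by fact
  have "(LINT x|lborel. deriv \<phi> x *\<^sub>R T (f x)) = T (LINT x|lborel. deriv \<phi> x *\<^sub>R f x)"
    "(LINT x|lborel. \<phi> x *\<^sub>R T (f' x)) = T (LINT x|lborel. \<phi> x *\<^sub>R f' x)"
    using integral_bounded_linear[OF T integrable_test(2)[OF \<phi> f]]
      integral_bounded_linear[OF T integrable_test(1)[OF \<phi> f']]
    by (simp_all add: T.scaleR)
  then show "(LINT x|lborel. deriv \<phi> x *\<^sub>R T (f x)) = - (LINT x|lborel. \<phi> x *\<^sub>R T (f' x))"
    using weak \<phi> by (simp add: has_weak_deriv_def linear_neg[OF T.linear])
qed

lemma has_weak_deriv_linear_sq:
  fixes T :: "complex^2 \<Rightarrow> 'a::euclidean_space"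
  assumes "bounded_linear T" "has_weak_deriv f f'" "sq_integrable f" "sq_integrable f'"
  shows "has_weak_deriv (\<lambda>x. T (f x)) (\<lambda>x. T (f' x))"
  using assms has_weak_deriv_linear[of T f f'] by (simp add: sq_integrable_def)

text \<open>For \<open>c = 1\<close> or \<open>c = -1\<close> this is the fundamental solution of
  \<open>u' = \<kappa> u + c \<delta>\<close> supported on the half-line of sign \<open>c\<close>;
  it decays when \<open>c\<close> times the real part of \<open>\<kappa>\<close> is
  negative.\<close>

definition half_exp :: "real \<Rightarrow> complex \<Rightarrow> real \<Rightarrow> complex" where
  "half_exp c \<kappa> t = (if 0 < c * t then exp (\<kappa> * t) else 0)"

lemma borel_measurable_half_exp [measurable (raw)]:
  assumes [measurable]: "f \<in> borel_measurable M"
  shows "(\<lambda>x. half_exp c \<kappa> (f x)) \<in> borel_measurable M"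
  unfolding half_exp_def by measurable

text \<open>The distributional equation of \<open>half_exp\<close>: integrating the derivative of
  the test function times the exponential over one half-line leaves the boundary value at
  \<open>y\<close>.\<close>

lemma half_exp_test:
  assumes \<phi>: "test_function \<phi>" and c: "c = 1 \<or> c = -1"
  shows "(LINT x|lborel. of_real (deriv \<phi> x) * half_exp c \<kappa> (x - y))
    = - of_real (c * \<phi> y) - \<kappa> * (LINT x|lborel. of_real (\<phi> x) * half_exp c \<kappa> (x - y))"
proof -
  obtain R where R: "0 < R" and der: "\<And>x. (\<phi> has_real_derivative deriv \<phi> x) (at x)"
    and cont: "continuous_on UNIV \<phi>" "continuous_on UNIV (deriv \<phi>)"
    and supp: "\<And>x. R \<le> \<bar>x\<bar> \<Longrightarrow> \<phi> x = 0" "\<And>x. R \<le> \<bar>x\<bar> \<Longrightarrow> deriv \<phi> x = 0"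
    using test_functionE[OF \<phi>] by metis
  define r where "r = max R \<bar>y\<bar>"
  define e where "e x = exp (\<kappa> * of_real (x - y))" for x :: real
  \<comment> \<open>The interval runs from \<open>y\<close> to \<open>r\<close> or from
    \<open>- r\<close> to \<open>y\<close>. At the outer end the test function vanishes, so only the
    value at \<open>y\<close> survives, with sign \<open>- c\<close>.\<close>
  define a b where "a = (if c = 1 then y else - r)" and "b = (if c = 1 then r else y)"
  have ab: "a \<le> b" by (auto simp: a_def b_def r_def)
  define F where "F x = of_real (\<phi> x) * e x" for x
  define F' where "F' x = of_real (deriv \<phi> x) * e x + \<kappa> * (of_real (\<phi> x) * e x)" for x
  have e_der: "(e has_vector_derivative \<kappa> * e x) (at x)" for x
  proof -
    have "((\<lambda>z. exp (\<kappa> * (z - of_real y))) has_field_derivative \<kappa> * exp (\<kappa> * (of_real x - of_real y))) (at (of_real x))"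
      by (auto intro!: derivative_eq_intros)
    then show ?thesis
      unfolding e_def of_real_diff by (rule has_vector_derivative_real_field)
  qed
  have cont_e: "continuous_on S e" for S
    unfolding e_def by (intro continuous_intros)
  have F_der: "(F has_vector_derivative F' x) (at x within S)" for x S
  proof -
    have "((\<lambda>x. complex_of_real (\<phi> x)) has_vector_derivative of_real (deriv \<phi> x)) (at x)"
      using der[of x] by (intro has_vector_derivative_of_real) (simp add: has_real_derivative_iff_has_vector_derivative)
    then have "(F has_vector_derivative (of_real (\<phi> x) * (\<kappa> * e x) + of_real (deriv \<phi> x) * e x)) (at x)"
      unfolding F_def by (rule has_vector_derivative_mult[OF _ e_der])
    then have "(F has_vector_derivative F' x) (at x)"
      by (simp add: F'_def algebra_simps)
    then show ?thesis by (rule has_vector_derivative_at_within)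
  qed
  have cont_F': "continuous_on UNIV F'"
    unfolding F'_def using cont cont_e by (intro continuous_on_add continuous_on_mult continuous_on_of_real continuous_on_const)
  have "(LINT x|lborel. indicator {a..b} x *\<^sub>R F' x) = F b - F a"
    by (rule integral_FTC_atLeastAtMost[OF ab F_der continuous_on_subset[OF cont_F']]) simp
  also have "F b - F a = - of_real (c * \<phi> y)"
  proof -
    have "F r = 0" "F (- r) = 0" "F y = of_real (\<phi> y)"
      using supp(1)[of r] supp(1)[of "- r"] R by (simp_all add: F_def e_def r_def)
    then show ?thesis
      using c unfolding a_def b_def by (elim disjE) simp_all
  qed
  also have "(LINT x|lborel. indicator {a..b} x *\<^sub>R F' x)
      = (LINT x|lborel. of_real (deriv \<phi> x) * half_exp c \<kappa> (x - y) + \<kappa> * (of_real (\<phi> x) * half_exp c \<kappa> (x - y)))"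
  proof (rule integral_cong_AE)
    have [measurable]: "F' \<in> borel_measurable borel"
      by (intro borel_measurable_continuous_onI cont_F')
    show "(\<lambda>x. indicator {a..b} x *\<^sub>R F' x) \<in> borel_measurable lborel" by measurable
    note [measurable] = borel_measurable_test[OF \<phi>]
    show "(\<lambda>x. of_real (deriv \<phi> x) * half_exp c \<kappa> (x - y) + \<kappa> * (of_real (\<phi> x) * half_exp c \<kappa> (x - y))) \<in> borel_measurable lborel"
      by measurable
    have "AE x in lborel. x \<noteq> y" by (rule AE_lborel_singleton)
    then show "AE x in lborel. indicator {a..b} x *\<^sub>R F' x
        = of_real (deriv \<phi> x) * half_exp c \<kappa> (x - y) + \<kappa> * (of_real (\<phi> x) * half_exp c \<kappa> (x - y))"
    proof eventually_elim
      case (elim x)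
      show ?case
      proof (cases "r < \<bar>x\<bar>")
        case True
        then show ?thesis
          using supp[of x] by (simp add: F'_def r_def)
      next
        case False
        then have "x \<in> {a..b} \<longleftrightarrow> 0 < c * (x - y)"
          using c elim by (auto simp: a_def b_def r_def)
        then show ?thesis by (simp add: F'_def half_exp_def e_def)
      qed
    qed
  qed
  also have "\<dots> = (LINT x|lborel. of_real (deriv \<phi> x) * half_exp c \<kappa> (x - y))
      + \<kappa> * (LINT x|lborel. of_real (\<phi> x) * half_exp c \<kappa> (x - y))"
  proof -
    have "integrable lborel (\<lambda>x. of_real (\<psi> x) * half_exp c \<kappa> (x - y))"
      if "continuous_on UNIV \<psi>" "\<And>x. R \<le> \<bar>x\<bar> \<Longrightarrow> \<psi> x = 0" for \<psi> :: "real \<Rightarrow> real"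
    proof (rule Bochner_Integration.integrable_bound)
      show "integrable lborel (\<lambda>x. of_real (\<psi> x) * e x)"
        using that by (intro integrable_compact_support[of _ R] continuous_intros cont_e) auto
      note [measurable] = borel_measurable_continuous_onI[OF that(1)]
      show "(\<lambda>x. of_real (\<psi> x) * half_exp c \<kappa> (x - y)) \<in> borel_measurable lborel" by measurable
    qed (auto simp: half_exp_def e_def)
    then show ?thesis
      using cont supp by (subst Bochner_Integration.integral_add) auto
  qed
  finally show ?thesis by (simp add: algebra_simps)
qed

section \<open>Convolution with exponential kernels\<close>

lemma mat_vector_mult: "mat k *v (v :: complex^2) = k *s v"
  unfolding vec_eq_iff forall_2 matrix_vector_mult_nth2 vector_smult_component by (simp add: mat_def)

lemma bounded_linear_smult_right: "bounded_linear (\<lambda>v :: complex^2. z *s v)"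
  by (rule bounded_linear_intro[where K = "cmod z"])
    (auto simp: vec_eq_iff norm_vector_scalar_mult algebra_simps)

lemma bounded_linear_smult_left: "bounded_linear (\<lambda>z. z *s (v :: complex^2))"
  by (rule bounded_linear_intro[where K = "norm v"])
    (auto simp: vec_eq_iff norm_vector_scalar_mult algebra_simps)

lemma scaleR_eq_smult: "r *\<^sub>R (v :: complex^2) = of_real r *s v"
  by (simp add: vec_eq_iff scaleR_conv_of_real[where 'a = complex])

lemma scaleR_smult: "r *\<^sub>R (z *s (v :: complex^2)) = (of_real r * z) *s v"
  by (simp add: vec_eq_iff scaleR_conv_of_real[where 'a = complex])

lemma borel_measurable_smult [measurable (raw)]:
  fixes g :: "'a \<Rightarrow> complex^2"
  assumes [measurable]: "f \<in> borel_measurable M" "g \<in> borel_measurable M"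
  shows "(\<lambda>x. f x *s g x) \<in> borel_measurable M"
  by (intro borel_measurable_vec2I) simp_all

lemma borel_measurable_mat [measurable (raw)]:
  assumes [measurable]: "f \<in> borel_measurable M"
  shows "(\<lambda>x. mat (f x) :: complex^2^2) \<in> borel_measurable M"
  by (rule borel_measurable_vec2I; rule borel_measurable_vec2I) (simp_all add: mat_def)

lemma nn_integral_exp_abs_le:
  assumes s: "0 < s"
  shows "(\<integral>\<^sup>+y. ennreal (exp (- s * \<bar>y - x\<bar>)) \<partial>lborel) \<le> ennreal (2 / s)"
proof -
  have half: "(\<integral>\<^sup>+t. ennreal (exp (- s * t)) * indicator {0..} t \<partial>lborel) = ennreal (1 / s)"
  proof -
    have "((\<lambda>t. - exp (- s * t) / s) \<longlongrightarrow> - 0 / s) at_top"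
      using s by (intro tendsto_intros filterlim_compose[OF exp_at_bot]
          filterlim_tendsto_neg_mult_at_bot[OF tendsto_const _ filterlim_ident]) auto
    then have "(\<integral>\<^sup>+t. ennreal (exp (- s * t)) * indicator {0..} t \<partial>lborel) = ennreal (- 0 / s - - exp (- s * 0) / s)"
      using s by (intro nn_integral_FTC_atLeast) (auto intro!: derivative_eq_intros)
    then show ?thesis by simp
  qed
  have reflect: "(\<integral>\<^sup>+t. ennreal (exp (s * t)) * indicator {..0} t \<partial>lborel) = ennreal (1 / s)"
  proof -
    have "indicator {..0} (- t) = (indicator {0..} t :: ennreal)" for t :: real
      by (simp add: indicator_def)
    then show ?thesis
      using half by (subst nn_integral_real_affine[of _ "-1" 0]) auto
  qed
  have "(\<integral>\<^sup>+y. ennreal (exp (- s * \<bar>y - x\<bar>)) \<partial>lborel) = (\<integral>\<^sup>+t. ennreal (exp (- s * \<bar>t\<bar>)) \<partial>lborel)"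
    by (subst nn_integral_real_affine[of _ 1 x]) auto
  also have "\<dots> \<le> (\<integral>\<^sup>+t. ennreal (exp (- s * t)) * indicator {0..} t + ennreal (exp (s * t)) * indicator {..0} t \<partial>lborel)"
    by (intro nn_integral_mono) (auto simp: indicator_def abs_if)
  also have "\<dots> = ennreal (1 / s) + ennreal (1 / s)"
    using half reflect by (subst nn_integral_add) auto
  also have "\<dots> = ennreal (2 / s)"
    using s by (subst ennreal_plus[symmetric]) (auto simp: field_simps)
  finally show ?thesis .
qed

definition conv :: "(real \<Rightarrow> complex) \<Rightarrow> (real \<Rightarrow> complex^2) \<Rightarrow> real \<Rightarrow> complex^2" where
  "conv k g x = (LINT y|lborel. k (x - y) *s g y)"

text \<open>Scalar kernels are written as multiples of the identity matrix, so that the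
  matrix-valued Schur test applies with weight 1.\<close>

locale exp_kernel =
  fixes k :: "real \<Rightarrow> complex" and s :: real
  assumes k_measurable [measurable]: "k \<in> borel_measurable borel"
    and s_pos: "0 < s" and k_le: "\<And>t. cmod (k t) \<le> exp (- s * \<bar>t\<bar>)"
begin

sublocale schur_kernel "\<lambda>x y. mat (k (x - y))" "\<lambda>_. 1" 1 s "2 / s"
proof
  show "(\<lambda>p. mat (k (fst p - snd p)) :: complex^2^2) \<in> borel_measurable (lborel \<Otimes>\<^sub>M lborel)"
    by measurable
  show "norm (mat (k (x - y)) *v v) \<le> 1 * 1 * 1 * exp (- s * \<bar>x - y\<bar>) * norm v" for x y and v :: "complex^2"
    using k_le[of "x - y"] by (simp add: mat_vector_mult norm_vector_scalar_mult mult_right_mono)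
  show "(\<integral>\<^sup>+y. ennreal (1\<^sup>2 * exp (- s * \<bar>y - x\<bar>)) \<partial>lborel) \<le> ennreal (2 / s)" for x
    using nn_integral_exp_abs_le[OF s_pos] by simp
qed (use s_pos in auto)

lemma kernel_apply_eq_conv: "kernel_apply g = conv k g"
  by (simp add: fun_eq_iff kernel_apply_def conv_def mat_vector_mult)

lemma sq_integrable_conv: "sq_integrable g \<Longrightarrow> sq_integrable (conv k g)"
  using sq_integrable_kernel_apply by (simp add: kernel_apply_eq_conv)

lemma integrable_conv: "sq_integrable g \<Longrightarrow> integrable lborel (\<lambda>y. k (x - y) *s g y)"
  using integrable_kernel[of g x] by (simp add: mat_vector_mult)

lemma conv_linear:
  assumes "sq_integrable g"
  shows "conv k (\<lambda>y. M *v g y) x = M *v conv k g x"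
proof -
  have "M *v conv k g x = (LINT y|lborel. M *v (k (x - y) *s g y))"
    unfolding conv_def by (rule integral_bounded_linear[symmetric, OF _ integrable_conv[OF assms]]) simp
  then show ?thesis
    by (simp add: conv_def matrix_vector_mult_scaleC)
qed

text \<open>This licenses Fubini. The product of \<open>\<bar>\<psi> x\<bar>\<close> and the norm of
  \<open>g y\<close> is at most the sum of their squares, and in each summand the exponential is
  integrated over the other variable.\<close>

lemma integrable_compact_conv:
  fixes \<psi> :: "real \<Rightarrow> real"
  assumes \<psi>: "continuous_on UNIV \<psi>" "\<And>x. R \<le> \<bar>x\<bar> \<Longrightarrow> \<psi> x = 0" and g: "sq_integrable g"
  shows "integrable (lborel \<Otimes>\<^sub>M lborel) (\<lambda>(x, y). \<psi> x *\<^sub>R (k (x - y) *s g y))"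
proof (rule integrableI_bounded)
  have [measurable]: "\<psi> \<in> borel_measurable borel" "g \<in> borel_measurable borel"
    using g borel_measurable_continuous_onI[OF \<psi>(1)] by (simp_all add: sq_integrable_def)
  show "(\<lambda>(x, y). \<psi> x *\<^sub>R (k (x - y) *s g y)) \<in> borel_measurable (lborel \<Otimes>\<^sub>M lborel)"
    by measurable
  let ?e = "\<lambda>x y. ennreal (exp (- s * \<bar>x - y\<bar>))"
  have flip: "(\<integral>\<^sup>+y. ?e x y \<partial>lborel) \<le> ennreal (2 / s)" for x
    using nn_integral_exp_abs_le[OF s_pos, of x] by (simp only: abs_minus_commute)
  have "(\<integral>\<^sup>+p. ennreal (norm (case p of (x, y) \<Rightarrow> \<psi> x *\<^sub>R (k (x - y) *s g y))) \<partial>(lborel \<Otimes>\<^sub>M lborel))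
      \<le> (\<integral>\<^sup>+(x, y). ennreal ((\<psi> x)\<^sup>2) * ?e x y + ennreal ((norm (g y))\<^sup>2) * ?e x y \<partial>(lborel \<Otimes>\<^sub>M lborel))"
  proof (rule nn_integral_mono, clarsimp simp: norm_vector_scalar_mult)
    fix x y
    have "\<bar>\<psi> x\<bar> * (cmod (k (x - y)) * norm (g y)) = cmod (k (x - y)) * (\<bar>\<psi> x\<bar> * norm (g y))"
      by (simp add: mult_ac)
    also have "\<dots> \<le> exp (- s * \<bar>x - y\<bar>) * ((\<psi> x)\<^sup>2 + (norm (g y))\<^sup>2)"
      using mult_le_sum_squares[of "\<bar>\<psi> x\<bar>" "norm (g y)"] by (intro mult_mono k_le) auto
    finally have "ennreal (\<bar>\<psi> x\<bar> * (cmod (k (x - y)) * norm (g y)))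
        \<le> ennreal ((\<psi> x)\<^sup>2 * exp (- s * \<bar>x - y\<bar>) + (norm (g y))\<^sup>2 * exp (- s * \<bar>x - y\<bar>))"
      by (intro ennreal_leI) (simp add: algebra_simps)
    then show "ennreal (\<bar>\<psi> x\<bar> * (cmod (k (x - y)) * norm (g y)))
        \<le> ennreal ((\<psi> x)\<^sup>2) * ennreal (exp (- (s * \<bar>x - y\<bar>))) + ennreal ((norm (g y))\<^sup>2) * ennreal (exp (- (s * \<bar>x - y\<bar>)))"
      by (simp add: ennreal_mult)
  qed
  also have "\<dots> = (\<integral>\<^sup>+(x, y). ennreal ((\<psi> x)\<^sup>2) * ?e x y \<partial>(lborel \<Otimes>\<^sub>M lborel))
      + (\<integral>\<^sup>+(x, y). ennreal ((norm (g y))\<^sup>2) * ?e x y \<partial>(lborel \<Otimes>\<^sub>M lborel))"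
    by (subst nn_integral_add[symmetric]) (auto simp: case_prod_unfold)
  also have "(\<integral>\<^sup>+(x, y). ennreal ((\<psi> x)\<^sup>2) * ?e x y \<partial>(lborel \<Otimes>\<^sub>M lborel))
      = (\<integral>\<^sup>+x. \<integral>\<^sup>+y. ennreal ((\<psi> x)\<^sup>2) * ?e x y \<partial>lborel \<partial>lborel)"
    by (subst lborel.nn_integral_fst[symmetric]) auto
  also have "\<dots> = (\<integral>\<^sup>+x. ennreal ((\<psi> x)\<^sup>2) * (\<integral>\<^sup>+y. ?e x y \<partial>lborel) \<partial>lborel)"
    by (intro nn_integral_cong nn_integral_cmult) measurable
  also have "\<dots> \<le> (\<integral>\<^sup>+x. ennreal ((\<psi> x)\<^sup>2) * ennreal (2 / s) \<partial>lborel)"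
    by (intro nn_integral_mono mult_left_mono flip) auto
  also have "\<dots> = (\<integral>\<^sup>+x. ennreal ((\<psi> x)\<^sup>2) \<partial>lborel) * ennreal (2 / s)"
    by (rule nn_integral_multc) measurable
  also have "(\<integral>\<^sup>+(x, y). ennreal ((norm (g y))\<^sup>2) * ?e x y \<partial>(lborel \<Otimes>\<^sub>M lborel))
      = (\<integral>\<^sup>+y. \<integral>\<^sup>+x. ennreal ((norm (g y))\<^sup>2) * ?e x y \<partial>lborel \<partial>lborel)"
    by (subst lborel_pair.nn_integral_snd[symmetric]) auto
  also have "\<dots> = (\<integral>\<^sup>+y. ennreal ((norm (g y))\<^sup>2) * (\<integral>\<^sup>+x. ?e x y \<partial>lborel) \<partial>lborel)"
    by (intro nn_integral_cong nn_integral_cmult) measurable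
  also have "\<dots> \<le> (\<integral>\<^sup>+y. ennreal ((norm (g y))\<^sup>2) * ennreal (2 / s) \<partial>lborel)"
    by (intro nn_integral_mono mult_left_mono nn_integral_exp_abs_le s_pos) auto
  also have "\<dots> = (\<integral>\<^sup>+y. ennreal ((norm (g y))\<^sup>2) \<partial>lborel) * ennreal (2 / s)"
    by (rule nn_integral_multc) measurable
  also have "(\<integral>\<^sup>+x. ennreal ((\<psi> x)\<^sup>2) \<partial>lborel) * ennreal (2 / s)
      + (\<integral>\<^sup>+y. ennreal ((norm (g y))\<^sup>2) \<partial>lborel) * ennreal (2 / s) < \<infinity>"
  proof -
    have "integrable lborel (\<lambda>x. (\<psi> x)\<^sup>2)"
      using \<psi> by (intro integrable_compact_support[of _ R] continuous_intros) auto
    then show ?thesis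
      using g by (simp add: sq_integrable_iff_nn_integral integrable_iff_bounded ennreal_mult_less_top)
  qed
  finally show "(\<integral>\<^sup>+p. ennreal (norm (case p of (x, y) \<Rightarrow> \<psi> x *\<^sub>R (k (x - y) *s g y))) \<partial>(lborel \<Otimes>\<^sub>M lborel)) < \<infinity>"
    by (simp add: add_mono)
qed

lemma integral_compact_conv:
  fixes \<psi> :: "real \<Rightarrow> real"
  assumes \<psi>: "continuous_on UNIV \<psi>" "\<And>x. R \<le> \<bar>x\<bar> \<Longrightarrow> \<psi> x = 0" and g: "sq_integrable g"
  shows "(LINT x|lborel. \<psi> x *\<^sub>R conv k g x) = (LINT y|lborel. (LINT x|lborel. of_real (\<psi> x) * k (x - y)) *s g y)"
    and "integrable lborel (\<lambda>y. (LINT x|lborel. of_real (\<psi> x) * k (x - y)) *s g y)"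
proof -
  note int = integrable_compact_conv[OF assms]
  have k_bounded: "cmod (k t) \<le> 1" for t
    using s_pos by (intro order_trans[OF k_le]) simp
  have inner: "(LINT x|lborel. \<psi> x *\<^sub>R (k (x - y) *s g y)) = (LINT x|lborel. of_real (\<psi> x) * k (x - y)) *s g y" for y
  proof -
    have "integrable lborel (\<lambda>x. complex_of_real (\<psi> x) * k (x - y))"
    proof (rule Bochner_Integration.integrable_bound)
      show "integrable lborel \<psi>" by (rule integrable_compact_support[OF \<psi>])
      note [measurable] = borel_measurable_continuous_onI[OF \<psi>(1)]
      show "(\<lambda>x. complex_of_real (\<psi> x) * k (x - y)) \<in> borel_measurable lborel" by measurable
    qed (auto simp: norm_mult k_bounded intro!: mult_left_le)
    from integral_bounded_linear[OF bounded_linear_smult_left this] show ?thesis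
      by (simp add: scaleR_smult)
  qed
  show "integrable lborel (\<lambda>y. (LINT x|lborel. of_real (\<psi> x) * k (x - y)) *s g y)"
    using lborel_pair.integrable_snd[OF int] by (simp add: inner)
  show "(LINT x|lborel. \<psi> x *\<^sub>R conv k g x) = (LINT y|lborel. (LINT x|lborel. of_real (\<psi> x) * k (x - y)) *s g y)"
    using lborel_pair.Fubini_integral[OF int] by (simp add: inner conv_def)
qed

end

lemma exp_kernel_half_exp:
  assumes "0 < s" and c: "c = 1 \<or> c = -1" and "Re \<kappa> = - c * s"
  shows "exp_kernel (half_exp c \<kappa>) s"
proof
  show "half_exp c \<kappa> \<in> borel_measurable borel"
    using borel_measurable_half_exp[of "\<lambda>x. x" borel] by simp
  show "cmod (half_exp c \<kappa> t) \<le> exp (- s * \<bar>t\<bar>)" for t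
    using c assms(3) by (auto simp: half_exp_def)
qed fact

text \<open>Fubini moves the test function onto the kernel, where \<open>half_exp_test\<close>
  applies for each fixed \<open>y\<close>.\<close>

lemma has_weak_deriv_conv:
  assumes s: "0 < s" and c: "c = 1 \<or> c = -1" and \<kappa>: "Re \<kappa> = - c * s" and g: "sq_integrable g"
  shows "has_weak_deriv (conv (half_exp c \<kappa>) g) (\<lambda>x. \<kappa> *s conv (half_exp c \<kappa>) g x + of_real c *s g x)"
  unfolding has_weak_deriv_def
proof (intro allI impI)
  interpret exp_kernel "half_exp c \<kappa>" s
    by (rule exp_kernel_half_exp[OF s c \<kappa>])
  fix \<phi> assume \<phi>: "test_function \<phi>"
  obtain R where cont: "continuous_on UNIV \<phi>" "continuous_on UNIV (deriv \<phi>)"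
    and supp: "\<And>x. R \<le> \<bar>x\<bar> \<Longrightarrow> \<phi> x = 0" "\<And>x. R \<le> \<bar>x\<bar> \<Longrightarrow> deriv \<phi> x = 0"
    using test_functionE[OF \<phi>] by metis
  let ?u = "conv (half_exp c \<kappa>) g"
  let ?I = "\<lambda>y. LINT x|lborel. of_real (\<phi> x) * half_exp c \<kappa> (x - y)"
  have int_g: "integrable lborel (\<lambda>x. \<phi> x *\<^sub>R g x)" and int_u: "integrable lborel (\<lambda>x. \<phi> x *\<^sub>R ?u x)"
    using integrable_test_sq(1)[OF \<phi>] g sq_integrable_conv[OF g] by auto
  note int_I = integral_compact_conv(2)[OF cont(1) supp(1) g]
  have "(LINT x|lborel. deriv \<phi> x *\<^sub>R ?u x)
      = (LINT y|lborel. (LINT x|lborel. of_real (deriv \<phi> x) * half_exp c \<kappa> (x - y)) *s g y)"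
    by (rule integral_compact_conv(1)[OF cont(2) supp(2) g])
  also have "\<dots> = (LINT y|lborel. - (of_real c *s (\<phi> y *\<^sub>R g y) + \<kappa> *s (?I y *s g y)))"
    unfolding half_exp_test[OF \<phi> c]
    by (intro Bochner_Integration.integral_cong refl) (simp add: scaleR_eq_smult vec_eq_iff algebra_simps)
  also have "\<dots> = - (of_real c *s (LINT y|lborel. \<phi> y *\<^sub>R g y) + \<kappa> *s (LINT y|lborel. ?I y *s g y))"
    using int_g int_I integral_bounded_linear[OF bounded_linear_smult_right[of "of_real c"] int_g]
      integral_bounded_linear[OF bounded_linear_smult_right[of \<kappa>] int_I]
      integrable_bounded_linear[OF bounded_linear_smult_right[of "of_real c"] int_g]
      integrable_bounded_linear[OF bounded_linear_smult_right[of \<kappa>] int_I]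
    by simp
  also have "(LINT y|lborel. ?I y *s g y) = (LINT x|lborel. \<phi> x *\<^sub>R ?u x)"
    by (rule integral_compact_conv(1)[OF cont(1) supp(1) g, symmetric])
  also have "of_real c *s (LINT y|lborel. \<phi> y *\<^sub>R g y) + \<kappa> *s (LINT x|lborel. \<phi> x *\<^sub>R ?u x)
      = (LINT x|lborel. of_real c *s (\<phi> x *\<^sub>R g x) + \<kappa> *s (\<phi> x *\<^sub>R ?u x))"
    using int_g int_u integral_bounded_linear[OF bounded_linear_smult_right[of "of_real c"] int_g]
      integral_bounded_linear[OF bounded_linear_smult_right[of \<kappa>] int_u]
      integrable_bounded_linear[OF bounded_linear_smult_right[of "of_real c"] int_g]
      integrable_bounded_linear[OF bounded_linear_smult_right[of \<kappa>] int_u]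
    by simp
  also have "\<dots> = (LINT x|lborel. \<phi> x *\<^sub>R (\<kappa> *s ?u x + of_real c *s g x))"
    by (intro Bochner_Integration.integral_cong refl) (simp add: scaleR_eq_smult vec_eq_iff algebra_simps)
  finally show "(LINT x|lborel. deriv \<phi> x *\<^sub>R ?u x) = - (LINT x|lborel. \<phi> x *\<^sub>R (\<kappa> *s ?u x + of_real c *s g x))" .
qed

section \<open>Square-integrable weak solutions\<close>

text \<open>Open intervals are stable under intersection and generate the Borel sets, so vanishing
  integrals spread to all Borel sets by Dynkin's argument.\<close>

lemma AE_zero_if_interval_integrals_zero:
  fixes w :: "real \<Rightarrow> complex"
  assumes int: "integrable lborel w"
    and zero: "\<And>a b. a < b \<Longrightarrow> (LINT x|lborel. indicator {a<..<b} x *\<^sub>R w x) = 0"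
  shows "AE x in lborel. w x = 0"
proof (rule sigma_finite_measure.density_zero[OF lborel.sigma_finite_measure_axioms int])
  fix A :: "real set" assume A: "A \<in> sets lborel"
  have ind: "integrable lborel (\<lambda>x. indicator B x *\<^sub>R w x)" if "B \<in> sets borel" for B
    using int that by (intro integrable_mult_indicator) auto
  have box: "(LINT x|lborel. indicator (box a b) x *\<^sub>R w x) = 0" for a b
    using zero[of a b] by (cases "a < b") (auto simp: box_real)
  \<comment> \<open>Exhaustion by growing intervals: the complement case of the induction needs the
    integral over the whole line.\<close>
  have "(\<lambda>n. LINT x|lborel. indicator (box (- real n) (real n)) x *\<^sub>R w x) \<longlonglongrightarrow> (LINT x|lborel. w x)"
  proof (rule integral_dominated_convergence[where w = "\<lambda>x. norm (w x)"])
    show "AE x in lborel. (\<lambda>n. indicator (box (- real n) (real n)) x *\<^sub>R w x) \<longlonglongrightarrow> w x"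
    proof (intro AE_I2 tendsto_eventually)
      fix x :: real
      obtain N :: nat where "\<bar>x\<bar> < N" using reals_Archimedean2 by blast
      then show "\<forall>\<^sub>F n in sequentially. indicator (box (- real n) (real n)) x *\<^sub>R w x = w x"
        by (intro eventually_sequentiallyI[of N]) (auto simp: box_real indicator_def abs_less_iff)
    qed
  qed (use int in \<open>auto simp: indicator_def\<close>)
  then have total: "(LINT x|lborel. w x) = 0"
    unfolding box by (simp add: LIMSEQ_const_iff)
  have A_sigma: "A \<in> sigma_sets UNIV (range (\<lambda>(a, b). box a b))"
    using A[unfolded sets_lborel borel_eq_box] by (simp del: box_real)
  have "Int_stable (range (\<lambda>(a, b). box a b :: real set))"
    by (auto simp: Int_stable_def box_Int_box)
  moreover have "range (\<lambda>(a, b). box a b :: real set) \<subseteq> Pow UNIV"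
    by auto
  ultimately have "(LINT x|lborel. indicator A x *\<^sub>R w x) = 0"
    using A_sigma
  proof (induction rule: sigma_sets_induct_disjoint)
    case (basic B) then show ?case using box by auto
  next
    case empty then show ?case by simp
  next
    case (compl B)
    then have B: "B \<in> sets borel" by (simp add: borel_eq_box del: box_real)
    have "indicator (UNIV - B) x *\<^sub>R w x = w x - indicator B x *\<^sub>R w x" for x
      by (simp add: indicator_def)
    then show ?case
      using int ind[OF B] total compl by simp
  next
    case (union B)
    then have B: "\<And>i. B i \<in> sets borel" by (simp add: borel_eq_box subset_eq del: box_real)
    have "(LINT x:(\<Union>i. B i)|lborel. w x) = (\<Sum>i. (LINT x:(B i)|lborel. w x))"
      using union(1) B ind[of "\<Union>i. B i"]
      by (intro lebesgue_integral_countable_add) (auto simp: disjoint_family_on_def set_integrable_def)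
    then show ?case
      using union(3) by (simp add: set_lebesgue_integral_def)
  qed
  then show "(LINT x:A|lborel. w x) = 0" by (simp add: set_lebesgue_integral_def)
qed

lemma integrable_mult_sq_integrable_complex:
  fixes \<psi> u :: "real \<Rightarrow> complex"
  assumes \<psi>: "continuous_on UNIV \<psi>" "\<And>x. R \<le> \<bar>x\<bar> \<Longrightarrow> \<psi> x = 0"
    and u: "u \<in> borel_measurable borel" "integrable lborel (\<lambda>x. (norm (u x))\<^sup>2)"
  shows "integrable lborel (\<lambda>x. \<psi> x * u x)"
proof (rule Bochner_Integration.integrable_bound)
  show "integrable lborel (\<lambda>x. cmod (\<psi> x) *\<^sub>R u x)"
    using \<psi> by (intro integrable_mult_sq_integrable[of _ R] continuous_intros u) auto
  note [measurable] = u(1) borel_measurable_continuous_onI[OF \<psi>(1)]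
  show "(\<lambda>x. \<psi> x * u x) \<in> borel_measurable lborel" by measurable
qed (simp add: norm_mult)

text \<open>Test functions are real, whereas exponentials with complex exponent must be used; real
  and imaginary parts are tested separately through the functional \<open>p\<close>.\<close>

lemma has_weak_deriv_complex_test:
  fixes u \<Phi> \<Phi>' :: "real \<Rightarrow> complex"
  assumes weak: "has_weak_deriv u (\<lambda>x. \<kappa> * u x)"
    and u: "u \<in> borel_measurable borel" "integrable lborel (\<lambda>x. (norm (u x))\<^sup>2)"
    and \<Phi>: "\<And>x. (\<Phi> has_vector_derivative \<Phi>' x) (at x)" "continuous_on UNIV \<Phi>'" "\<And>x. R \<le> \<bar>x\<bar> \<Longrightarrow> \<Phi> x = 0"
  shows "(LINT x|lborel. (\<Phi>' x + \<kappa> * \<Phi> x) * u x) = 0"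
proof -
  have part: "(LINT x|lborel. p (\<Phi>' x) *\<^sub>R u x + p (\<Phi> x) *\<^sub>R (\<kappa> * u x)) = 0
      \<and> integrable lborel (\<lambda>x. p (\<Phi>' x) *\<^sub>R u x + p (\<Phi> x) *\<^sub>R (\<kappa> * u x))"
    if p: "bounded_linear p" for p :: "complex \<Rightarrow> real"
  proof -
    have der: "((\<lambda>x. p (\<Phi> x)) has_real_derivative p (\<Phi>' x)) (at x)" for x
      unfolding has_real_derivative_iff_has_vector_derivative
      by (rule bounded_linear.has_vector_derivative[OF p \<Phi>(1)])
    have test: "test_function (\<lambda>x. p (\<Phi> x))"
      using \<Phi>(2,3) by (intro test_functionI[OF der, of R] bounded_linear.continuous_on[OF p])
        (simp_all add: linear_0[OF bounded_linear.linear[OF p]])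
    have deriv: "deriv (\<lambda>x. p (\<Phi> x)) x = p (\<Phi>' x)" for x
      by (rule DERIV_imp_deriv[OF der])
    have "integrable lborel (\<lambda>x. (norm (\<kappa> * u x))\<^sup>2)"
      using u(2) by (simp add: norm_mult power_mult_distrib)
    then have int: "integrable lborel (\<lambda>x. p (\<Phi>' x) *\<^sub>R u x)" "integrable lborel (\<lambda>x. p (\<Phi> x) *\<^sub>R (\<kappa> * u x))"
      using integrable_test(2)[OF test u] integrable_test(1)[OF test, of "\<lambda>x. \<kappa> * u x"] u(1)
      by (auto simp: deriv)
    have "(LINT x|lborel. p (\<Phi>' x) *\<^sub>R u x) = - (LINT x|lborel. p (\<Phi> x) *\<^sub>R (\<kappa> * u x))"
      using weak[unfolded has_weak_deriv_def, rule_format, OF test] by (simp add: deriv)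
    then show ?thesis using int by simp
  qed
  have "(LINT x|lborel. (\<Phi>' x + \<kappa> * \<Phi> x) * u x)
      = (LINT x|lborel. (Re (\<Phi>' x) *\<^sub>R u x + Re (\<Phi> x) *\<^sub>R (\<kappa> * u x))
          + \<i> * (Im (\<Phi>' x) *\<^sub>R u x + Im (\<Phi> x) *\<^sub>R (\<kappa> * u x)))"
  proof (intro Bochner_Integration.integral_cong refl)
    fix x
    have split: "z = of_real (Re z) + \<i> * of_real (Im z)" for z by (rule complex_eq)
    show "(\<Phi>' x + \<kappa> * \<Phi> x) * u x = (Re (\<Phi>' x) *\<^sub>R u x + Re (\<Phi> x) *\<^sub>R (\<kappa> * u x))
          + \<i> * (Im (\<Phi>' x) *\<^sub>R u x + Im (\<Phi> x) *\<^sub>R (\<kappa> * u x))"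
      by (subst split[of "\<Phi> x"], subst split[of "\<Phi>' x"]) (simp add: scaleR_conv_of_real algebra_simps)
  qed
  also have "\<dots> = 0"
    using part[OF bounded_linear_Re] part[OF bounded_linear_Im] by simp
  finally show ?thesis .
qed

text \<open>Testing with \<open>\<Phi> x = exp (- \<kappa> x) (\<Theta> x - \<Theta> (x - T))\<close>, where \<open>\<Theta>\<close> is an antiderivative of \<open>\<theta>\<close>,
  shows that the integral does not change under the shift \<open>\<theta> \<mapsto> \<theta> (\<cdot> - T)\<close>; it tends to \<open>0\<close> as
  \<open>Re \<kappa> T \<rightarrow> \<infinity>\<close>.\<close>

lemma weak_exponential_orthogonal:
  fixes u :: "real \<Rightarrow> complex" and \<theta> :: "real \<Rightarrow> real"
  assumes weak: "has_weak_deriv u (\<lambda>x. \<kappa> * u x)" and \<kappa>: "Re \<kappa> \<noteq> 0"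
    and u: "u \<in> borel_measurable borel" "integrable lborel (\<lambda>x. (norm (u x))\<^sup>2)"
    and cont: "continuous_on UNIV \<theta>" and le: "\<And>x. \<bar>\<theta> x\<bar> \<le> 1" and supp: "\<And>x. r \<le> \<bar>x\<bar> \<Longrightarrow> \<theta> x = 0"
    and r: "0 < r"
  shows "(LINT x|lborel. exp (- \<kappa> * of_real x) * of_real (\<theta> x) * u x) = 0"
proof -
  obtain \<Theta> where \<Theta>: "\<And>x. (\<Theta> has_vector_derivative \<theta> x) (at x)"
    using einterval_antiderivative[of "-\<infinity>" "\<infinity>" \<theta>] cont
    by (auto simp: continuous_on_eq_continuous_at)
  have cont_\<Theta>: "continuous_on UNIV \<Theta>"
    by (rule continuous_at_imp_continuous_on) (use \<Theta> has_vector_derivative_continuous in blast)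
  \<comment> \<open>An antiderivative need not have compact support, but it is constant on either
    side of the support of \<open>\<theta>\<close>; hence its difference with a shift of itself is
    zero far out.\<close>
  have \<Theta>_const: "\<Theta> x = \<Theta> y" if "x \<le> y" "y \<le> - r \<or> r \<le> x" for x y
  proof -
    have "(\<Theta> has_vector_derivative 0) (at t within {x..y})" if "t \<in> {x..y}" for t
      using \<Theta>[of t] supp[of t] that \<open>y \<le> - r \<or> r \<le> x\<close> r by (auto intro: has_vector_derivative_at_within)
    then obtain c where "\<And>t. t \<in> {x..y} \<Longrightarrow> \<Theta> t = c"
      using has_vector_derivative_zero_constant[of "{x..y}" \<Theta>] by (metis convex_real_interval(5))
    then show ?thesis using that(1) by auto
  qed
  define e where "e x = exp (- \<kappa> * of_real x)" for x :: real
  have e_der: "(e has_vector_derivative - \<kappa> * e x) (at x)" for x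
  proof -
    have "((\<lambda>z. exp (- \<kappa> * z)) has_field_derivative - \<kappa> * exp (- \<kappa> * of_real x)) (at (of_real x))"
      by (auto intro!: derivative_eq_intros)
    then show ?thesis
      unfolding e_def by (rule has_vector_derivative_real_field)
  qed
  have cont_e: "continuous_on UNIV e"
    unfolding e_def by (intro continuous_intros)
  have cont_shift: "continuous_on UNIV (\<lambda>x. \<theta> (x - T))" for T
    by (rule continuous_on_compose2[OF cont]) (auto intro: continuous_intros)
  have int: "integrable lborel (\<lambda>x. e x * of_real (\<theta> (x - T)) * u x)" for T
    using supp by (intro integrable_mult_sq_integrable_complex[of _ "r + \<bar>T\<bar>"] u continuous_on_mult cont_e
        continuous_on_of_real cont_shift) auto
  define I where "I T = (LINT x|lborel. e x * of_real (\<theta> (x - T)) * u x)" for T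
  have shift: "I 0 = I T" for T
  proof -
    define \<Phi> where "\<Phi> x = e x * of_real (\<Theta> x - \<Theta> (x - T))" for x
    define \<Phi>' where "\<Phi>' x = e x * of_real (\<theta> x - \<theta> (x - T)) + - \<kappa> * e x * of_real (\<Theta> x - \<Theta> (x - T))" for x
    have "((\<lambda>x. \<Theta> (x - T)) has_vector_derivative \<theta> (x - T)) (at x)" for x
    proof -
      have "((\<lambda>x. x - T) has_real_derivative 1) (at x)"
        by (auto intro!: derivative_eq_intros)
      with \<Theta>[of "x - T"] show ?thesis
        unfolding has_real_derivative_iff_has_vector_derivative[symmetric]
        using DERIV_chain2[of \<Theta> "\<theta> (x - T)" "\<lambda>x. x - T" x 1 UNIV] by simp
    qed
    then have diff: "((\<lambda>x. \<Theta> x - \<Theta> (x - T)) has_vector_derivative \<theta> x - \<theta> (x - T)) (at x)" for x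
      by (intro has_vector_derivative_diff \<Theta>)
    have D: "((\<lambda>x. complex_of_real (\<Theta> x - \<Theta> (x - T))) has_vector_derivative of_real (\<theta> x - \<theta> (x - T))) (at x)" for x
      by (rule has_vector_derivative_of_real[OF diff[folded has_real_derivative_iff_has_vector_derivative]])
    have "(\<Phi> has_vector_derivative \<Phi>' x) (at x)" for x
      using has_vector_derivative_mult[OF e_der D, of x] unfolding \<Phi>_def \<Phi>'_def by simp
    moreover have "continuous_on UNIV \<Phi>'"
      unfolding \<Phi>'_def
      by (intro continuous_intros cont_e cont cont_shift cont_\<Theta> continuous_on_compose2[OF cont_\<Theta>, of _ "\<lambda>x. x - T"]) auto
    moreover have "\<Phi> x = 0" if "r + \<bar>T\<bar> \<le> \<bar>x\<bar>" for x
    proof -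
      have "(x \<le> - r \<and> x - T \<le> - r) \<or> (r \<le> x \<and> r \<le> x - T)"
        using that by linarith
      then have "\<Theta> x = \<Theta> (x - T)"
        using \<Theta>_const[of x "x - T"] \<Theta>_const[of "x - T" x] by linarith
      then show ?thesis by (simp add: \<Phi>_def)
    qed
    ultimately have "(LINT x|lborel. (\<Phi>' x + \<kappa> * \<Phi> x) * u x) = 0"
      by (rule has_weak_deriv_complex_test[OF weak u])
    moreover have "(\<Phi>' x + \<kappa> * \<Phi> x) * u x = e x * of_real (\<theta> (x - 0)) * u x - e x * of_real (\<theta> (x - T)) * u x" for x
      by (simp add: \<Phi>_def \<Phi>'_def algebra_simps)
    ultimately show ?thesis
      using int[of 0] int[of T] by (simp add: I_def)
  qed
  \<comment> \<open>On the support of the shifted \<open>\<theta>\<close> the point \<open>x\<close>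
    is within \<open>r\<close> of \<open>T\<close>. Bounding \<open>|u|\<close> by
    \<open>1 + |u|^2\<close> yields the two summands, \<open>2 * r\<close> being the length of that
    support.\<close>
  define C where "C = exp (\<bar>Re \<kappa>\<bar> * r) * (2 * r + (LINT x|lborel. (cmod (u x))\<^sup>2))"
  have bound: "cmod (I T) \<le> exp (- (Re \<kappa> * T)) * C" for T
  proof -
    have ind: "integrable lborel (indicator {T - r..T + r} :: real \<Rightarrow> real)"
      by (intro integrable_real_indicator) (auto simp: emeasure_lborel_Icc_eq)
    have "cmod (e x * of_real (\<theta> (x - T)) * u x)
        \<le> exp (- (Re \<kappa> * T)) * exp (\<bar>Re \<kappa>\<bar> * r) * (indicator {T - r..T + r} x + (cmod (u x))\<^sup>2)" for x
    proof (cases "r \<le> \<bar>x - T\<bar>")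
      case True
      then show ?thesis using supp by simp
    next
      case False
      have "\<bar>Re \<kappa> * (T - x)\<bar> \<le> \<bar>Re \<kappa>\<bar> * r"
        unfolding abs_mult using False by (intro mult_left_mono) auto
      then have "- (Re \<kappa> * x) \<le> - (Re \<kappa> * T) + \<bar>Re \<kappa>\<bar> * r"
        by (simp add: algebra_simps)
      then have "cmod (e x) \<le> exp (- (Re \<kappa> * T)) * exp (\<bar>Re \<kappa>\<bar> * r)"
        by (simp add: e_def flip: exp_add)
      moreover have "cmod (u x) \<le> 1 + (cmod (u x))\<^sup>2"
        using mult_le_sum_squares[of 1 "cmod (u x)"] by simp
      moreover have "x \<in> {T - r..T + r}" using False by auto
      ultimately show ?thesis
        using mult_mono[OF mult_mono[of "cmod (e x)" "exp (- (Re \<kappa> * T)) * exp (\<bar>Re \<kappa>\<bar> * r)" "\<bar>\<theta> (x - T)\<bar>" 1]]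
          le[of "x - T"] by (simp add: norm_mult)
    qed
    note pointwise = this
    have "cmod (I T) \<le> (LINT x|lborel. exp (- (Re \<kappa> * T)) * exp (\<bar>Re \<kappa>\<bar> * r) * (indicator {T - r..T + r} x + (cmod (u x))\<^sup>2))"
      unfolding I_def
      by (intro order_trans[OF integral_norm_bound] Bochner_Integration.integral_mono integrable_norm int
          integrable_mult_right Bochner_Integration.integrable_add ind u(2) pointwise)
    also have "\<dots> = exp (- (Re \<kappa> * T)) * C"
      using u(2) ind r by (simp add: C_def)
    finally show ?thesis .
  qed
  have "(\<lambda>n. exp (- real n) * C) \<longlonglongrightarrow> 0"
  proof -
    have "(\<lambda>n. exp (- real n) * C) \<longlonglongrightarrow> 0 * C"
      by (intro tendsto_intros filterlim_compose[OF exp_at_bot] filterlim_compose[OF filterlim_uminus_at_bot_at_top]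
          filterlim_real_sequentially)
    then show ?thesis by simp
  qed
  moreover have "cmod (I 0) \<le> exp (- real n) * C" for n
    using bound[of "real n / Re \<kappa>"] shift[of "real n / Re \<kappa>"] \<kappa> by simp
  ultimately have "cmod (I 0) \<le> 0"
    by (intro LIMSEQ_le_const) auto
  then show ?thesis by (simp add: I_def e_def)
qed

text \<open>The function \<open>exp (- \<kappa> x) u x\<close> would be a constant in the classical
  sense. Approximating indicators by continuous \<open>\<theta>\<close> shows that its integral over
  every bounded interval is zero.\<close>

lemma weak_exponential_eq_zero:
  fixes u :: "real \<Rightarrow> complex"
  assumes weak: "has_weak_deriv u (\<lambda>x. \<kappa> * u x)" and \<kappa>: "Re \<kappa> \<noteq> 0"
    and u: "u \<in> borel_measurable borel" "integrable lborel (\<lambda>x. (norm (u x))\<^sup>2)"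
  shows "AE x in lborel. u x = 0"
proof -
  define w where "w x = exp (- \<kappa> * of_real x) * u x" for x
  have [measurable]: "w \<in> borel_measurable borel" "u \<in> borel_measurable borel"
    using u(1) unfolding w_def by measurable
  have w_int: "integrable lborel (\<lambda>x. indicator {a<..<b} x *\<^sub>R w x)" for a b
  proof (rule Bochner_Integration.integrable_bound)
    define M where "M = exp (\<bar>Re \<kappa>\<bar> * (\<bar>a\<bar> + \<bar>b\<bar>))"
    have "integrable lborel (indicator {a<..<b} :: real \<Rightarrow> real)"
      by (cases "a \<le> b") auto
    then show "integrable lborel (\<lambda>x. M * (indicator {a<..<b} x + (cmod (u x))\<^sup>2))"
      using u(2) by (intro integrable_mult_right Bochner_Integration.integrable_add)
    have "cmod (indicator {a<..<b} x *\<^sub>R w x) \<le> M * (indicator {a<..<b} x + (cmod (u x))\<^sup>2)" for x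
    proof (cases "x \<in> {a<..<b}")
      case True
      have "- (Re \<kappa> * x) \<le> \<bar>Re \<kappa> * x\<bar>" by simp
      also have "\<dots> \<le> \<bar>Re \<kappa>\<bar> * (\<bar>a\<bar> + \<bar>b\<bar>)"
        unfolding abs_mult using True by (intro mult_left_mono) auto
      finally have "cmod (exp (- \<kappa> * of_real x)) \<le> M" by (simp add: M_def)
      moreover have "cmod (u x) \<le> 1 + (cmod (u x))\<^sup>2"
        using mult_le_sum_squares[of 1 "cmod (u x)"] by simp
      ultimately show ?thesis
        using True mult_mono[of "cmod (exp (- \<kappa> * of_real x))" M "cmod (u x)" "1 + (cmod (u x))\<^sup>2"]
        by (simp add: w_def norm_mult M_def)
    qed (simp add: M_def)
    then show "AE x in lborel. cmod (indicator {a<..<b} x *\<^sub>R w x) \<le> norm (M * (indicator {a<..<b} x + (cmod (u x))\<^sup>2))"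
      by (intro AE_I2) (auto intro: order_trans abs_ge_self)
  qed measurable
  have w_zero: "(LINT x|lborel. indicator {a<..<b} x *\<^sub>R w x) = 0" if ab: "a < b" for a b
  proof -
    \<comment> \<open>Trapezoids of slope \<open>n\<close> that vanish outside the interval; at each
      interior point they equal 1 once \<open>n\<close> is large.\<close>
    define \<theta> where "\<theta> n x = min 1 (real n * max 0 (min (x - a) (b - x)))" for n x
    have \<theta>_le: "\<bar>\<theta> n x\<bar> \<le> indicator {a<..<b} x" for n x
      by (auto simp: \<theta>_def indicator_def max_def min_def)
    have cont: "continuous_on UNIV (\<theta> n)" for n
      unfolding \<theta>_def by (intro continuous_intros)
    have lim: "(\<lambda>n. \<theta> n x) \<longlonglongrightarrow> indicator {a<..<b} x" for x
    proof (cases "x \<in> {a<..<b}")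
      case True
      define d where "d = min (x - a) (b - x)"
      have d: "0 < d" using True by (simp add: d_def)
      obtain N :: nat where N: "1 / d < N" using reals_Archimedean2 by blast
      have "\<theta> n x = 1" if "n \<ge> N" for n
      proof -
        have "1 / d \<le> real n" using N that by simp
        then have "1 \<le> real n * d" using d by (simp add: field_simps)
        then show ?thesis using d by (simp add: \<theta>_def flip: d_def)
      qed
      then show ?thesis
        using True by (intro tendsto_eventually eventually_sequentiallyI[of N]) simp
    next
      case False
      then have "\<theta> n x = 0" for n using \<theta>_le[of n x] by simp
      then show ?thesis using False by simp
    qed
    have "(LINT x|lborel. \<theta> n x *\<^sub>R w x) = 0" for n
    proof -
      have "(LINT x|lborel. exp (- \<kappa> * of_real x) * of_real (\<theta> n x) * u x) = 0"
      proof (rule weak_exponential_orthogonal[OF weak \<kappa> u cont, of _ "\<bar>a\<bar> + \<bar>b\<bar> + 1"])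
        show "\<bar>\<theta> n x\<bar> \<le> 1" for x by (rule order_trans[OF \<theta>_le]) (simp add: indicator_def)
        show "\<theta> n x = 0" if "\<bar>a\<bar> + \<bar>b\<bar> + 1 \<le> \<bar>x\<bar>" for x
        proof -
          have "x \<notin> {a<..<b}" using that by auto
          then show ?thesis using \<theta>_le[of n x] by simp
        qed
      qed simp
      then show ?thesis by (simp add: w_def scaleR_conv_of_real mult_ac)
    qed
    moreover have "(\<lambda>n. LINT x|lborel. \<theta> n x *\<^sub>R w x) \<longlonglongrightarrow> (LINT x|lborel. indicator {a<..<b} x *\<^sub>R w x)"
    proof (rule integral_dominated_convergence[where w = "\<lambda>x. norm (indicator {a<..<b} x *\<^sub>R w x)"])
      note [measurable] = borel_measurable_continuous_onI[OF cont]
      show "(\<lambda>x. \<theta> n x *\<^sub>R w x) \<in> borel_measurable lborel" for n by measurable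
      show "AE x in lborel. (\<lambda>n. \<theta> n x *\<^sub>R w x) \<longlonglongrightarrow> indicator {a<..<b} x *\<^sub>R w x"
        by (intro AE_I2 tendsto_intros lim)
      show "AE x in lborel. norm (\<theta> n x *\<^sub>R w x) \<le> norm (indicator {a<..<b} x *\<^sub>R w x)" for n
        using \<theta>_le[of n] by (intro AE_I2) (simp add: mult_right_mono)
    qed (use w_int[of a b] integrable_norm[OF w_int[of a b]] in auto)
    ultimately show ?thesis by (simp add: LIMSEQ_const_iff)
  qed
  \<comment> \<open>The exponential factor may grow, so \<open>w\<close> is known to be integrable
    only after truncation; countably many truncations cover the line.\<close>
  have "AE x in lborel. indicator {- real n<..<real n} x *\<^sub>R w x = 0" for n
  proof (rule AE_zero_if_interval_integrals_zero[OF w_int])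
    fix a b :: real
    have "indicator {a<..<b} x *\<^sub>R (indicator {- real n<..<real n} x *\<^sub>R w x)
        = indicator {max a (- real n)<..<min b (real n)} x *\<^sub>R w x" for x
      by (auto simp: indicator_def)
    then show "(LINT x|lborel. indicator {a<..<b} x *\<^sub>R (indicator {- real n<..<real n} x *\<^sub>R w x)) = 0"
      using w_zero[of "max a (- real n)" "min b (real n)"]
      by (cases "max a (- real n) < min b (real n)") (simp_all only: greaterThanLessThan_empty not_less, simp_all)
  qed
  then have "AE x in lborel. \<forall>n. indicator {- real n<..<real n} x *\<^sub>R w x = 0"
    by (intro AE_all_countable[THEN iffD2] allI)
  then show ?thesis
  proof eventually_elim
    case (elim x)
    obtain n :: nat where "\<bar>x\<bar> < n" using reals_Archimedean2 by blast
    then have "x \<in> {- real n<..<real n}" by auto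
    then have "w x = 0" using elim by (metis indicator_simps(1) scaleR_one)
    then show "u x = 0" by (simp add: w_def)
  qed
qed

section \<open>The free resolvent\<close>

lemma sq_integrable_matrix:
  assumes f: "sq_integrable f"
  shows "sq_integrable (\<lambda>x. (M :: complex^2^2) *v f x)"
proof -
  have [measurable]: "f \<in> borel_measurable borel" using f by (simp add: sq_integrable_def)
  have "integrable lborel (\<lambda>x. (norm (M *v f x))\<^sup>2)"
  proof (rule Bochner_Integration.integrable_bound)
    show "integrable lborel (\<lambda>x. (norm M)\<^sup>2 * (norm (f x))\<^sup>2)"
      using f by (simp add: sq_integrable_def)
    show "AE x in lborel. norm ((norm (M *v f x))\<^sup>2) \<le> norm ((norm M)\<^sup>2 * (norm (f x))\<^sup>2)"
      by (simp add: norm_matrix_vector_le power_mono flip: power_mult_distrib)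
  qed measurable
  then show ?thesis by (simp add: sq_integrable_def)
qed

lemma bounded_linear_matrix: "bounded_linear ((*v) (M :: complex^2^2))"
  by simp

text \<open>The composed graphs are unfolded once. The intermediate vectors \<open>q\<close> and
  \<open>h\<close> always exist because constant matrices preserve square-integrability.\<close>

lemma mem_dirac_minus_iff:
  "(f, g) \<in> H0 m [-] op_scalar z \<longleftrightarrow> (\<exists>f'. (f, f') \<in> weak_deriv \<and>
    (AE x in lborel. rep_l2 g x = - \<i> *s (sigma1 *v rep_l2 f' x) + of_real m *s (sigma3 *v rep_l2 f x) - z *s rep_l2 f x))"
    (is "?l \<longleftrightarrow> (\<exists>f'. ?r f')")
proof
  assume ?l
  then obtain f' q h where f': "(f, f') \<in> weak_deriv" and q: "(f', q) \<in> mult_op (\<lambda>x. sigma1)"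
    and h: "(f, h) \<in> mult_op (\<lambda>x. sigma3)"
    and g: "g = scaleC (-\<i>) q + scaleC (of_real m) h - scaleC z f"
    unfolding H0_def op_diff_def op_add_def op_comp_def op_scalar_def by blast
  have "AE x in lborel. rep_l2 g x = - \<i> *s (sigma1 *v rep_l2 f' x) + of_real m *s (sigma3 *v rep_l2 f x) - z *s rep_l2 f x"
    using q h rep_l2_diff[of "scaleC (-\<i>) q + scaleC (of_real m) h" "scaleC z f"]
      rep_l2_add[of "scaleC (-\<i>) q" "scaleC (of_real m) h"] rep_l2_scaleC[of "-\<i>" q] rep_l2_scaleC[of "of_real m" h]
      rep_l2_scaleC[of z f]
    unfolding g mult_op_def mem_Collect_eq case_prod_conv
    by eventually_elim simp
  then show "\<exists>f'. ?r f'" using f' by blast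
next
  assume "\<exists>f'. ?r f'"
  then obtain f' where f': "(f, f') \<in> weak_deriv"
    and g: "AE x in lborel. rep_l2 g x = - \<i> *s (sigma1 *v rep_l2 f' x) + of_real m *s (sigma3 *v rep_l2 f x) - z *s rep_l2 f x"
    by blast
  define q h where "q = abs_l2 (\<lambda>x. sigma1 *v rep_l2 f' x)" and "h = abs_l2 (\<lambda>x. sigma3 *v rep_l2 f x)"
  have q: "AE x in lborel. rep_l2 q x = sigma1 *v rep_l2 f' x" and h: "AE x in lborel. rep_l2 h x = sigma3 *v rep_l2 f x"
    unfolding q_def h_def by (intro rep_abs_l2 sq_integrable_matrix sq_integrable_rep)+
  have "g = scaleC (-\<i>) q + scaleC (of_real m) h - scaleC z f"
    using g q h rep_l2_diff[of "scaleC (-\<i>) q + scaleC (of_real m) h" "scaleC z f"]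
      rep_l2_add[of "scaleC (-\<i>) q" "scaleC (of_real m) h"] rep_l2_scaleC[of "-\<i>" q] rep_l2_scaleC[of "of_real m" h]
      rep_l2_scaleC[of z f]
    by (intro l2_eqI, eventually_elim) simp
  then show ?l
    using f' q h unfolding H0_def op_diff_def op_add_def op_comp_def op_scalar_def mult_op_def by blast
qed

lemma sigma_nth [simp]:
  "sigma1 $ 1 $ 1 = 0" "sigma1 $ 1 $ 2 = 1" "sigma1 $ 2 $ 1 = 1" "sigma1 $ 2 $ 2 = 0"
  "sigma3 $ 1 $ 1 = 1" "sigma3 $ 1 $ 2 = 0" "sigma3 $ 2 $ 1 = 0" "sigma3 $ 2 $ 2 = -1"
  by (simp_all add: sigma1_def sigma3_def)

text \<open>Here \<open>k = \<surd>(z\<^sup>2 - m\<^sup>2)\<close> and \<open>\<zeta> = (z + m) / k\<close>; the parameter \<open>e = \<plusminus>1\<close> is the sign of the argument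
  of the Green function.\<close>

definition green_matrix :: "complex \<Rightarrow> complex \<Rightarrow> complex^2^2" where
  "green_matrix \<zeta> e = mat22 (\<i> / 2 * \<zeta>) (\<i> / 2 * e) (\<i> / 2 * e) (\<i> / 2 / \<zeta>)"

definition green :: "complex \<Rightarrow> complex \<Rightarrow> real \<Rightarrow> complex^2^2" where
  "green k \<zeta> t = mat (half_exp 1 (\<i> * k) t) ** green_matrix \<zeta> 1 + mat (half_exp (-1) (- \<i> * k) t) ** green_matrix \<zeta> (-1)"

lemma green_mult:
  "green k \<zeta> t *v v = half_exp 1 (\<i> * k) t *s (green_matrix \<zeta> 1 *v v)
     + half_exp (-1) (- \<i> * k) t *s (green_matrix \<zeta> (-1) *v v)"
  unfolding green_def matrix_vector_mult_add_rdistrib matrix_vector_mul_assoc[symmetric] mat_vector_mult ..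

text \<open>The Frobenius norm of \<open>green_matrix \<zeta> e\<close> for \<open>e\<close> equal
  to 1 or -1. The determinant is then zero, so it is also the operator norm; it equals half of
  \<open>|\<zeta>| + 1 / |\<zeta>|\<close>.\<close>

definition green_bound :: "complex \<Rightarrow> real" where
  "green_bound \<zeta> = sqrt ((cmod \<zeta>)\<^sup>2 + 2 + 1 / (cmod \<zeta>)\<^sup>2) / 2"

lemma norm_green_matrix:
  assumes "e = 1 \<or> e = -1"
  shows "norm (green_matrix \<zeta> e) = green_bound \<zeta>"
proof -
  have "(norm (green_matrix \<zeta> e))\<^sup>2 = (norm (green_matrix \<zeta> e $ 1))\<^sup>2 + (norm (green_matrix \<zeta> e $ 2))\<^sup>2"
    by (simp add: norm_vec_def L2_set_def sum_2)
  also have "\<dots> = (green_bound \<zeta>)\<^sup>2"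
    unfolding norm_complex2 green_matrix_def mat22_nth
    using assms by (auto simp: norm_mult norm_divide green_bound_def power_divide power_mult_distrib field_simps)
  finally show ?thesis
    by (rule power2_eq_imp_eq) (simp_all add: green_bound_def)
qed

text \<open>Two products encode both \<open>k^2 = z^2 - m^2\<close> and
  \<open>\<zeta> = (z + m) / k\<close> in a polynomial form suited to \<open>algebra\<close>. As
  \<open>k\<close> is nonzero, \<open>\<zeta>\<close> is nonzero and \<open>z\<close> differs from
  \<open>m\<close>.\<close>

locale free_resolvent =
  fixes m :: real and z k \<zeta> :: complex
  assumes Im_k: "0 < Im k" and zeta_k: "\<zeta> * k = z + of_real m" and k_eq: "k = \<zeta> * (z - of_real m)"
begin

lemma zeta_nonzero: "\<zeta> \<noteq> 0"
  using k_eq Im_k by auto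

lemma norm_green_le: "norm (green k \<zeta> t *v v) \<le> green_bound \<zeta> * exp (- Im k * \<bar>t\<bar>) * norm v"
proof -
  have *: "cmod (half_exp c \<kappa> t) * norm (green_matrix \<zeta> e *v v) \<le> exp (- Im k * \<bar>t\<bar>) * (green_bound \<zeta> * norm v)"
    if "e = 1 \<or> e = -1" "cmod (half_exp c \<kappa> t) \<le> exp (- Im k * \<bar>t\<bar>)" for c \<kappa> e
    using norm_matrix_vector_le[of "green_matrix \<zeta> e" v] that(2)
    unfolding norm_green_matrix[OF that(1)] by (intro mult_mono) auto
  have "cmod (half_exp 1 (\<i> * k) t) \<le> exp (- Im k * \<bar>t\<bar>)" "cmod (half_exp (-1) (- \<i> * k) t) \<le> exp (- Im k * \<bar>t\<bar>)"
    by (auto simp: half_exp_def)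
  note bounds = *[OF _ this(1), of 1] *[OF _ this(2), of "-1"]
  have "0 \<le> green_bound \<zeta>" by (simp add: green_bound_def)
  then show ?thesis
    using bounds unfolding green_mult
    \<comment> \<open>On either side of 0 only one of the two terms is present, so the bound is not
      doubled.\<close>
    by (cases t "0 :: real" rule: linorder_cases)
      (auto simp: half_exp_def norm_vector_scalar_mult mult_ac)
qed

lemma measurable_green [measurable (raw)]:
  "f \<in> borel_measurable M \<Longrightarrow> (\<lambda>x. green k \<zeta> (f x)) \<in> borel_measurable M"
proof -
  assume [measurable]: "f \<in> borel_measurable M"
  have "(\<lambda>x. mat (half_exp c \<kappa> (f x)) ** green_matrix \<zeta> e) \<in> borel_measurable M" for c \<kappa> e
    by measurable
  then show ?thesis unfolding green_def by (intro borel_measurable_add)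
qed

sublocale schur_kernel "\<lambda>x y. green k \<zeta> (x - y)" "\<lambda>_. 1" "green_bound \<zeta>" "Im k" "2 / Im k"
proof
  show "(\<lambda>p. green k \<zeta> (fst p - snd p)) \<in> borel_measurable (lborel \<Otimes>\<^sub>M lborel)"
    by measurable
  show "norm (green k \<zeta> (x - y) *v v) \<le> green_bound \<zeta> * 1 * 1 * exp (- Im k * \<bar>x - y\<bar>) * norm v" for x y v
    using norm_green_le by simp
  show "(\<integral>\<^sup>+y. ennreal (1\<^sup>2 * exp (- Im k * \<bar>y - x\<bar>)) \<partial>lborel) \<le> ennreal (2 / Im k)" for x
    using nn_integral_exp_abs_le[OF Im_k] by simp
qed (use Im_k in \<open>auto simp: green_bound_def\<close>)

sublocale right: exp_kernel "half_exp 1 (\<i> * k)" "Im k"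
  by (rule exp_kernel_half_exp) (auto simp: Im_k)

sublocale left: exp_kernel "half_exp (-1) (- \<i> * k)" "Im k"
  by (rule exp_kernel_half_exp) (auto simp: Im_k)

lemma kernel_apply_eq:
  assumes g: "sq_integrable g"
  shows "kernel_apply g x = green_matrix \<zeta> 1 *v conv (half_exp 1 (\<i> * k)) g x
    + green_matrix \<zeta> (-1) *v conv (half_exp (-1) (- \<i> * k)) g x"
proof -
  have "kernel_apply g x = conv (half_exp 1 (\<i> * k)) (\<lambda>y. green_matrix \<zeta> 1 *v g y) x
      + conv (half_exp (-1) (- \<i> * k)) (\<lambda>y. green_matrix \<zeta> (-1) *v g y) x"
    unfolding kernel_apply_def conv_def green_mult
    by (intro Bochner_Integration.integral_add right.integrable_conv left.integrable_conv sq_integrable_matrix g)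
  then show ?thesis
    by (simp only: right.conv_linear[OF g] left.conv_linear[OF g])
qed

text \<open>The columns of the two matrices are the polarisations of the plane waves
  \<open>exp (\<i> k t)\<close> and \<open>exp (- \<i> k t)\<close>, so the terms in
  \<open>p\<close> and \<open>q\<close> cancel. The jump
  \<open>green_matrix \<zeta> 1 - green_matrix \<zeta> (-1)\<close> is \<open>\<i>\<close> times
  \<open>sigma1\<close>, which leaves \<open>g\<close>.\<close>

lemma green_identity:
  "- \<i> *s (sigma1 *v (green_matrix \<zeta> 1 *v (\<i> * k *s p + g) + green_matrix \<zeta> (-1) *v (- \<i> * k *s q - g)))
    + of_real m *s (sigma3 *v (green_matrix \<zeta> 1 *v p + green_matrix \<zeta> (-1) *v q))
    - z *s (green_matrix \<zeta> 1 *v p + green_matrix \<zeta> (-1) *v q) = g"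
proof -
  have zk: "z = \<zeta> * k - of_real m" using zeta_k by simp
  have km: "k / \<zeta> = z - of_real m" using k_eq zeta_nonzero by simp
  have km': "\<zeta> * (\<zeta> * k) = k + 2 * of_real m * \<zeta>"
    using k_eq unfolding zk by algebra
  show ?thesis
    unfolding vec_eq_iff forall_2 matrix_vector_mult_nth2 vector_add_component vector_minus_component
      vector_smult_component green_matrix_def mat22_nth sigma_nth zk
    using zeta_nonzero km' by (simp add: field_simps) algebra
qed

lemma kernel_op_mem: "(kernel_op g, g) \<in> H0 m [-] op_scalar z"
proof -
  let ?g = "rep_l2 g"
  define p q where "p = conv (half_exp 1 (\<i> * k)) ?g" and "q = conv (half_exp (-1) (- \<i> * k)) ?g"
  define p' q' where "p' x = \<i> * k *s p x + ?g x" and "q' x = - \<i> * k *s q x - ?g x" for x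
  have sq: "sq_integrable p" "sq_integrable q"
    unfolding p_def q_def using right.sq_integrable_conv left.sq_integrable_conv by auto
  have sq': "sq_integrable p'" "sq_integrable q'"
    unfolding p'_def q'_def by (intro sq_integrable_add sq_integrable_diff sq_integrable_scaleC sq sq_integrable_rep)+
  have p: "has_weak_deriv p p'"
    unfolding p_def p'_def using has_weak_deriv_conv[OF Im_k, of 1 "\<i> * k" ?g] by simp
  have P: "has_weak_deriv (\<lambda>x. green_matrix \<zeta> 1 *v p x) (\<lambda>x. green_matrix \<zeta> 1 *v p' x)"
    by (rule has_weak_deriv_linear_sq[OF bounded_linear_matrix p sq(1) sq'(1)])
  have "(\<lambda>x. - \<i> * k *s q x + of_real (-1) *s ?g x) = q'"
    by (simp add: fun_eq_iff q'_def vec_eq_iff)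
  then have q: "has_weak_deriv q q'"
    using has_weak_deriv_conv[OF Im_k, of "-1" "- \<i> * k" ?g] unfolding q_def by simp
  have Q: "has_weak_deriv (\<lambda>x. green_matrix \<zeta> (-1) *v q x) (\<lambda>x. green_matrix \<zeta> (-1) *v q' x)"
    by (rule has_weak_deriv_linear_sq[OF bounded_linear_matrix q sq(2) sq'(2)])
  define u' where "u' x = green_matrix \<zeta> 1 *v p' x + green_matrix \<zeta> (-1) *v q' x" for x
  have u_eq: "kernel_apply ?g = (\<lambda>x. green_matrix \<zeta> 1 *v p x + green_matrix \<zeta> (-1) *v q x)"
    by (simp add: fun_eq_iff kernel_apply_eq p_def q_def)
  have u: "has_weak_deriv (kernel_apply ?g) u'"
    unfolding u_eq u'_def by (intro has_weak_deriv_add P Q sq_integrable_matrix sq sq')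
  have sq_u': "sq_integrable u'"
    unfolding u'_def by (intro sq_integrable_add sq_integrable_matrix sq')
  define f' where "f' = abs_l2 u'"
  have f': "AE x in lborel. rep_l2 f' x = u' x"
    unfolding f'_def by (rule rep_abs_l2[OF sq_u'])
  have "has_weak_deriv (rep_l2 (kernel_op g)) (rep_l2 f')"
  proof (rule has_weak_deriv_cong_AE[OF u])
    show "AE x in lborel. kernel_apply ?g x = rep_l2 (kernel_op g) x"
      using rep_kernel_op[of g] by eventually_elim simp
    show "AE x in lborel. u' x = rep_l2 f' x"
      using f' by eventually_elim simp
  qed (use sq_u' sq_integrable_kernel_apply[OF sq_integrable_rep[of g]] in \<open>auto simp: sq_integrable_def\<close>)
  moreover have "AE x in lborel. ?g x = - \<i> *s (sigma1 *v rep_l2 f' x)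
      + of_real m *s (sigma3 *v rep_l2 (kernel_op g) x) - z *s rep_l2 (kernel_op g) x"
    using f' rep_kernel_op[of g]
  proof eventually_elim
    case (elim x)
    show ?case
      unfolding elim u_eq u'_def p'_def q'_def green_identity ..
  qed
  ultimately show ?thesis
    unfolding mem_dirac_minus_iff weak_deriv_iff by blast
qed

text \<open>The combinations of the two components with coefficients 1 and
  \<open>e * \<zeta>\<close>, where \<open>e\<close> is 1 or -1, diagonalise the homogeneous system
  into \<open>u' = e \<i> k u\<close>, which has only the zero solution in \<open>L^2\<close> as
  \<open>k\<close> is not real.\<close>

lemma dirac_minus_injective:
  assumes "(f1, g) \<in> H0 m [-] op_scalar z" "(f2, g) \<in> H0 m [-] op_scalar z"
  shows "f1 = f2"
proof -
  obtain f1' f2' where weak: "has_weak_deriv (rep_l2 f1) (rep_l2 f1')" "has_weak_deriv (rep_l2 f2) (rep_l2 f2')"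
    and g1: "AE x in lborel. rep_l2 g x = - \<i> *s (sigma1 *v rep_l2 f1' x) + of_real m *s (sigma3 *v rep_l2 f1 x) - z *s rep_l2 f1 x"
    and g2: "AE x in lborel. rep_l2 g x = - \<i> *s (sigma1 *v rep_l2 f2' x) + of_real m *s (sigma3 *v rep_l2 f2 x) - z *s rep_l2 f2 x"
    using assms unfolding mem_dirac_minus_iff weak_deriv_iff by blast
  define f f' where "f x = rep_l2 f1 x + - rep_l2 f2 x" and "f' x = rep_l2 f1' x + - rep_l2 f2' x" for x
  have sq: "sq_integrable f" "sq_integrable f'"
    unfolding f_def f'_def by (intro sq_integrable_add sq_integrable_minus sq_integrable_rep)+
  have "has_weak_deriv (\<lambda>x. - rep_l2 f2 x) (\<lambda>x. - rep_l2 f2' x)"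
    by (rule has_weak_deriv_linear_sq[OF bounded_linear_minus[OF bounded_linear_ident] weak(2) sq_integrable_rep sq_integrable_rep])
  then have weak_f: "has_weak_deriv f f'"
    unfolding f_def f'_def
    by (intro has_weak_deriv_add weak(1) sq_integrable_minus sq_integrable_rep)
  have ode: "AE x in lborel. f' x $ 1 = \<i> * (z + of_real m) * f x $ 2 \<and> f' x $ 2 = \<i> * (z - of_real m) * f x $ 1"
    using g1 g2
  proof eventually_elim
    case (elim x)
    have "- \<i> *s (sigma1 *v f' x) + of_real m *s (sigma3 *v f x) - z *s f x = 0"
      using elim unfolding f_def f'_def
      by (simp add: matrix_vector_right_distrib matrix_vector_mult_diff_distrib vector_add_ldistrib
          vector_sub_rdistrib vec.diff vec_eq_iff algebra_simps)
    then have "- \<i> * f' x $ 2 + (of_real m - z) * f x $ 1 = 0" "- \<i> * f' x $ 1 - (of_real m + z) * f x $ 2 = 0"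
      unfolding vec_eq_iff forall_2 matrix_vector_mult_nth2 vector_add_component vector_minus_component
        vector_smult_component sigma_nth by (simp_all add: algebra_simps)
    moreover have "\<i> * \<i> = -1" by simp
    ultimately show ?case by algebra
  qed
  have zero: "AE x in lborel. f x $ 1 + e * \<zeta> * f x $ 2 = 0" if e: "e = 1 \<or> e = -1" for e
  proof (rule weak_exponential_eq_zero[where \<kappa> = "e * \<i> * k"])
    let ?T = "\<lambda>v :: complex^2. v $ 1 + e * \<zeta> * v $ 2"
    have T: "bounded_linear ?T"
      by (intro bounded_linear_add bounded_linear_const_mult bounded_linear_vec_nth)
    then interpret T: bounded_linear ?T .
    obtain K where K: "\<And>v. norm (?T v) \<le> norm v * K" using T.bounded by blast
    have [measurable]: "f \<in> borel_measurable borel" "f' \<in> borel_measurable borel"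
      using sq by (auto simp: sq_integrable_def)
    have "has_weak_deriv (\<lambda>x. ?T (f x)) (\<lambda>x. ?T (f' x))"
      by (rule has_weak_deriv_linear_sq[OF T weak_f sq])
    then show "has_weak_deriv (\<lambda>x. ?T (f x)) (\<lambda>x. e * \<i> * k * ?T (f x))"
    proof (rule has_weak_deriv_cong_AE)
      show "AE x in lborel. ?T (f' x) = e * \<i> * k * ?T (f x)"
        using ode
      proof eventually_elim
        case (elim x)
        have "e * e = 1" using e by auto
        then show ?case
          using elim zeta_k k_eq by algebra
      qed
    qed auto
    show "Re (e * \<i> * k) \<noteq> 0" using e Im_k by auto
    show "(\<lambda>x. ?T (f x)) \<in> borel_measurable borel" by measurable
    show "integrable lborel (\<lambda>x. (cmod (?T (f x)))\<^sup>2)"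
    proof (rule Bochner_Integration.integrable_bound)
      show "integrable lborel (\<lambda>x. K\<^sup>2 * (norm (f x))\<^sup>2)"
        using sq by (simp add: sq_integrable_def)
      show "AE x in lborel. norm ((cmod (?T (f x)))\<^sup>2) \<le> norm (K\<^sup>2 * (norm (f x))\<^sup>2)"
        using power_mono[OF K norm_ge_zero, of _ 2] by (simp add: power_mult_distrib mult.commute)
    qed measurable
  qed
  have "AE x in lborel. f x $ 1 + \<zeta> * f x $ 2 = 0" "AE x in lborel. f x $ 1 - \<zeta> * f x $ 2 = 0"
    using zero[of 1] zero[of "-1"] by simp_all
  then have "AE x in lborel. rep_l2 f1 x = rep_l2 f2 x"
  proof eventually_elim
    case (elim x)
    then have "2 * f x $ 1 = 0" "2 * \<zeta> * f x $ 2 = 0" by algebra+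
    then have "f x = 0" using zeta_nonzero by (simp add: vec_eq_iff forall_2)
    then show ?case by (simp add: f_def)
  qed
  then show ?thesis by (rule l2_eqI)
qed

lemma resolvent_eq: "resolvent (H0 m) z = {(f, kernel_op f) | f. True}"
  unfolding resolvent_def using kernel_op_mem dirac_minus_injective by (auto simp: converse_def)

lemma mem_resolvent_set: "z \<in> resolvent_set (H0 m)"
  unfolding resolvent_set_def bounded_everywhere_def
  by (intro CollectI exI[of _ kernel_op] conjI bounded_linear_kernel_op resolvent_eq)

end

section \<open>The spectrum of the free Dirac operator\<close>

text \<open>Off the two half-lines \<open>z^2 - m^2\<close> is not a nonnegative real, so its two
  roots are non-real and opposite, and exactly one lies in the upper half-plane.\<close>

lemma branch_sqrt:
  assumes z: "z \<notin> {of_real x | x. x \<le> - m \<or> m \<le> x}" and m: "0 \<le> m"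
  shows "(branch_sqrt m z)\<^sup>2 = z\<^sup>2 - (of_real m)\<^sup>2" "0 < Im (branch_sqrt m z)"
proof -
  define c where "c = csqrt (z\<^sup>2 - (of_real m)\<^sup>2)"
  have c: "c\<^sup>2 = z\<^sup>2 - (of_real m)\<^sup>2" by (simp add: c_def)
  have "Im c \<noteq> 0"
  proof
    assume "Im c = 0"
    then have "c = of_real (Re c)" by (simp add: complex_eq_iff)
    then have "z\<^sup>2 = of_real ((Re c)\<^sup>2 + m\<^sup>2)"
      using c by (metis diff_add_cancel of_real_add of_real_power)
    also have "\<dots> = (of_real (sqrt ((Re c)\<^sup>2 + m\<^sup>2)))\<^sup>2"
      by (simp flip: of_real_power)
    finally have "z = of_real (sqrt ((Re c)\<^sup>2 + m\<^sup>2)) \<or> z = of_real (- sqrt ((Re c)\<^sup>2 + m\<^sup>2))"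
      by (simp add: power2_eq_iff)
    moreover have "m \<le> sqrt ((Re c)\<^sup>2 + m\<^sup>2)"
      by (rule real_le_rsqrt) simp
    ultimately show False using z by fastforce
  qed
  then obtain w where w: "w\<^sup>2 = z\<^sup>2 - (of_real m)\<^sup>2" "Im w > 0"
    using c by (cases "Im c > 0") (force intro: that[of c], force intro: that[of "- c"])
  have "w' = w" if "w'\<^sup>2 = z\<^sup>2 - (of_real m)\<^sup>2 \<and> 0 < Im w'" for w'
  proof -
    have "w' = w \<or> w' = - w" using that w by (metis power2_eq_iff)
    moreover have "w' \<noteq> - w"
      using that w(2) by (metis less_asym neg_less_0_iff_less uminus_complex.sel(2))
    ultimately show ?thesis by blast
  qed
  then have "branch_sqrt m z = w"
    unfolding branch_sqrt_def using w by (metis (mono_tags, lifting) the_equality)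
  then show "(branch_sqrt m z)\<^sup>2 = z\<^sup>2 - (of_real m)\<^sup>2" "0 < Im (branch_sqrt m z)"
    using w by auto
qed

lemma free_resolvent_branch_sqrt:
  assumes "z \<notin> {of_real x | x. x \<le> - m \<or> m \<le> x}" "0 \<le> m"
  shows "free_resolvent m z (branch_sqrt m z) ((z + of_real m) / branch_sqrt m z)"
proof
  have "branch_sqrt m z \<noteq> 0" using branch_sqrt(2)[OF assms] by auto
  then show "(z + of_real m) / branch_sqrt m z * branch_sqrt m z = z + of_real m"
    "branch_sqrt m z = (z + of_real m) / branch_sqrt m z * (z - of_real m)"
    using branch_sqrt(1)[OF assms] by (simp_all add: field_simps power2_eq_square)
qed (rule branch_sqrt(2)[OF assms])

text \<open>The defining equations make \<open>\<zeta>\<close> a square root of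
  \<open>Phi m z\<close>, so \<open>|Phi m z|\<close> is the square of
  \<open>|\<zeta>|\<close>.\<close>

lemma (in free_resolvent) green_bound_eq_eta: "green_bound \<zeta> = eta (cmod (Phi m z))"
proof -
  have nz: "z - of_real m \<noteq> 0" "\<zeta> \<noteq> 0" using k_eq Im_k zeta_nonzero by auto
  have "\<zeta>\<^sup>2 * (z - of_real m) = z + of_real m"
    using zeta_k k_eq by (metis mult.assoc power2_eq_square)
  then have "\<zeta>\<^sup>2 = Phi m z" using nz by (simp add: Phi_def field_simps)
  then have eq: "cmod (Phi m z) = (cmod \<zeta>)\<^sup>2"
    by (metis norm_power)
  define a where "a = (cmod \<zeta>)\<^sup>2"
  have "0 < a" using nz by (simp add: a_def)
  then have "(sqrt (a + 2 + 1 / a) / 2)\<^sup>2 = (sqrt (1/2 + 1/4 * (a + inverse a)))\<^sup>2"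
    by (simp add: power_divide field_simps)
  then show ?thesis
    unfolding eq green_bound_def eta_def a_def[symmetric]
    by (rule power2_eq_imp_eq) (use \<open>0 < a\<close> in simp_all)
qed

text \<open>Approximate eigenfunctions \<open>exp (- \<epsilon> |t| + i p t) v\<close> for \<open>x\<^sup>2 = p\<^sup>2 + m\<^sup>2\<close>: the residual
  has exactly \<open>\<epsilon>\<close> times their norm.\<close>

locale weyl =
  fixes m x p \<epsilon> :: real and v :: "complex^2"
  assumes eps: "0 < \<epsilon>" and v_nonzero: "v \<noteq> 0"
    and eigen: "of_real p *s (sigma1 *v v) + of_real m *s (sigma3 *v v) = of_real x *s v"
begin

definition wr :: "real \<Rightarrow> complex" where "wr = half_exp 1 (\<i> * p - \<epsilon>)"
definition wl :: "real \<Rightarrow> complex" where "wl = half_exp (-1) (\<i> * p + \<epsilon>)"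
definition wf :: "real \<Rightarrow> complex" where "wf t = wr t + wl t"
definition wd :: "real \<Rightarrow> complex" where "wd t = (\<i> * p - \<epsilon>) * wr t + (\<i> * p + \<epsilon>) * wl t"

lemma measurable_w [measurable]:
  "wr \<in> borel_measurable borel" "wl \<in> borel_measurable borel"
  "wf \<in> borel_measurable borel" "wd \<in> borel_measurable borel"
proof -
  show 1: "wr \<in> borel_measurable borel" "wl \<in> borel_measurable borel"
    unfolding wr_def wl_def using borel_measurable_half_exp[of "\<lambda>x. x" borel] by simp_all
  show "wf \<in> borel_measurable borel" "wd \<in> borel_measurable borel"
    unfolding wf_def wd_def using 1 by measurable
qed

lemma norm_w:
  "cmod (wr t) \<le> exp (- \<epsilon> * \<bar>t\<bar>)" "cmod (wl t) \<le> exp (- \<epsilon> * \<bar>t\<bar>)"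
  "t \<noteq> 0 \<Longrightarrow> cmod (wf t) = exp (- \<epsilon> * \<bar>t\<bar>)" "cmod (wf t) \<le> exp (- \<epsilon> * \<bar>t\<bar>)"
  "cmod (wr t - wl t) = cmod (wf t)"
  by (auto simp: wr_def wl_def wf_def half_exp_def)

lemma integrable_exp_square: "integrable lborel (\<lambda>t. (exp (- \<epsilon> * \<bar>t\<bar>))\<^sup>2)"
proof -
  have "(\<integral>\<^sup>+t. ennreal (exp (- (2 * \<epsilon>) * \<bar>t - 0\<bar>)) \<partial>lborel) < \<infinity>"
    using eps by (intro le_less_trans[OF nn_integral_exp_abs_le]) auto
  moreover have "(exp (- \<epsilon> * \<bar>t\<bar>))\<^sup>2 = exp (- (2 * \<epsilon>) * \<bar>t - 0\<bar>)" for t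
    by (simp add: power2_eq_square flip: exp_add)
  ultimately show ?thesis by (intro integrableI_bounded) auto
qed

lemma integrable_w_square:
  assumes "w \<in> borel_measurable borel" "\<And>t. cmod (w t) \<le> K * exp (- \<epsilon> * \<bar>t\<bar>)"
  shows "integrable lborel (\<lambda>t. (cmod (w t))\<^sup>2)"
proof (rule Bochner_Integration.integrable_bound)
  note [measurable] = assms(1)
  show "integrable lborel (\<lambda>t. K\<^sup>2 * (exp (- \<epsilon> * \<bar>t\<bar>))\<^sup>2)"
    by (intro integrable_mult_right integrable_exp_square)
  show "AE t in lborel. norm ((cmod (w t))\<^sup>2) \<le> norm (K\<^sup>2 * (exp (- \<epsilon> * \<bar>t\<bar>))\<^sup>2)"
    using power_mono[OF assms(2) norm_ge_zero, of _ 2] by (intro AE_I2) (simp add: power_mult_distrib)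
qed (use assms(1) in measurable)

lemma integrable_wf: "integrable lborel (\<lambda>t. (cmod (wf t))\<^sup>2)"
  by (rule integrable_w_square[where K = 1]) (simp_all only: measurable_w norm_w mult_1)

lemma integrable_wd: "integrable lborel (\<lambda>t. (cmod (wd t))\<^sup>2)"
proof (rule integrable_w_square)
  fix t
  have "cmod (wd t) \<le> cmod (\<i> * p - \<epsilon>) * cmod (wr t) + cmod (\<i> * p + \<epsilon>) * cmod (wl t)"
    unfolding wd_def norm_mult[symmetric] by (rule norm_triangle_ineq)
  also have "\<dots> \<le> cmod (\<i> * p - \<epsilon>) * exp (- \<epsilon> * \<bar>t\<bar>) + cmod (\<i> * p + \<epsilon>) * exp (- \<epsilon> * \<bar>t\<bar>)"
    by (intro add_mono mult_left_mono norm_w) auto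
  finally show "cmod (wd t) \<le> (cmod (\<i> * p - \<epsilon>) + cmod (\<i> * p + \<epsilon>)) * exp (- \<epsilon> * \<bar>t\<bar>)"
    by (simp add: distrib_right)
qed measurable

text \<open>Each half contributes a point mass at 0; the two jumps have opposite signs and
  cancel.\<close>

lemma has_weak_deriv_wf: "has_weak_deriv wf wd"
  unfolding has_weak_deriv_def
proof (intro allI impI)
  fix \<phi> assume \<phi>: "test_function \<phi>"
  have sq: "integrable lborel (\<lambda>t. (cmod (wr t))\<^sup>2)" "integrable lborel (\<lambda>t. (cmod (wl t))\<^sup>2)"
    by (rule integrable_w_square[where K = 1]; simp add: norm_w(1,2)[simplified])+
  note int = integrable_test[OF \<phi> measurable_w(1) sq(1)] integrable_test[OF \<phi> measurable_w(2) sq(2)]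
  have "(LINT t|lborel. deriv \<phi> t *\<^sub>R wf t)
      = (LINT t|lborel. deriv \<phi> t *\<^sub>R wr t) + (LINT t|lborel. deriv \<phi> t *\<^sub>R wl t)"
    using int by (simp add: wf_def scaleR_add_right)
  also have "(LINT t|lborel. deriv \<phi> t *\<^sub>R wr t) = - of_real (\<phi> 0) - (\<i> * p - \<epsilon>) * (LINT t|lborel. \<phi> t *\<^sub>R wr t)"
    using half_exp_test[OF \<phi>, of 1 "\<i> * p - \<epsilon>" 0] by (simp add: wr_def scaleR_conv_of_real)
  also have "(LINT t|lborel. deriv \<phi> t *\<^sub>R wl t) = of_real (\<phi> 0) - (\<i> * p + \<epsilon>) * (LINT t|lborel. \<phi> t *\<^sub>R wl t)"
    using half_exp_test[OF \<phi>, of "-1" "\<i> * p + \<epsilon>" 0] by (simp add: wl_def scaleR_conv_of_real)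
  also have "- of_real (\<phi> 0) - (\<i> * p - \<epsilon>) * (LINT t|lborel. \<phi> t *\<^sub>R wr t)
      + (of_real (\<phi> 0) - (\<i> * p + \<epsilon>) * (LINT t|lborel. \<phi> t *\<^sub>R wl t))
      = - ((\<i> * p - \<epsilon>) * (LINT t|lborel. \<phi> t *\<^sub>R wr t) + (\<i> * p + \<epsilon>) * (LINT t|lborel. \<phi> t *\<^sub>R wl t))"
    by simp
  also have "(\<i> * p - \<epsilon>) * (LINT t|lborel. \<phi> t *\<^sub>R wr t) + (\<i> * p + \<epsilon>) * (LINT t|lborel. \<phi> t *\<^sub>R wl t)
      = (LINT t|lborel. (\<i> * p - \<epsilon>) * (\<phi> t *\<^sub>R wr t) + (\<i> * p + \<epsilon>) * (\<phi> t *\<^sub>R wl t))"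
    using int by (simp only: Bochner_Integration.integral_add integrable_mult_right integral_mult_right_zero)
  also have "\<dots> = (LINT t|lborel. \<phi> t *\<^sub>R wd t)"
    by (intro Bochner_Integration.integral_cong refl) (simp add: wd_def scaleR_conv_of_real algebra_simps)
  finally show "(LINT t|lborel. deriv \<phi> t *\<^sub>R wf t) = - (LINT t|lborel. \<phi> t *\<^sub>R wd t)" .
qed

lemma sq_integrable_smult:
  assumes "w \<in> borel_measurable borel" "integrable lborel (\<lambda>t. (cmod (w t))\<^sup>2)"
  shows "sq_integrable (\<lambda>t. w t *s (u :: complex^2))"
  using assms by (simp add: sq_integrable_def norm_vector_scalar_mult power_mult_distrib)

lemma norm_sigma1: "norm (sigma1 *v u) = norm u"
proof -
  have "(norm (sigma1 *v u))\<^sup>2 = (norm u)\<^sup>2"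
    unfolding norm_complex2 matrix_vector_mult_nth2 by simp
  then show ?thesis by simp
qed

text \<open>By \<open>eigen\<close> the plane-wave part cancels and the residual is
  \<open>\<i> \<epsilon> (wr - wl)\<close> times \<open>sigma1 *v v\<close>. As \<open>wr\<close>
  and \<open>wl\<close> have disjoint supports and \<open>sigma1\<close> is isometric, its norm is
  exactly \<open>\<epsilon>\<close> times that of \<open>f\<close>.\<close>

lemma approximate_eigenfunction:
  "\<exists>f g. (f, g) \<in> H0 m [-] op_scalar (of_real x) \<and> norm g = \<epsilon> * norm f \<and> norm f \<noteq> 0"
proof -
  define f f' g where "f = abs_l2 (\<lambda>t. wf t *s v)" and "f' = abs_l2 (\<lambda>t. wd t *s v)"
    and "g = abs_l2 (\<lambda>t. (\<i> * \<epsilon> * (wr t - wl t)) *s (sigma1 *v v))"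
  have "integrable lborel (\<lambda>t. (cmod (\<i> * \<epsilon> * (wr t - wl t)))\<^sup>2)"
    using integrable_wf by (simp add: norm_mult norm_w(5) power_mult_distrib)
  then have sq: "sq_integrable (\<lambda>t. wf t *s v)" "sq_integrable (\<lambda>t. wd t *s v)"
    "sq_integrable (\<lambda>t. (\<i> * \<epsilon> * (wr t - wl t)) *s (sigma1 *v v))"
    by (intro sq_integrable_smult integrable_wf integrable_wd; measurable)+
  have rep: "AE t in lborel. rep_l2 f t = wf t *s v" "AE t in lborel. rep_l2 f' t = wd t *s v"
    "AE t in lborel. rep_l2 g t = (\<i> * \<epsilon> * (wr t - wl t)) *s (sigma1 *v v)"
    unfolding f_def f'_def g_def by (intro rep_abs_l2 sq)+
  have "has_weak_deriv (\<lambda>t. wf t *s v) (\<lambda>t. wd t *s v)"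
    by (rule has_weak_deriv_linear[OF bounded_linear_smult_left has_weak_deriv_wf _ integrable_wf _ integrable_wd])
      measurable
  then have "(f, f') \<in> weak_deriv"
    unfolding weak_deriv_iff
  proof (rule has_weak_deriv_cong_AE)
    show "AE t in lborel. wf t *s v = rep_l2 f t" "AE t in lborel. wd t *s v = rep_l2 f' t"
      using rep(1,2) by (eventually_elim, simp)+
  qed measurable
  moreover have "AE t in lborel. rep_l2 g t = - \<i> *s (sigma1 *v rep_l2 f' t)
      + of_real m *s (sigma3 *v rep_l2 f t) - of_real x *s rep_l2 f t"
    using rep
  proof eventually_elim
    case (elim t)
    have "of_real m *s (sigma3 *v v) - of_real x *s v = - (of_real p *s (sigma1 *v v))"
      using eigen by (simp add: algebra_simps)
    then have "wf t *s (of_real m *s (sigma3 *v v) - of_real x *s v) = wf t *s (- (of_real p *s (sigma1 *v v)))"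
      by simp
    then show ?case
      unfolding elim matrix_vector_mult_scaleC
      by (simp add: vec_eq_iff wf_def wd_def algebra_simps)
  qed
  ultimately have mem: "(f, g) \<in> H0 m [-] op_scalar (of_real x)"
    unfolding mem_dirac_minus_iff by blast
  have "(norm g)\<^sup>2 = \<epsilon>\<^sup>2 * (norm f)\<^sup>2"
    unfolding f_def g_def norm_abs_l2_square[OF sq(1)] norm_abs_l2_square[OF sq(3)]
      norm_vector_scalar_mult norm_mult norm_w(5) norm_sigma1 power_mult_distrib
    using eps by (simp add: mult.assoc)
  then have "(norm g)\<^sup>2 = (\<epsilon> * norm f)\<^sup>2"
    by (simp add: power_mult_distrib)
  then have "norm g = \<epsilon> * norm f"
    by (rule power2_eq_imp_eq) (use eps in auto)
  moreover have "norm f \<noteq> 0"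
  proof
    assume "norm f = 0"
    then have "AE t in lborel. rep_l2 f t = 0"
      using rep_l2_zero by simp
    moreover have "AE t in lborel. t \<noteq> (0 :: real)" by (rule AE_lborel_singleton)
    ultimately have "AE t in (lborel :: real measure). False"
      using rep(1)
    proof eventually_elim
      case (elim t)
      then have "wf t = 0" using v_nonzero by (simp add: vector_mul_eq_0)
      then show False using norm_w(3)[of t] elim by simp
    qed
    then show False
      using AE_iff_measurable[of "UNIV :: real set" lborel "\<lambda>_. False"] by simp
  qed
  ultimately show ?thesis using mem by blast
qed

end

text \<open>The symbol \<open>p sigma1 + m sigma3\<close> squares to \<open>x^2\<close>, so the
  columns of \<open>p sigma1 + m sigma3 + x\<close> are eigenvectors. If the first diagonal entry is
  0 the second column serves, unless \<open>m = x = 0\<close>, where any vector will do.\<close>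

lemma dirac_eigenvector:
  assumes "x \<le> - m \<or> m \<le> x" "0 \<le> m"
  obtains p v where "v \<noteq> 0" "of_real p *s (sigma1 *v v) + of_real m *s (sigma3 *v v) = of_real x *s (v :: complex^2)"
proof -
  define p where "p = sqrt (x\<^sup>2 - m\<^sup>2)"
  have "m\<^sup>2 \<le> x\<^sup>2" using assms by (auto simp: abs_le_square_iff[symmetric])
  then have "p * p = x * x - m * m" by (simp add: p_def power2_eq_square)
  then have p: "complex_of_real p * of_real p = of_real x * of_real x - of_real m * of_real m"
    by (metis of_real_diff of_real_mult)
  have eig: "of_real p *s (sigma1 *v v) + of_real m *s (sigma3 *v v) = of_real x *s v"
    if "v = vector [of_real (m + x), of_real p] \<or> v = vector [of_real p, of_real (x - m)]" for v :: "complex^2"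
    using that
  proof
    assume v: "v = vector [of_real (m + x), of_real p]"
    show ?thesis
      unfolding v vec_eq_iff forall_2 matrix_vector_mult_nth2 vector_add_component
        vector_smult_component sigma_nth using p by (simp add: algebra_simps)
  next
    assume v: "v = vector [of_real p, of_real (x - m)]"
    show ?thesis
      unfolding v vec_eq_iff forall_2 matrix_vector_mult_nth2 vector_add_component
        vector_smult_component sigma_nth using p by (simp add: algebra_simps)
  qed
  show ?thesis
  proof (cases "m + x = 0")
    case False
    have "(vector [of_real (m + x), of_real p] :: complex^2) $ 1 \<noteq> 0"
      using False by (simp flip: of_real_add)
    then have "vector [of_real (m + x), of_real p] \<noteq> (0 :: complex^2)" by (metis zero_index)
    from that[OF this eig] show ?thesis by blast
  next
    case True
    show ?thesis
    proof (cases "x = m")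
      case True
      with \<open>m + x = 0\<close> have "m = 0" "x = 0" by auto
      then show ?thesis
        by (intro that[of "vector [1, 0]" 0]) (auto simp: vec_eq_iff forall_2)
    next
      case False
      have "(vector [of_real p, of_real (x - m)] :: complex^2) $ 2 \<noteq> 0"
        using False by simp
      then have "vector [of_real p, of_real (x - m)] \<noteq> (0 :: complex^2)" by (metis zero_index)
      from that[OF this eig] show ?thesis by blast
    qed
  qed
qed

lemma not_mem_resolvent_set:
  assumes x: "x \<le> - m \<or> m \<le> x" and m: "0 \<le> m"
  shows "complex_of_real x \<notin> resolvent_set (H0 m)"
proof
  assume "complex_of_real x \<in> resolvent_set (H0 m)"
  then obtain R where R: "bounded_linear R" "resolvent (H0 m) (of_real x) = {(f, R f) | f. True}"
    unfolding resolvent_set_def bounded_everywhere_def by blast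
  obtain K where K: "0 < K" "\<And>g. norm (R g) \<le> norm g * K"
    using bounded_linear.pos_bounded[OF R(1)] by blast
  obtain p and v :: "complex^2" where v: "v \<noteq> 0"
    "of_real p *s (sigma1 *v v) + of_real m *s (sigma3 *v v) = of_real x *s v"
    using dirac_eigenvector[OF x m] by metis
  \<comment> \<open>With this \<open>\<epsilon>\<close> the resolvent bound \<open>K\<close> would
    give \<open>norm f \<le> norm f / 2\<close>.\<close>
  interpret weyl m x p "1 / (2 * K)" v
    by unfold_locales (use K v in auto)
  obtain f g where fg: "(f, g) \<in> H0 m [-] op_scalar (of_real x)" "norm g = 1 / (2 * K) * norm f" "norm f \<noteq> 0"
    using approximate_eigenfunction by blast
  have "(g, f) \<in> resolvent (H0 m) (of_real x)"
    using fg(1) by (simp add: resolvent_def)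
  then have "f = R g" using R(2) by auto
  then have "norm f \<le> norm f / 2" using K(2)[of g] K(1) fg(2) by simp
  then show False using fg(3) by simp
qed

lemma resolvent_set_H0:
  assumes "0 \<le> m"
  shows "resolvent_set (H0 m) = - {of_real x | x. x \<le> - m \<or> m \<le> x}"
  using free_resolvent.mem_resolvent_set[OF free_resolvent_branch_sqrt[OF _ assms]] not_mem_resolvent_set[OF _ assms]
  by blast

section \<open>The Birman--Schwinger operator\<close>

lemma mult_op_cong_AE:
  assumes "AE x in lborel. M x = N x"
  shows "mult_op M = mult_op N"
proof -
  have "(AE x in lborel. rep_l2 g x = M x *v rep_l2 f x) \<longleftrightarrow> (AE x in lborel. rep_l2 g x = N x *v rep_l2 f x)" for f g
  proof
    assume "AE x in lborel. rep_l2 g x = M x *v rep_l2 f x"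
    with assms show "AE x in lborel. rep_l2 g x = N x *v rep_l2 f x" by eventually_elim simp
  next
    assume "AE x in lborel. rep_l2 g x = N x *v rep_l2 f x"
    with assms show "AE x in lborel. rep_l2 g x = M x *v rep_l2 f x" by eventually_elim simp
  qed
  then show ?thesis by (simp add: mult_op_def)
qed

lemma lebesgue_measurable_ex_borel:
  fixes f :: "real \<Rightarrow> complex"
  assumes "f \<in> borel_measurable lebesgue"
  shows "\<exists>g \<in> borel_measurable borel. AE x in lborel. f x = g x"
proof -
  have "(\<lambda>x. Re (f x)) \<in> borel_measurable lebesgue" "(\<lambda>x. Im (f x)) \<in> borel_measurable lebesgue"
    using assms by measurable
  then obtain r i where ri [measurable]: "r \<in> borel_measurable lborel" "i \<in> borel_measurable lborel"
    and AE: "AE x in lborel. Re (f x) = r x" "AE x in lborel. Im (f x) = i x"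
    using completion_ex_borel_measurable_real[of _ lborel] by metis
  have "(\<lambda>x. complex_of_real (r x) + \<i> * of_real (i x)) \<in> borel_measurable borel"
    using ri by measurable
  moreover have "AE x in lborel. f x = of_real (r x) + \<i> * of_real (i x)"
    using AE by eventually_elim (simp add: complex_eq_iff)
  ultimately show ?thesis
    by (intro bexI[of _ "\<lambda>x. complex_of_real (r x) + \<i> * of_real (i x)"])
qed

lemma onorm_matrix_nonneg: "0 \<le> onorm ((*v) (M :: complex^2^2))"
  by (intro onorm_pos_le) simp

section \<open>Integrability of the potential and monotonicity of \<open>F\<close>\<close>

locale potential =
  fixes V :: "real \<Rightarrow> complex^2^2"
  assumes entries: "\<And>i j. (\<lambda>x. V x $ i $ j) \<in> L1_plus_L0inf"
begin

abbreviation N :: "real \<Rightarrow> real" where "N x \<equiv> onorm ((*v) (V x))"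

lemma measurable_entries: "(\<lambda>x. V x $ i $ j) \<in> borel_measurable lebesgue"
proof -
  obtain u w where "(\<lambda>x. V x $ i $ j) = (\<lambda>x. u x + w x)" "integrable lebesgue u" "w \<in> borel_measurable lebesgue"
    using entries[of i j] unfolding L1_plus_L0inf_def by auto
  then show ?thesis by (simp add: borel_measurable_integrable)
qed

lemma measurable_V [measurable]: "V \<in> borel_measurable lebesgue"
  by (rule borel_measurable_vec2I; rule borel_measurable_vec2I) (rule measurable_entries)+

lemma norm_bound:
  obtains u W where "integrable lebesgue u" "0 \<le> W" "\<And>x. N x \<le> u x + W"
proof -
  have "\<exists>u W. integrable lebesgue u \<and> 0 \<le> W \<and> (\<forall>x. cmod (V x $ i $ j) \<le> u x + W)" for i j
  proof -
    obtain u w where V: "(\<lambda>x. V x $ i $ j) = (\<lambda>x. u x + w x)" "integrable lebesgue u" "bounded (range w)"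
      using entries[of i j] unfolding L1_plus_L0inf_def by auto
    obtain W where W: "0 < W" "\<And>x. cmod (w x) \<le> W"
      using V(3) unfolding bounded_pos by auto
    have "cmod (V x $ i $ j) \<le> cmod (u x) + W" for x
      using fun_cong[OF V(1), of x] norm_triangle_ineq[of "u x" "w x"] W(2)[of x] by simp
    then show ?thesis
      using V(2) W(1) by (intro exI[of _ "\<lambda>x. cmod (u x)"] exI[of _ W]) auto
  qed
  then obtain u W where uW: "\<And>i j. integrable lebesgue (u i j)" "\<And>i j. 0 \<le> W i j"
    "\<And>i j x. cmod (V x $ i $ j) \<le> u i j x + W i j"
    by metis
  have "N x \<le> (\<Sum>i\<in>UNIV. \<Sum>j\<in>UNIV. u i j x) + (\<Sum>i\<in>UNIV. \<Sum>j\<in>UNIV. W i j)" for x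
  proof -
    have "norm (V x) \<le> (\<Sum>i\<in>UNIV. norm (V x $ i))"
      unfolding norm_vec_def[of "V x"] by (rule L2_set_le_sum) simp
    also have "\<dots> \<le> (\<Sum>i\<in>UNIV. \<Sum>j\<in>UNIV. cmod (V x $ i $ j))"
      unfolding norm_vec_def[of "V x $ _"] by (intro sum_mono L2_set_le_sum) simp
    also have "\<dots> \<le> (\<Sum>i\<in>UNIV. \<Sum>j\<in>UNIV. u i j x + W i j)"
      by (intro sum_mono uW)
    finally show ?thesis
      using onorm_matrix_le[of "V x"] by (simp add: sum.distrib)
  qed
  then show ?thesis
    using uW(1,2) by (intro that[of "\<lambda>x. \<Sum>i\<in>UNIV. \<Sum>j\<in>UNIV. u i j x" "\<Sum>i\<in>UNIV. \<Sum>j\<in>UNIV. W i j"])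
      (auto intro!: sum_nonneg)
qed

lemma integrable_exp_lebesgue:
  fixes s :: real
  assumes s: "0 < s"
  shows "integrable lebesgue (\<lambda>x. exp (- s * \<bar>x - y\<bar>))"
    and "(LINT x|lebesgue. exp (- s * \<bar>x - y\<bar>)) \<le> 2 / s"
proof -
  have int: "integrable lborel (\<lambda>x. exp (- s * \<bar>x - y\<bar>))"
    using s by (intro integrableI_bounded) (auto intro!: le_less_trans[OF nn_integral_exp_abs_le[of s y, simplified]])
  then show "integrable lebesgue (\<lambda>x. exp (- s * \<bar>x - y\<bar>))"
    by (subst integrable_completion) auto
  have "ennreal (LINT x|lborel. exp (- s * \<bar>x - y\<bar>)) \<le> ennreal (2 / s)"
    using nn_integral_exp_abs_le[OF s, of y] nn_integral_eq_integral[OF int] by simp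
  then have "(LINT x|lborel. exp (- s * \<bar>x - y\<bar>)) \<le> 2 / s"
    using s by (simp add: ennreal_le_iff)
  then show "(LINT x|lebesgue. exp (- s * \<bar>x - y\<bar>)) \<le> 2 / s"
    by (subst integral_completion) auto
qed

text \<open>A real supremum is meaningful only for a set that is bounded above. The
  \<open>L^1\<close> part contributes at most its norm for every \<open>y\<close>, the bounded part
  at most \<open>2 / s\<close> times its bound.\<close>

lemma integral_bounded:
  fixes s :: real
  assumes s: "0 < s"
  shows "integrable lebesgue (\<lambda>x. N x * exp (- s * \<bar>x - y\<bar>))"
    and "bdd_above (range (\<lambda>y. LINT x|lebesgue. N x * exp (- s * \<bar>x - y\<bar>)))"
proof -
  obtain u W where u: "integrable lebesgue u" and W: "0 \<le> W" and le: "\<And>x. N x \<le> u x + W"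
    using norm_bound by metis
  have le': "N x * exp (- s * \<bar>x - y\<bar>) \<le> \<bar>u x\<bar> + W * exp (- s * \<bar>x - y\<bar>)" for x y
  proof -
    have "N x * exp (- s * \<bar>x - y\<bar>) \<le> (\<bar>u x\<bar> + W) * exp (- s * \<bar>x - y\<bar>)"
      using le[of x] by (intro mult_right_mono) auto
    also have "\<dots> \<le> \<bar>u x\<bar> + W * exp (- s * \<bar>x - y\<bar>)"
      using s by (simp add: distrib_right mult_left_le)
    finally show ?thesis .
  qed
  have int_bound: "integrable lebesgue (\<lambda>x. \<bar>u x\<bar> + W * exp (- s * \<bar>x - y\<bar>))" for y
    using u integrable_exp_lebesgue(1)[OF s] by (intro Bochner_Integration.integrable_add integrable_mult_right) auto
  have meas: "(\<lambda>x. N x * exp (- s * \<bar>x - y\<bar>)) \<in> borel_measurable lebesgue" for y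
  proof -
    have "(\<lambda>x. exp (- s * \<bar>x - y\<bar>)) \<in> borel_measurable lebesgue"
      using integrable_exp_lebesgue(1)[OF s] by (rule borel_measurable_integrable)
    then show ?thesis
      using borel_measurable_onorm[OF measurable_V] by (intro borel_measurable_times)
  qed
  show int: "integrable lebesgue (\<lambda>x. N x * exp (- s * \<bar>x - y\<bar>))" for y
    by (rule Bochner_Integration.integrable_bound[OF int_bound[of y] meas])
      (intro AE_I2, use le' W onorm_matrix_nonneg in \<open>auto simp: abs_mult intro: order_trans[OF _ abs_ge_self]\<close>)
  have "(LINT x|lebesgue. N x * exp (- s * \<bar>x - y\<bar>)) \<le> (LINT x|lebesgue. \<bar>u x\<bar>) + W * (2 / s)" for y
  proof -
    have "(LINT x|lebesgue. N x * exp (- s * \<bar>x - y\<bar>)) \<le> (LINT x|lebesgue. \<bar>u x\<bar> + W * exp (- s * \<bar>x - y\<bar>))"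
      by (intro Bochner_Integration.integral_mono int int_bound le')
    also have "\<dots> = (LINT x|lebesgue. \<bar>u x\<bar>) + W * (LINT x|lebesgue. exp (- s * \<bar>x - y\<bar>))"
      using u integrable_exp_lebesgue(1)[OF s] by simp
    also have "\<dots> \<le> (LINT x|lebesgue. \<bar>u x\<bar>) + W * (2 / s)"
      by (intro add_left_mono mult_left_mono integrable_exp_lebesgue(2) s W)
    finally show ?thesis .
  qed
  then show "bdd_above (range (\<lambda>y. LINT x|lebesgue. N x * exp (- s * \<bar>x - y\<bar>)))"
    by (auto simp: bdd_above_def)
qed

lemma integral_le_F: "0 < s \<Longrightarrow> (LINT x|lebesgue. N x * exp (- s * \<bar>x - y\<bar>)) \<le> F V s"
  unfolding F_def by (rule cSUP_upper[OF _ integral_bounded(2)]) auto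

lemma F_nonneg: "0 < s \<Longrightarrow> 0 \<le> F V s"
  by (rule order_trans[OF _ integral_le_F[of s 0]]) (auto intro!: integral_nonneg_AE AE_I2 mult_nonneg_nonneg onorm_matrix_nonneg)

lemma F_antimono:
  assumes "0 < s" "s \<le> t"
  shows "F V t \<le> F V s"
  unfolding F_def[of V t]
proof (rule cSUP_least)
  fix y
  have "(LINT x|lebesgue. N x * exp (- t * \<bar>x - y\<bar>)) \<le> (LINT x|lebesgue. N x * exp (- s * \<bar>x - y\<bar>))"
    using assms
    by (intro Bochner_Integration.integral_mono integral_bounded mult_left_mono onorm_matrix_nonneg)
      (auto intro: mult_right_mono)
  also have "\<dots> \<le> F V s" by (rule integral_le_F[OF assms(1)])
  finally show "(LINT x|lebesgue. N x * exp (- t * \<bar>x - y\<bar>)) \<le> F V s" .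
qed simp

text \<open>The Schur test works with Borel kernels on the product space, while the entries of
  \<open>V\<close> are only Lebesgue measurable. Multiplication operators do not see the change on a
  null set.\<close>

lemma ex_borel_version: "\<exists>V'. V' \<in> borel_measurable borel \<and> (AE x in lborel. V x = V' x)"
proof -
  have "\<forall>i j. \<exists>g. g \<in> borel_measurable borel \<and> (AE x in lborel. V x $ i $ j = g x)"
    using lebesgue_measurable_ex_borel[OF measurable_entries] by blast
  then obtain g where g: "\<And>i j. g i j \<in> borel_measurable borel" "\<And>i j. AE x in lborel. V x $ i $ j = g i j x"
    by metis
  have "(\<lambda>x. mat22 (g 1 1 x) (g 1 2 x) (g 2 1 x) (g 2 2 x)) \<in> borel_measurable borel"
    using g(1) by measurable
  moreover have "AE x in lborel. V x = mat22 (g 1 1 x) (g 1 2 x) (g 2 1 x) (g 2 2 x)"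
    using g(2)[of 1 1] g(2)[of 1 2] g(2)[of 2 1] g(2)[of 2 2] by eventually_elim (simp add: mat22_eq_iff)
  ultimately show ?thesis by blast
qed

end

section \<open>The Birman-Schwinger kernel and its closure\<close>

locale borel_potential = potential V + free_resolvent m z k \<zeta>
  for V V' :: "real \<Rightarrow> complex^2^2" and m :: real and z k \<zeta> :: complex +
  assumes V'_measurable [measurable]: "V' \<in> borel_measurable borel"
    and V'_eq: "AE x in lborel. V x = V' x"
begin

definition a :: "real \<Rightarrow> real" where "a x = sqrt (onorm ((*v) (V' x)))"
definition A :: "real \<Rightarrow> complex^2^2" where "A x = psd_sqrt (mat_abs (V' x))"
definition B :: "real \<Rightarrow> complex^2^2" where "B x = polar_U (V' x) ** psd_sqrt (mat_abs (V' x))"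

lemma a_square: "(a x)\<^sup>2 = onorm ((*v) (V' x))"
  by (simp add: a_def onorm_matrix_nonneg)

lemma measurable_aAB [measurable]:
  "a \<in> borel_measurable borel" "A \<in> borel_measurable borel" "B \<in> borel_measurable borel"
  unfolding a_def[abs_def] A_def[abs_def] B_def[abs_def] by measurable

lemma a_nonneg: "0 \<le> a x" by (simp add: a_def onorm_matrix_nonneg)

lemma norm_A_le: "norm (A x *v v) \<le> a x * norm v" and norm_B_le: "norm (B x *v v) \<le> a x * norm v"
  using norm_sqrt_abs_le[of "V' x" v] norm_polar_sqrt_abs_le[of "V' x" v] a_nonneg[of x]
  by (auto intro!: power2_le_imp_le[of "norm (_ *v v)"] simp: A_def B_def power_mult_distrib a_square)

lemma opA_eq: "opA V = mult_op A" and opB_eq: "opB V = mult_op B"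
  unfolding opA_def opB_def using V'_eq
  by (intro mult_op_cong_AE, eventually_elim, simp add: A_def B_def)+

text \<open>By definition \<open>a^2\<close> is the norm of the Borel version, so the column
  integral is the one inside \<open>F\<close>; the rest is the passage between \<open>lborel\<close>
  and its completion.\<close>

lemma weight_le_F: "(\<integral>\<^sup>+y. ennreal ((a y)\<^sup>2 * exp (- Im k * \<bar>y - x\<bar>)) \<partial>lborel) \<le> ennreal (F V (Im k))"
proof -
  let ?f = "\<lambda>y. N y * exp (- Im k * \<bar>y - x\<bar>)" and ?g = "\<lambda>y. (a y)\<^sup>2 * exp (- Im k * \<bar>y - x\<bar>)"
  have meas: "?g \<in> borel_measurable lborel" by measurable
  have AE: "AE y in lebesgue. ?f y = ?g y"
    using AE_completion[OF V'_eq] by eventually_elim (simp add: a_square)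
  have meas': "?g \<in> borel_measurable lebesgue" using meas by (rule measurable_completion)
  have "integrable lebesgue ?g"
    using integral_bounded(1)[OF Im_k, of x] integrable_cong_AE[OF _ meas' AE] borel_measurable_integrable by blast
  then have int: "integrable lborel ?g"
    using integrable_completion[OF meas] by blast
  have "(\<integral>\<^sup>+y. ennreal (?g y) \<partial>lborel) = ennreal (LINT y|lborel. ?g y)"
    by (rule nn_integral_eq_integral[OF int]) simp
  also have "(LINT y|lborel. ?g y) = (LINT y|lebesgue. ?g y)"
    by (rule integral_completion[OF meas, symmetric])
  also have "\<dots> = (LINT y|lebesgue. ?f y)"
    using AE by (intro integral_cong_AE meas' borel_measurable_integrable[OF integral_bounded(1)[OF Im_k]]) auto
  also have "ennreal \<dots> \<le> ennreal (F V (Im k))"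
    by (intro ennreal_leI integral_le_F Im_k)
  finally show ?thesis .
qed

sublocale bs: schur_kernel "\<lambda>x y. A x ** green k \<zeta> (x - y) ** B y" a "green_bound \<zeta>" "Im k" "F V (Im k)"
proof
  show "(\<lambda>p. A (fst p) ** green k \<zeta> (fst p - snd p) ** B (snd p)) \<in> borel_measurable (lborel \<Otimes>\<^sub>M lborel)"
    by measurable
  show "norm ((A x ** green k \<zeta> (x - y) ** B y) *v v) \<le> green_bound \<zeta> * a x * a y * exp (- Im k * \<bar>x - y\<bar>) * norm v" for x y v
  proof -
    have gb: "0 \<le> green_bound \<zeta>" by (simp add: green_bound_def)
    have "norm ((A x ** green k \<zeta> (x - y) ** B y) *v v) \<le> a x * norm (green k \<zeta> (x - y) *v (B y *v v))"
      using norm_A_le by (simp flip: matrix_vector_mul_assoc)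
    also have "\<dots> \<le> a x * (green_bound \<zeta> * exp (- Im k * \<bar>x - y\<bar>) * norm (B y *v v))"
      by (intro mult_left_mono norm_green_le a_nonneg)
    also have "\<dots> \<le> a x * (green_bound \<zeta> * exp (- Im k * \<bar>x - y\<bar>) * (a y * norm v))"
      using gb by (intro mult_left_mono norm_B_le a_nonneg) auto
    finally show ?thesis by (simp add: mult_ac)
  qed
qed (use Im_k F_nonneg a_nonneg weight_le_F in \<open>auto simp: green_bound_def\<close>)

text \<open>The matrix \<open>A x\<close> is moved under the integral. Since the Schur test puts the
  result in \<open>L^2\<close>, \<open>kernel_op p\<close> lies in the domain of the unbounded
  operator \<open>A\<close> automatically.\<close>

lemma resolvent_chain_iff:
  assumes p: "(f, p) \<in> mult_op B"
  shows "(kernel_op p, h) \<in> mult_op A \<longleftrightarrow> h = bs.kernel_op f"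
proof -
  have p_rep: "AE y in lborel. rep_l2 p y = B y *v rep_l2 f y"
    using p by (simp add: mult_op_def)
  have pointwise: "A x *v kernel_apply (rep_l2 p) x = bs.kernel_apply (rep_l2 f) x" for x
  proof -
    have "A x *v kernel_apply (rep_l2 p) x = (LINT y|lborel. A x *v (green k \<zeta> (x - y) *v rep_l2 p y))"
      unfolding kernel_apply_def
      by (rule integral_bounded_linear[symmetric, OF bounded_linear_matrix integrable_kernel[OF sq_integrable_rep]])
    also have "\<dots> = bs.kernel_apply (rep_l2 f) x"
      unfolding bs.kernel_apply_def
    proof (rule integral_cong_AE)
      show "AE y in lborel. A x *v (green k \<zeta> (x - y) *v rep_l2 p y) = (A x ** green k \<zeta> (x - y) ** B y) *v rep_l2 f y"
        using p_rep by eventually_elim (simp flip: matrix_vector_mul_assoc)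
    qed measurable
    finally show ?thesis .
  qed
  have eq: "AE x in lborel. rep_l2 (bs.kernel_op f) x = A x *v rep_l2 (kernel_op p) x"
    using rep_kernel_op[of p] bs.rep_kernel_op[of f] by eventually_elim (simp add: pointwise)
  show ?thesis
  proof
    assume "(kernel_op p, h) \<in> mult_op A"
    then have "AE x in lborel. rep_l2 h x = A x *v rep_l2 (kernel_op p) x" by (simp add: mult_op_def)
    with eq have "AE x in lborel. rep_l2 h x = rep_l2 (bs.kernel_op f) x" by eventually_elim simp
    then show "h = bs.kernel_op f" by (rule l2_eqI)
  next
    assume "h = bs.kernel_op f"
    then show "(kernel_op p, h) \<in> mult_op A" using eq by (simp add: mult_op_def)
  qed
qed

text \<open>Cutting \<open>g\<close> off to the set where the potential has norm at most
  \<open>n\<close> makes \<open>B\<close> bounded on it, and the cut-offs converge to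
  \<open>g\<close> by dominated convergence.\<close>

lemma dense_domain_B: "\<exists>f p. (\<forall>n. (f n, p n) \<in> mult_op B) \<and> f \<longlonglongrightarrow> g"
proof -
  let ?g = "rep_l2 g"
  define cut where "cut n x = (if onorm ((*v) (V' x)) \<le> real n then ?g x else 0)" for n :: nat and x
  have [measurable]: "cut n \<in> borel_measurable borel" for n
    unfolding cut_def[abs_def] by measurable
  have g_int: "integrable lborel (\<lambda>x. (norm (?g x))\<^sup>2)"
    using sq_integrable_rep[of g] by (simp add: sq_integrable_def)
  have sq: "sq_integrable (cut n)" for n
  proof -
    have "integrable lborel (\<lambda>x. (norm (cut n x))\<^sup>2)"
      by (rule Bochner_Integration.integrable_bound[OF g_int]) (auto simp: cut_def)
    then show ?thesis by (simp add: sq_integrable_def)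
  qed
  have sqB: "sq_integrable (\<lambda>x. B x *v cut n x)" for n
  proof -
    have "integrable lborel (\<lambda>x. (norm (B x *v cut n x))\<^sup>2)"
    proof (rule Bochner_Integration.integrable_bound)
      show "integrable lborel (\<lambda>x. real n * (norm (?g x))\<^sup>2)" using g_int by simp
      have "(norm (B x *v cut n x))\<^sup>2 \<le> real n * (norm (?g x))\<^sup>2" for x
      proof (cases "onorm ((*v) (V' x)) \<le> real n")
        case True
        have "(norm (B x *v cut n x))\<^sup>2 \<le> onorm ((*v) (V' x)) * (norm (cut n x))\<^sup>2"
          unfolding B_def by (rule norm_polar_sqrt_abs_le)
        also have "\<dots> \<le> real n * (norm (cut n x))\<^sup>2"
          using True by (intro mult_right_mono) auto
        finally show ?thesis using True by (simp add: cut_def)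
      qed (simp add: cut_def)
      then show "AE x in lborel. norm ((norm (B x *v cut n x))\<^sup>2) \<le> norm (real n * (norm (?g x))\<^sup>2)" by simp
    qed measurable
    then show ?thesis by (simp add: sq_integrable_def)
  qed
  define f p where "f n = abs_l2 (cut n)" and "p n = abs_l2 (\<lambda>x. B x *v cut n x)" for n
  have "(f n, p n) \<in> mult_op B" for n
    unfolding mult_op_def mem_Collect_eq case_prod_conv f_def p_def
    using rep_abs_l2[OF sq[of n]] rep_abs_l2[OF sqB[of n]] by eventually_elim simp
  moreover have "f \<longlonglongrightarrow> g"
  proof -
    have nsq: "(norm (f n - g))\<^sup>2 = (LINT x|lborel. (norm (cut n x - ?g x))\<^sup>2)" for n
    proof -
      have "f n - g = abs_l2 (\<lambda>x. cut n x - ?g x)"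
        using rep_l2_diff[of "f n" g] rep_abs_l2[OF sq[of n]] rep_abs_l2[OF sq_integrable_diff[OF sq[of n] sq_integrable_rep[of g]]]
        unfolding f_def by (intro l2_eqI, eventually_elim) simp
      then show ?thesis
        by (simp add: norm_abs_l2_square sq_integrable_diff sq)
    qed
    have "(\<lambda>n. LINT x|lborel. (norm (cut n x - ?g x))\<^sup>2) \<longlonglongrightarrow> (LINT x|(lborel :: real measure). 0 :: real)"
    proof (rule integral_dominated_convergence[where w = "\<lambda>x. (norm (?g x))\<^sup>2"])
      show "AE x in lborel. (\<lambda>n. (norm (cut n x - ?g x))\<^sup>2) \<longlonglongrightarrow> 0"
      proof (intro AE_I2 tendsto_eventually)
        fix x
        obtain M :: nat where M: "onorm ((*v) (V' x)) \<le> real M" using real_arch_simple by blast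
        show "\<forall>\<^sub>F n in sequentially. (norm (cut n x - ?g x))\<^sup>2 = 0"
          using M by (intro eventually_sequentiallyI[of M]) (simp add: cut_def)
      qed
    qed (use g_int in \<open>auto simp: cut_def\<close>)
    then have "(\<lambda>n. sqrt ((norm (f n - g))\<^sup>2)) \<longlonglongrightarrow> sqrt 0"
      unfolding nsq by (intro tendsto_real_sqrt) simp
    then have "(\<lambda>n. f n - g) \<longlonglongrightarrow> 0" by (simp add: tendsto_norm_zero_iff)
    then show ?thesis by (simp add: LIM_zero_iff)
  qed
  ultimately show ?thesis by blast
qed

text \<open>The product of graphs is the bounded Schur operator restricted to the domain of
  \<open>B\<close>. As that domain is dense and a bounded operator has closed graph, the closure is
  the whole operator.\<close>

lemma Q_eq: "Q m V z = {(f, bs.kernel_op f) | f. True}"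
proof -
  let ?G = "{(f, bs.kernel_op f) | f. True}"
  let ?S = "opA V [*] R0 m z [*] opB V"
  have S: "?S = {(f, bs.kernel_op f) | f. \<exists>p. (f, p) \<in> mult_op B}"
    unfolding opA_eq opB_eq op_comp_def resolvent_eq
    using resolvent_chain_iff by (auto simp: relcomp_unfold)
  have "closed ?G"
  proof -
    have G: "?G = {q. snd q = bs.kernel_op (fst q)}" by auto
    have "continuous_on UNIV (\<lambda>q :: l2 \<times> l2. bs.kernel_op (fst q))"
      by (intro bounded_linear.continuous_on[OF bs.bounded_linear_kernel_op] continuous_intros)
    then show ?thesis
      unfolding G by (rule closed_Collect_eq[OF continuous_on_snd[OF continuous_on_id]])
  qed
  then have "closure ?S \<subseteq> ?G"
    by (rule closure_minimal[rotated]) (auto simp: S)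
  moreover have "?G \<subseteq> closure ?S"
  proof clarify
    fix g
    obtain f p where fp: "\<And>n. (f n, p n) \<in> mult_op B" "f \<longlonglongrightarrow> g"
      using dense_domain_B[of g] by blast
    have "(\<lambda>n. (f n, bs.kernel_op (f n))) \<longlonglongrightarrow> (g, bs.kernel_op g)"
      by (intro tendsto_Pair fp(2) bounded_linear.tendsto[OF bs.bounded_linear_kernel_op])
    moreover have "(f n, bs.kernel_op (f n)) \<in> ?S" for n
      unfolding S using fp(1) by blast
    ultimately show "(g, bs.kernel_op g) \<in> closure ?S"
      unfolding closure_sequential by (intro exI[of _ "\<lambda>n. (f n, bs.kernel_op (f n))"]) simp
  qed
  ultimately show ?thesis unfolding Q_def by blast
qed

lemma minus_one_mem_resolvent_set_Q:
  assumes "green_bound \<zeta> * F V (Im k) < 1"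
  shows "-1 \<in> resolvent_set (Q m V z)"
proof -
  have scale: "scaleC (-1) f = - f" for f
  proof (rule l2_eqI)
    show "AE x in lborel. rep_l2 (scaleC (-1) f) x = rep_l2 (- f) x"
      using rep_l2_scaleC[of "-1" f] rep_l2_scaleR[of "-1" f, simplified] by eventually_elim (simp add: vec_eq_iff)
  qed
  have "Q m V z [-] op_scalar (-1) = {(f, f + bs.kernel_op f) | f. True}"
    unfolding Q_eq op_diff_def op_scalar_def by (auto simp: scale add.commute)
  then show ?thesis
    unfolding resolvent_set_def resolvent_def
    using bounded_everywhere_inverse_add[OF bs.bounded_linear_kernel_op assms bs.norm_kernel_op_le] by simp
qed

end

text \<open>Smallness puts \<open>z\<close> into \<open>good_points\<close>, and
  \<open>dirac_operator\<close> equates these with the common regular points of \<open>H\<close> and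
  \<open>H0\<close>. Knowing the resolvent set of \<open>H0\<close> provides the branch of the
  square root.\<close>

lemma (in potential) mem_resolvent_set_if_small:
  assumes m: "0 \<le> m" and H: "dirac_operator m V H" and z: "z \<in> resolvent_set (H0 m)"
    and small: "eta (cmod (Phi m z)) * F V (Im (branch_sqrt m z)) < 1"
  shows "z \<in> resolvent_set H"
proof -
  have "z \<notin> {of_real x | x. x \<le> - m \<or> m \<le> x}"
    using z by (simp add: resolvent_set_H0[OF m])
  note free = free_resolvent_branch_sqrt[OF this m]
  obtain V' where V': "V' \<in> borel_measurable borel" "AE x in lborel. V x = V' x"
    using ex_borel_version by blast
  interpret free_resolvent m z "branch_sqrt m z" "(z + of_real m) / branch_sqrt m z"
    by (rule free)
  interpret borel_potential V V' m z "branch_sqrt m z" "(z + of_real m) / branch_sqrt m z"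
    by unfold_locales (rule V')+
  have "z \<in> good_points m V"
    unfolding good_points_def using z minus_one_mem_resolvent_set_Q small by (simp add: green_bound_eq_eta)
  then show ?thesis
    using H unfolding dirac_operator_def by blast
qed

section \<open>Real energies inside the gap\<close>

lemma eta_Phi_gap:
  assumes "\<bar>x\<bar> < m"
  shows "eta (cmod (Phi m (of_real x))) = m / sqrt (m\<^sup>2 - x\<^sup>2)"
proof -
  have x2: "x\<^sup>2 < m\<^sup>2" using assms by (metis abs_ge_zero power2_abs power_strict_mono zero_less_numeral)
  have nz: "complex_of_real x \<noteq> of_real m" "complex_of_real x \<noteq> - of_real m"
    using assms by (auto simp flip: of_real_minus)
  have "cmod ((complex_of_real x)\<^sup>2 - (of_real m)\<^sup>2) = m\<^sup>2 - x\<^sup>2"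
  proof -
    have "cmod ((complex_of_real x)\<^sup>2 - (of_real m)\<^sup>2) = cmod (of_real (x\<^sup>2 - m\<^sup>2))" by simp
    also have "\<dots> = m\<^sup>2 - x\<^sup>2" using x2 unfolding norm_of_real by simp
    finally show ?thesis .
  qed
  then have "eta (cmod (Phi m (of_real x))) = 1 / sqrt 2 * sqrt (1 + (x\<^sup>2 + m\<^sup>2) / (m\<^sup>2 - x\<^sup>2))"
    using eta_Phi[OF nz] by simp
  also have "1 + (x\<^sup>2 + m\<^sup>2) / (m\<^sup>2 - x\<^sup>2) = 2 * (m\<^sup>2 / (m\<^sup>2 - x\<^sup>2))"
    using x2 by (simp add: field_simps)
  also have "1 / sqrt 2 * sqrt (2 * (m\<^sup>2 / (m\<^sup>2 - x\<^sup>2))) = m / sqrt (m\<^sup>2 - x\<^sup>2)"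
    using assms by (simp add: real_sqrt_mult real_sqrt_divide)
  finally show ?thesis .
qed

lemma branch_sqrt_gap:
  assumes "\<bar>x\<bar> < m"
  shows "Im (branch_sqrt m (of_real x)) = sqrt (m\<^sup>2 - x\<^sup>2)"
proof -
  have x2: "x\<^sup>2 < m\<^sup>2" using assms by (metis abs_ge_zero power2_abs power_strict_mono zero_less_numeral)
  define w where "w = branch_sqrt m (of_real x)"
  have w: "w\<^sup>2 = (of_real x)\<^sup>2 - (of_real m)\<^sup>2" "0 < Im w"
    unfolding w_def using branch_sqrt[of "of_real x" m] assms by (auto simp: abs_less_iff)
  have "(\<i> * of_real (sqrt (m\<^sup>2 - x\<^sup>2)))\<^sup>2 = w\<^sup>2"
    using x2 unfolding w(1) power_mult_distrib of_real_power[symmetric] by simp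
  then have "w = \<i> * of_real (sqrt (m\<^sup>2 - x\<^sup>2)) \<or> w = - (\<i> * of_real (sqrt (m\<^sup>2 - x\<^sup>2)))"
    by (metis power2_eq_iff)
  then show ?thesis
    unfolding w_def[symmetric] using w(2) x2 by auto
qed

theorem theorem4p3:
  fixes m :: real and V :: "real \<Rightarrow> complex^2^2" and H :: l2_op
  assumes m: "m \<ge> 0"
    and V: "\<And>i j. (\<lambda>x. V x $ i $ j) \<in> L1_plus_L0inf"
    and H: "dirac_operator m V H"
  shows "resolvent_set (H0 m) = - {of_real x | x. x \<le> - m \<or> m \<le> x} \<and>
    (\<forall>z \<in> resolvent_set (H0 m).
       eta (cmod (Phi m z)) * F V (Im (branch_sqrt m z)) < 1 \<longrightarrow> z \<notin> spectrum H) \<and>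
    (\<forall>\<mu>\<^sub>0 \<in> {- m<..<m}. m > 0 \<and> \<mu>\<^sub>0 > 0 \<and> F V \<mu>\<^sub>0 = \<mu>\<^sub>0 / m \<longrightarrow>
       (\<forall>\<mu>>0. F V \<mu> = \<mu> / m \<longrightarrow> \<mu> = \<mu>\<^sub>0) \<and>
       spectrum H \<inter> of_real ` {- sqrt (m\<^sup>2 - \<mu>\<^sub>0\<^sup>2)<..<sqrt (m\<^sup>2 - \<mu>\<^sub>0\<^sup>2)} = {})"
proof -
  interpret potential V by unfold_locales (rule V)
  have res: "z \<in> resolvent_set H"
    if "z \<in> resolvent_set (H0 m)" "eta (cmod (Phi m z)) * F V (Im (branch_sqrt m z)) < 1" for z
    by (rule mem_resolvent_set_if_small[OF m H that])
  have "(\<forall>\<mu>>0. F V \<mu> = \<mu> / m \<longrightarrow> \<mu> = \<mu>\<^sub>0) \<and>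
       spectrum H \<inter> of_real ` {- sqrt (m\<^sup>2 - \<mu>\<^sub>0\<^sup>2)<..<sqrt (m\<^sup>2 - \<mu>\<^sub>0\<^sup>2)} = {}"
    if \<mu>\<^sub>0: "\<mu>\<^sub>0 \<in> {- m<..<m}" "m > 0" "\<mu>\<^sub>0 > 0" "F V \<mu>\<^sub>0 = \<mu>\<^sub>0 / m" for \<mu>\<^sub>0
  proof
    show "\<forall>\<mu>>0. F V \<mu> = \<mu> / m \<longrightarrow> \<mu> = \<mu>\<^sub>0"
    proof (intro allI impI)
      fix \<mu> assume \<mu>: "0 < \<mu>" "F V \<mu> = \<mu> / m"
      show "\<mu> = \<mu>\<^sub>0"
      \<comment> \<open>A nonincreasing function meets the strictly increasing
        \<open>\<mu> / m\<close> at most once.\<close>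
      proof (cases "\<mu> \<le> \<mu>\<^sub>0")
        case True
        then have "\<mu>\<^sub>0 / m \<le> \<mu> / m" using F_antimono[OF \<mu>(1) True] \<mu> \<mu>\<^sub>0 by simp
        then show ?thesis using True \<mu>\<^sub>0(2) by (simp add: divide_le_cancel)
      next
        case False
        then have "\<mu> / m \<le> \<mu>\<^sub>0 / m" using F_antimono[OF \<mu>\<^sub>0(3), of \<mu>] \<mu> \<mu>\<^sub>0 by simp
        then show ?thesis using False \<mu>\<^sub>0(2) by (simp add: divide_le_cancel)
      qed
    qed
    have "complex_of_real x \<in> resolvent_set H" if x: "x \<in> {- sqrt (m\<^sup>2 - \<mu>\<^sub>0\<^sup>2)<..<sqrt (m\<^sup>2 - \<mu>\<^sub>0\<^sup>2)}" for x
    proof -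
      have "\<bar>x\<bar> < sqrt (m\<^sup>2 - \<mu>\<^sub>0\<^sup>2)" using x by auto
      then have x2: "x\<^sup>2 < m\<^sup>2 - \<mu>\<^sub>0\<^sup>2"
        by (metis real_sqrt_abs real_sqrt_less_iff)
      then have "\<mu>\<^sub>0\<^sup>2 < m\<^sup>2 - x\<^sup>2" by simp
      then have s: "\<mu>\<^sub>0 < sqrt (m\<^sup>2 - x\<^sup>2)" by (rule real_less_rsqrt)
      have "x\<^sup>2 < m\<^sup>2" using x2 zero_le_power2[of \<mu>\<^sub>0] by linarith
      then have xm: "\<bar>x\<bar> < m" using \<mu>\<^sub>0(2) by (metis abs_of_pos real_sqrt_abs real_sqrt_less_iff)
      \<comment> \<open>Monotonicity replaces \<open>F\<close> at the larger argument by its value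
        at \<open>\<mu>\<^sub>0\<close>; the factor \<open>m\<close> cancels and the quotient of
        \<open>\<mu>\<^sub>0\<close> by that larger argument remains.\<close>
      have "F V (sqrt (m\<^sup>2 - x\<^sup>2)) \<le> \<mu>\<^sub>0 / m"
        using F_antimono[OF \<mu>\<^sub>0(3), of "sqrt (m\<^sup>2 - x\<^sup>2)"] s \<mu>\<^sub>0(4) by simp
      then have "m / sqrt (m\<^sup>2 - x\<^sup>2) * F V (sqrt (m\<^sup>2 - x\<^sup>2)) \<le> m / sqrt (m\<^sup>2 - x\<^sup>2) * (\<mu>\<^sub>0 / m)"
        using s \<mu>\<^sub>0 \<open>x\<^sup>2 < m\<^sup>2\<close> by (intro mult_left_mono divide_nonneg_nonneg) auto
      also have "\<dots> = \<mu>\<^sub>0 / sqrt (m\<^sup>2 - x\<^sup>2)" using \<mu>\<^sub>0 by simp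
      also have "\<dots> < 1" using s \<mu>\<^sub>0(3) by (subst divide_less_eq_1_pos) linarith+
      finally have "eta (cmod (Phi m (of_real x))) * F V (Im (branch_sqrt m (of_real x))) < 1"
        unfolding eta_Phi_gap[OF xm] branch_sqrt_gap[OF xm] .
      moreover have "complex_of_real x \<in> resolvent_set (H0 m)"
        using xm by (auto simp: resolvent_set_H0[OF m] abs_less_iff)
      ultimately show ?thesis by (intro res)
    qed
    then show "spectrum H \<inter> of_real ` {- sqrt (m\<^sup>2 - \<mu>\<^sub>0\<^sup>2)<..<sqrt (m\<^sup>2 - \<mu>\<^sub>0\<^sup>2)} = {}"
      by (auto simp: spectrum_def)
  qed
  then show ?thesis
    using res resolvent_set_H0[OF m] unfolding spectrum_def by blast
qed

end
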